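(* Let $\overline{\rho}\in BV(\mathbb{R})\cap L^1(\mathbb{R})\cap L^\infty(\mathbb{R})$ be non-negative with compact support, and let $\overline{R}:=\|\overline{\rho}\|_{L^\infty(\mathbb{R})}$. Let $v\in C^1([0,\overline{R}])$ be strictly decreasing on $[0,\overline{R}]$, set $\phi(\rho):=\rho v'(\rho)$, and assume that there exists a constant $K\ge 0$ such that $$0\le \frac{\phi(\rho)-\phi(\sigma)}{v(\rho)-v(\sigma)}\le K\qquad\text{for all }\rho,\sigma\in[0,\overline{R}]\text{ with }\rho\ne\sigma.$$ Let $f(\rho):=\rho v(\rho)$. Then the Cauchy problem $$\rho_t+f(\rho)_x=0\ \text{ in }\mathbb{R}\times(0,+\infty),\qquad \rho(x,0)=\overline{\rho}(x),\ x\in\mathbb{R},$$ has at most one extended entropy solution (solutions being identified when they agree almost everywhere).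
   Context: Extended entropy solution. A function $\rho\in L^\infty([0,+\infty);L^1\cap L^\infty(\mathbb{R}))$, with values in $[0,\overline{R}]$ almost everywhere (so that $f(\rho)$ and $f'(\rho)$ make sense), is an extended entropy solution of the Cauchy problem with initial datum $\overline{\rho}$ if: (1) $\rho_t+f(\rho)_x=0$ in the sense of distributions on $\mathbb{R}\times(0,+\infty)$; (2) $\rho(\cdot,t)\to\overline{\rho}$ strongly in $L^1(\mathbb{R})$ as $t\searrow 0$ (for a suitable representative of $\rho$ in time); (3) there exists a constant $C\ge 1$ such that $f'(\rho)_x\le C/t$ in the sense of distributions, i.e. $\int_0^{+\infty}\int_{\mathbb{R}} f'(\rho(x,t))\varphi_x(x,t)\,dx\,dt\ge -\int_0^{+\infty}\int_{\mathbb{R}}\frac{C}{t}\varphi(x,t)\,dx\,dt$ for all $\varphi\in C_c^\infty(\mathbb{R}\times(0,+\infty))$ with $\varphi\ge 0$. The constant $C$ is allowed to depend on the solution. *)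

theory Defs
  imports "HOL-Analysis.Analysis" "HOL-Probability.Essential_Supremum"
begin

text \<open>\<open>Ck k g\<close>: \<open>g\<close> is \<open>k\<close> times continuously (Frechet) differentiable on the whole space.\<close>

primrec Ck :: "nat \<Rightarrow> ('a::euclidean_space \<Rightarrow> real) \<Rightarrow> bool" where
  "Ck 0 g \<longleftrightarrow> continuous_on UNIV g"
| "Ck (Suc k) g \<longleftrightarrow> (\<forall>x. g differentiable (at x)) \<and>
     (\<forall>b\<in>Basis. Ck k (\<lambda>x. frechet_derivative g (at x) b))"

definition Cc_infty :: "'a::euclidean_space set \<Rightarrow> ('a \<Rightarrow> real) set" where
  "Cc_infty \<Omega> = {\<phi>. (\<forall>k. Ck k \<phi>) \<and> compact (closure {z. \<phi> z \<noteq> 0})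
                    \<and> closure {z. \<phi> z \<noteq> 0} \<subseteq> \<Omega>}"

definition Linfty_norm :: "(real \<Rightarrow> real) \<Rightarrow> ereal" where
  "Linfty_norm u = esssup lebesgue (\<lambda>x. ereal \<bar>u x\<bar>)"

text \<open>Elements of \<open>BV(\<real>)\<close> are classes of functions modulo null sets, so the variation is the
  total mass of the distributional derivative, not the pointwise variation of a representative.\<close>

definition BV :: "(real \<Rightarrow> real) \<Rightarrow> bool" where
  "BV u \<longleftrightarrow> integrable lebesgue u \<and>
     (\<exists>M. \<forall>\<phi>\<in>Cc_infty UNIV. (\<forall>x. \<bar>\<phi> x\<bar> \<le> 1) \<longrightarrow> (LINT x|lebesgue. u x * deriv \<phi> x) \<le> M)"

definition essentially_compact_support :: "(real \<Rightarrow> real) \<Rightarrow> bool" where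
  "essentially_compact_support u \<longleftrightarrow> (\<exists>S. compact S \<and> (AE x in lebesgue. x \<notin> S \<longrightarrow> u x = 0))"

text \<open>Points of \<open>\<real> \<times> (0,\<infinity>)\<close> are pairs \<open>(x, t)\<close>, space first.\<close>

abbreviation half_plane :: "(real \<times> real) set" where
  "half_plane \<equiv> UNIV \<times> {0<..}"

abbreviation partial_x :: "(real \<times> real \<Rightarrow> real) \<Rightarrow> real \<times> real \<Rightarrow> real" where
  "partial_x \<phi> \<equiv> \<lambda>(x, t). deriv (\<lambda>y. \<phi> (y, t)) x"

abbreviation partial_t :: "(real \<times> real \<Rightarrow> real) \<Rightarrow> real \<times> real \<Rightarrow> real" where
  "partial_t \<phi> \<equiv> \<lambda>(x, t). deriv (\<lambda>s. \<phi> (x, s)) t"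

text \<open>\<open>L\<^sup>\<infinity>([0,\<infinity>); L\<^sup>1 \<inter> L\<^sup>\<infinity>(\<real>))\<close>, read as the measurable functions of \<open>(x, t)\<close> whose time slices
  are, for almost every time, bounded in \<open>L\<^sup>1\<close> and in \<open>L\<^sup>\<infinity>\<close> uniformly in time.\<close>

definition Linfty_L1_Linfty :: "(real \<times> real \<Rightarrow> real) \<Rightarrow> bool" where
  "Linfty_L1_Linfty \<rho> \<longleftrightarrow> \<rho> \<in> borel_measurable (lebesgue_on half_plane) \<and>
     (\<exists>M. AE t in lebesgue_on {0<..}.
        integrable lebesgue (\<lambda>x. \<rho> (x, t)) \<and> (LINT x|lebesgue. \<bar>\<rho> (x, t)\<bar>) \<le> M \<and>
        (AE x in lebesgue. \<bar>\<rho> (x, t)\<bar> \<le> M))"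

definition weak_solution :: "(real \<Rightarrow> real) \<Rightarrow> (real \<times> real \<Rightarrow> real) \<Rightarrow> bool" where
  "weak_solution f \<rho> \<longleftrightarrow> (\<forall>\<phi>\<in>Cc_infty half_plane.
     (LINT z|lebesgue_on half_plane. \<rho> z * partial_t \<phi> z + f (\<rho> z) * partial_x \<phi> z) = 0)"

text \<open>\<open>g\<close> is the representative in time: a map into \<open>L\<^sup>1(\<real>)\<close> that agrees with the slices of \<open>\<rho>\<close>
  for almost every time.\<close>

definition attains_initial_datum ::
    "(real \<Rightarrow> real) \<Rightarrow> (real \<times> real \<Rightarrow> real) \<Rightarrow> bool" where
  "attains_initial_datum \<rho>\<^sub>0 \<rho> \<longleftrightarrow> (\<exists>g :: real \<Rightarrow> real \<Rightarrow> real.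
     (AE t in lebesgue_on {0<..}. AE x in lebesgue. g t x = \<rho> (x, t)) \<and>
     (\<forall>t>0. integrable lebesgue (g t)) \<and>
     ((\<lambda>t. LINT x|lebesgue. \<bar>g t x - \<rho>\<^sub>0 x\<bar>) \<longlongrightarrow> 0) (at_right 0))"

definition one_sided_bound :: "(real \<Rightarrow> real) \<Rightarrow> (real \<times> real \<Rightarrow> real) \<Rightarrow> bool" where
  "one_sided_bound f' \<rho> \<longleftrightarrow> (\<exists>C\<ge>1. \<forall>\<phi>\<in>Cc_infty half_plane. (\<forall>z. \<phi> z \<ge> 0) \<longrightarrow>
     (LINT z|lebesgue_on half_plane. f' (\<rho> z) * partial_x \<phi> z)
       \<ge> - (LINT z|lebesgue_on half_plane. C / snd z * \<phi> z))"

text \<open>The flux is only given on \<open>[0,R]\<close>, so its derivative is taken within that interval (one-sided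
  at the end points). For \<open>R = 0\<close> it is an unspecified constant on the only admissible value.\<close>

definition extended_entropy_solution ::
    "real \<Rightarrow> (real \<Rightarrow> real) \<Rightarrow> (real \<Rightarrow> real) \<Rightarrow> (real \<times> real \<Rightarrow> real) \<Rightarrow> bool" where
  "extended_entropy_solution R f \<rho>\<^sub>0 \<rho> \<longleftrightarrow>
     Linfty_L1_Linfty \<rho> \<and>
     (AE z in lebesgue_on half_plane. \<rho> z \<in> {0..R}) \<and>
     weak_solution f \<rho> \<and>
     attains_initial_datum \<rho>\<^sub>0 \<rho> \<and>
     one_sided_bound (\<lambda>r. vector_derivative f (at r within {0..R})) \<rho>"

end

(* Only the concavity of f on [0,R] is used; the hypothesis on phi = r v' gives it, since
   f' = v + phi.  For two solutions u, w put e = u - w, F = f(u) - f(w) and let D be a potential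
   of e_t + F_x = 0, i.e. D_x = e and D_t = -F, with D = 0 at t = 0.  With b = f'(u) concavity
   gives b e <= F, that is D_t + b D_x <= 0, while b_x <= C/t by the one-sided bound.  Hence, for
   D_+ = max 0 D and p > C,
     (D_+^p)_t + (b D_+^p)_x <= (C/t) D_+^p ,
   so t^(-C) times the local integral of D_+^p over backward cones is non-increasing.  As
   |D| <= L t, this quantity tends to 0 for t -> 0, and D <= 0.  Exchanging u and w gives D = 0,
   hence e = 0.  The singular constant C/t is thus beaten by a large power of a Lipschitz function
   vanishing at t = 0.  The argument is carried out for mollifications of e and F, with errors that
   vanish in L^1_loc. *)

theory Submission
  imports Defs
begin

section \<open>Differentiation under the integral sign and test functions\<close>

text \<open>Two features keep the formal computation from being immediate. The speed
  \<open>b\<close> is merely bounded, so \<open>b e \<le> F\<close> is a pointwise nonlinear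
  relation that does not commute with mollification, and the one-sided bound may only be tested with
  smooth functions. Mollifying just \<open>e\<close> and \<open>F\<close> and leaving
  \<open>b\<close> rough resolves both: \<open>b e_n - F_n \<le> b (e_n - e) - (F_n - F)\<close>
  costs a plain L^1 error and no commutator estimate, and the positive part of the smooth potential,
  raised to a power at least 2, is C^1, hence a limit of admissible tests. The price is that the
  mollified potential does not vanish at t = 0; it is only uniformly small there, through the L^1
  attainment of the datum. A cutoff at time \<delta> absorbs this, and the limits are taken in the
  order n to infinity, then \<delta> to 0. Time monotonicity is replaced by one space-time integral:
  the factor \<open>max 0 (T - t)^2\<close> has derivative \<open>-2 max 0 (T - t)\<close>, which
  puts the quantity to be controlled on the good side.\<close>

lemma has_real_derivative_integral_dominated:
  fixes g g' :: "real \<Rightarrow> 'a \<Rightarrow> real"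
  assumes deriv: "\<And>x w. ((\<lambda>x. g x w) has_real_derivative g' x w) (at x)"
    and int: "\<And>x. integrable M (g x)"
    and meas: "g' x0 \<in> borel_measurable M"
    and bound: "\<And>x w. \<bar>x - x0\<bar> < 1 \<Longrightarrow> \<bar>g' x w\<bar> \<le> B w"
    and B: "integrable M B"
  shows "((\<lambda>x. \<integral>w. g x w \<partial>M) has_real_derivative (\<integral>w. g' x0 w \<partial>M)) (at x0)"
  unfolding has_field_derivative_iff
proof (rule tendsto_at_iff_sequentially[THEN iffD2], intro allI impI)
  fix X :: "nat \<Rightarrow> real" assume X: "\<forall>i. X i \<in> UNIV - {x0}" "X \<longlonglongrightarrow> x0"
  then have ne: "X i - x0 \<noteq> 0" for i by auto
  \<comment> \<open>The majorant \<open>B\<close> is available only within distance 1 of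
    \<open>x0\<close>, so the sequence is shifted by \<open>n0\<close> before dominated convergence
    is applied to the difference quotients; the mean value inequality bounds these by
    \<open>B\<close>.\<close>
  have "eventually (\<lambda>i. dist (X i) x0 < 1) sequentially"
    using X(2) tendstoD zero_less_one by blast
  then obtain n0 where n0: "\<And>i. i \<ge> n0 \<Longrightarrow> \<bar>X i - x0\<bar> < 1"
    by (auto simp: eventually_sequentially dist_real_def)
  let ?q = "\<lambda>i w. (g (X i) w - g x0 w) / (X i - x0)"
  have "(\<lambda>i. \<integral>w. ?q (i + n0) w \<partial>M) \<longlonglongrightarrow> (\<integral>w. g' x0 w \<partial>M)"
  proof (rule integral_dominated_convergence[where w=B])
    show "AE w in M. (\<lambda>i. ?q (i + n0) w) \<longlonglongrightarrow> g' x0 w"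
    proof (rule AE_I2)
      fix w
      have "((\<lambda>y. (g y w - g x0 w) / (y - x0)) \<longlongrightarrow> g' x0 w) (at x0)"
        using deriv[of w x0] by (simp add: has_field_derivative_iff)
      then have "(\<lambda>i. ?q i w) \<longlonglongrightarrow> g' x0 w"
        using X unfolding tendsto_at_iff_sequentially by (auto simp: o_def)
      then show "(\<lambda>i. ?q (i + n0) w) \<longlonglongrightarrow> g' x0 w" by (rule LIMSEQ_ignore_initial_segment)
    qed
    show "AE w in M. norm (?q (i + n0) w) \<le> B w" for i
    proof (rule AE_I2)
      fix w
      have lt: "\<bar>X (i + n0) - x0\<bar> < 1" using n0 by simp
      have "norm (g (X (i + n0)) w - g x0 w) \<le> B w * norm (X (i + n0) - x0)"
      proof (rule field_differentiable_bound[where S="ball x0 1" and f'="\<lambda>x. g' x w"])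
        show "((\<lambda>x. g x w) has_field_derivative g' z w) (at z within ball x0 1)" for z
          using deriv has_field_derivative_at_within by blast
        show "norm (g' z w) \<le> B w" if "z \<in> ball x0 1" for z
          using bound[of z w] that by (auto simp: dist_real_def abs_minus_commute)
      qed (use lt in \<open>auto simp: dist_real_def abs_minus_commute\<close>)
      then show "norm (?q (i + n0) w) \<le> B w"
        using ne[of "i + n0"] by (auto simp: divide_simps)
    qed
  qed (use int meas B in auto)
  then have "(\<lambda>i. \<integral>w. ?q i w \<partial>M) \<longlonglongrightarrow> (\<integral>w. g' x0 w \<partial>M)" by (rule LIMSEQ_offset)
  moreover have "(\<lambda>i. \<integral>w. ?q i w \<partial>M) = (\<lambda>i. ((\<integral>w. g (X i) w \<partial>M) - (\<integral>w. g x0 w \<partial>M)) / (X i - x0))"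
    using int by simp
  ultimately show "((\<lambda>x. ((\<integral>w. g x w \<partial>M) - (\<integral>w. g x0 w \<partial>M)) / (x - x0)) \<circ> X) \<longlonglongrightarrow> (\<integral>w. g' x0 w \<partial>M)"
    unfolding o_def by simp
qed

section \<open>Integrals of bounded functions against compactly supported kernels\<close>

lemma integrable_indicator_cball:
  "integrable lborel (\<lambda>w. c * indicator (cball (a::'b::euclidean_space) r) w :: real)"
proof -
  have "emeasure lborel (cball a r) < \<infinity>" by (rule emeasure_bounded_finite) simp
  then show ?thesis by (intro integrable_mult_right integrable_real_indicator) auto
qed

lemma integrable_bounded_compact:
  fixes g :: "'b::euclidean_space \<Rightarrow> real"
  assumes "g \<in> borel_measurable borel" "\<And>w. \<bar>g w\<bar> \<le> c" "\<And>w. norm w > r \<Longrightarrow> g w = 0"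
  shows "integrable lborel g"
proof (rule Bochner_Integration.integrable_bound)
  show "integrable lborel (\<lambda>w. c * indicator (cball 0 r) w :: real)"
    by (rule integrable_indicator_cball)
  have "0 \<le> c" using assms(2) abs_ge_zero order_trans by blast
  then show "AE w in lborel. norm (g w) \<le> norm (c * indicator (cball 0 r) w :: real)"
    using assms(2,3) by (auto simp: indicator_def)
qed (use assms in simp)

lemma continuous_compact_support_bounded:
  fixes g :: "'b::euclidean_space \<Rightarrow> real"
  assumes "continuous_on UNIV g" "\<And>w. norm w > r \<Longrightarrow> g w = 0"
  obtains c where "c \<ge> 0" "\<And>w. \<bar>g w\<bar> \<le> c"
proof -
  have "bounded (g ` cball 0 r)"
    by (intro compact_imp_bounded compact_continuous_image continuous_on_subset[OF assms(1)]) auto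
  then obtain c where c: "\<And>w. norm w \<le> r \<Longrightarrow> \<bar>g w\<bar> \<le> c"
    unfolding bounded_iff by (metis imageI mem_cball_0 real_norm_def)
  have "\<bar>g w\<bar> \<le> max c 0" for w
    using c[of w] assms(2)[of w] by (cases "norm w \<le> r") auto
  then show ?thesis using that[of "max c 0"] by auto
qed

lemma integrable_mult_compact:
  fixes u g :: "'b::euclidean_space \<Rightarrow> real"
  assumes u: "u \<in> borel_measurable borel" "\<And>w. \<bar>u w\<bar> \<le> L"
    and g: "continuous_on UNIV g" "\<And>w. norm w > r \<Longrightarrow> g w = 0"
  shows "integrable lborel (\<lambda>w. u w * g w)"
proof -
  obtain c where c: "c \<ge> 0" "\<And>w. \<bar>g w\<bar> \<le> c" using continuous_compact_support_bounded[OF g] by blast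
  have [measurable]: "g \<in> borel_measurable borel" using g(1) by (rule borel_measurable_continuous_onI)
  show ?thesis
  proof (rule integrable_bounded_compact)
    show "\<bar>u w * g w\<bar> \<le> L * c" for w
      using u(2)[of w] c(2)[of w] by (auto simp: abs_mult intro!: mult_mono)
    show "u w * g w = 0" if "norm w > r" for w using g(2) that by simp
  qed (use u in measurable)
qed

text \<open>The density \<open>u\<close> carries no regularity, so all differentiability sits in the
  kernel \<open>P\<close>. Locally uniform compact support in \<open>w\<close> provides the
  dominating function: a constant times the indicator of a ball.\<close>

lemma has_real_derivative_integral_compact:
  fixes P P' :: "real \<Rightarrow> 'b::euclidean_space \<Rightarrow> real"
  assumes u: "u \<in> borel_measurable borel" "\<And>w. \<bar>u w\<bar> \<le> L"
    and deriv: "\<And>x w. ((\<lambda>x. P x w) has_real_derivative P' x w) (at x)"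
    and cP: "\<And>x. continuous_on UNIV (P x)"
    and cP': "continuous_on UNIV (\<lambda>(x, w). P' x w)"
    and supp: "\<And>x0. \<exists>r. \<forall>x w. \<bar>x - x0\<bar> < 2 \<longrightarrow> norm w > r \<longrightarrow> P x w = 0"
  shows "((\<lambda>x. LBINT w. u w * P x w) has_real_derivative (LBINT w. u w * P' x0 w)) (at x0)"
proof -
  obtain r where r: "\<And>x w. \<bar>x - x0\<bar> < 2 \<Longrightarrow> norm w > r \<Longrightarrow> P x w = 0" using supp by blast
  \<comment> \<open>For \<open>norm w > r\<close> the kernel vanishes at all parameters within 2 of
    \<open>x0\<close>, hence on a unit neighbourhood of any parameter within 1. This is why the
    support hypothesis has radius 2, while the derivative is known to vanish with radius 1.\<close>
  have r': "P' x w = 0" if "\<bar>x - x0\<bar> < 1" "norm w > r" for x w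
  proof -
    have "((\<lambda>x. P x w) has_real_derivative 0) (at x)"
    proof (rule DERIV_cong_ev[OF refl _ refl, THEN iffD1, OF _ DERIV_const[of 0]])
      show "eventually (\<lambda>y. 0 = P y w) (nhds x)"
        unfolding eventually_nhds_metric
      proof (intro exI[of _ 1] conjI allI impI)
        fix y assume "dist y x < 1"
        then have "\<bar>y - x0\<bar> < 2" using that by (simp add: dist_real_def)
        then show "0 = P y w" using r that by simp
      qed simp
    qed
    then show ?thesis using DERIV_unique deriv by blast
  qed
  have "compact (cbox (x0 - 1) (x0 + 1) \<times> cball (0::'b) r)"
    by (intro compact_Times) auto
  then have "bounded ((\<lambda>(x, w). P' x w) ` (cbox (x0 - 1) (x0 + 1) \<times> cball 0 r))"
    by (intro compact_imp_bounded compact_continuous_image continuous_on_subset[OF cP']) auto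
  then obtain c where c: "\<And>x w. \<bar>x - x0\<bar> \<le> 1 \<Longrightarrow> norm w \<le> r \<Longrightarrow> \<bar>P' x w\<bar> \<le> c"
    unfolding bounded_iff by (fastforce simp: abs_le_iff)
  have cPx: "continuous_on UNIV (P' x)" for x
    using continuous_on_compose2[OF cP', of UNIV "\<lambda>w. (x, w)"] by (simp add: continuous_on_Pair continuous_on_const continuous_on_id)
  have L: "L \<ge> 0" using u(2) abs_ge_zero order_trans by blast
  show ?thesis
  proof (rule has_real_derivative_integral_dominated[where B="\<lambda>w. L * (\<bar>c\<bar> * indicator (cball (0::'b) r) w)"])
    show "((\<lambda>x. u w * P x w) has_real_derivative u w * P' x w) (at x)" for x w
      by (intro DERIV_cmult deriv)
    show "integrable lborel (\<lambda>w. u w * P x w)" for x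
    proof -
      obtain s where "\<And>y w. \<bar>y - x\<bar> < 2 \<Longrightarrow> norm w > s \<Longrightarrow> P y w = 0" using supp[of x] by blast
      then have "\<And>w. norm w > s \<Longrightarrow> P x w = 0" by simp
      then show ?thesis by (intro integrable_mult_compact[OF u cP])
    qed
    have [measurable]: "P' x0 \<in> borel_measurable borel" by (rule borel_measurable_continuous_onI[OF cPx])
    show "(\<lambda>w. u w * P' x0 w) \<in> borel_measurable lborel" using u by measurable
    show "\<bar>u w * P' x w\<bar> \<le> L * (\<bar>c\<bar> * indicator (cball 0 r) w)" if "\<bar>x - x0\<bar> < 1" for x w
      unfolding abs_mult
    proof (rule mult_mono)
      show "\<bar>P' x w\<bar> \<le> \<bar>c\<bar> * indicator (cball 0 r) w"
        using c[of x w] r'[of x w] that by (auto simp: indicator_def)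
    qed (use u L in auto)
    show "integrable lborel (\<lambda>w. L * (\<bar>c\<bar> * indicator (cball (0::'b) r) w :: real))"
      by (intro integrable_mult_right integrable_indicator_cball)
  qed
qed

lemma continuous_on_integral_compact:
  fixes Q :: "'a::euclidean_space \<Rightarrow> 'b::euclidean_space \<Rightarrow> real"
  assumes u: "u \<in> borel_measurable borel" "\<And>w. \<bar>u w\<bar> \<le> L"
    and cQ: "continuous_on UNIV (\<lambda>(z, w). Q z w)"
    and supp: "\<And>z0. \<exists>r. \<forall>z w. dist z z0 \<le> 1 \<longrightarrow> norm w > r \<longrightarrow> Q z w = 0"
  shows "continuous_on UNIV (\<lambda>z. LBINT w. u w * Q z w)"
  unfolding continuous_on_sequentially
proof (intro allI ballI impI)
  fix X :: "nat \<Rightarrow> 'a" and z0 assume X: "(\<forall>n. X n \<in> UNIV) \<and> X \<longlonglongrightarrow> z0"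
  obtain r where r: "\<And>z w. dist z z0 \<le> 1 \<Longrightarrow> norm w > r \<Longrightarrow> Q z w = 0" using supp by blast
  have "compact (cball z0 1 \<times> cball (0::'b) r)"
    by (intro compact_Times) auto
  then have "bounded ((\<lambda>(x, w). Q x w) ` (cball z0 1 \<times> cball (0::'b) r))"
    by (intro compact_imp_bounded compact_continuous_image continuous_on_subset[OF cQ]) auto
  then obtain c where c: "\<And>x w. dist x z0 \<le> 1 \<Longrightarrow> norm w \<le> r \<Longrightarrow> \<bar>Q x w\<bar> \<le> c"
    unfolding bounded_iff by (fastforce simp: dist_commute)
  have L: "L \<ge> 0" using u(2) abs_ge_zero order_trans by blast
  have cQx: "continuous_on UNIV (Q x)" for x
    using continuous_on_compose2[OF cQ, of UNIV "\<lambda>w. (x, w)"] by (simp add: continuous_on_Pair continuous_on_const continuous_on_id)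
  have [measurable]: "Q x \<in> borel_measurable borel" for x by (rule borel_measurable_continuous_onI[OF cQx])
  obtain n0 where n0: "\<And>i. i \<ge> n0 \<Longrightarrow> dist (X i) z0 \<le> 1"
    using X tendstoD[of X z0 sequentially 1] by (fastforce simp: eventually_sequentially)
  have "(\<lambda>i. LBINT w. u w * Q (X (i + n0)) w) \<longlonglongrightarrow> (LBINT w. u w * Q z0 w)"
  proof (rule integral_dominated_convergence[where w="\<lambda>w. L * (\<bar>c\<bar> * indicator (cball (0::'b) r) w)"])
    show "AE w in lborel. (\<lambda>i. u w * Q (X (i + n0)) w) \<longlonglongrightarrow> u w * Q z0 w"
    proof (intro AE_I2 tendsto_mult tendsto_const)
      fix w :: 'b
      have lim: "((\<lambda>i. (X (i + n0), w)) \<longlongrightarrow> (z0, w)) sequentially"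
        using X by (intro tendsto_intros LIMSEQ_ignore_initial_segment) auto
      have "(\<lambda>i. (\<lambda>(z, w). Q z w) (X (i + n0), w)) \<longlonglongrightarrow> (\<lambda>(z, w). Q z w) (z0, w)"
        by (rule continuous_on_tendsto_compose[OF cQ lim]) auto
      then
      show "(\<lambda>i. Q (X (i + n0)) w) \<longlonglongrightarrow> Q z0 w" by auto
    qed
    show "AE w in lborel. norm (u w * Q (X (i + n0)) w) \<le> L * (\<bar>c\<bar> * indicator (cball 0 r) w)" for i
      unfolding real_norm_def abs_mult
    proof (intro AE_I2 mult_mono)
      fix w
      show "\<bar>Q (X (i + n0)) w\<bar> \<le> \<bar>c\<bar> * indicator (cball 0 r) w"
        using c[of "X (i + n0)" w] r[of "X (i + n0)" w] n0[of "i + n0"] by (auto simp: indicator_def)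
    qed (use u L in auto)
    show "integrable lborel (\<lambda>w. L * (\<bar>c\<bar> * indicator (cball (0::'b) r) w :: real))"
      by (intro integrable_mult_right integrable_indicator_cball)
  qed (use u in measurable)
  then show "((\<lambda>z. LBINT w. u w * Q z w) \<circ> X) \<longlonglongrightarrow> (LBINT w. u w * Q z0 w)"
    unfolding o_def by (rule LIMSEQ_offset)
qed

section \<open>Integrals of derivatives of compactly supported functions\<close>

lemma lborel_integral_translation:
  fixes g :: "'b::euclidean_space \<Rightarrow> real"
  assumes "g \<in> borel_measurable borel"
  shows "(LBINT z. g (a + z)) = (LBINT z. g z)"
proof -
  have "(LBINT z. g z) = (\<integral>z. g z \<partial>distr lborel borel ((+) a))"
    by (simp add: lborel_distr_plus)
  also have "\<dots> = (LBINT z. g (a + z))"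
    using assms by (subst integral_distr) auto
  finally show ?thesis by simp
qed

text \<open>By translation invariance the integral of \<open>g (h *\<^sub>R d + z)\<close> over z
  does not depend on h; differentiating under the integral at h = 0 gives the claim. This replaces
  Fubini and the fundamental theorem of calculus.\<close>

lemma integral_directional_derivative_eq_0:
  fixes g g' :: "'b::euclidean_space \<Rightarrow> real"
  assumes deriv: "\<And>h z. ((\<lambda>h. g (h *\<^sub>R d + z)) has_real_derivative g' (h *\<^sub>R d + z)) (at h)"
    and c: "continuous_on UNIV g" "continuous_on UNIV g'"
    and supp: "\<And>z. norm z > r \<Longrightarrow> g z = 0"
  shows "(LBINT z. g' z) = 0"
proof -
  have "((\<lambda>h. LBINT z. 1 * g (h *\<^sub>R d + z)) has_real_derivative (LBINT z. 1 * g' (0 *\<^sub>R d + z))) (at 0)"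
  proof (rule has_real_derivative_integral_compact[where L=1 and P="\<lambda>h z. g (h *\<^sub>R d + z)" and P'="\<lambda>h z. g' (h *\<^sub>R d + z)"])
    show "\<exists>r. \<forall>x w. \<bar>x - x0\<bar> < 2 \<longrightarrow> r < norm w \<longrightarrow> g (x *\<^sub>R d + w) = 0" for x0
    proof (intro exI allI impI)
      fix x and w :: 'b assume *: "\<bar>x - x0\<bar> < 2" "r + (\<bar>x0\<bar> + 2) * norm d < norm w"
      have "norm w \<le> norm (x *\<^sub>R d + w) + norm (x *\<^sub>R d)"
        by (metis add_diff_cancel_left' norm_triangle_sub add.commute norm_triangle_ineq4)
      also have "norm (x *\<^sub>R d) \<le> (\<bar>x0\<bar> + 2) * norm d"
        using *(1) by (auto intro!: mult_right_mono)
      finally show "g (x *\<^sub>R d + w) = 0" using * by (intro supp) linarith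
    qed
    show "continuous_on UNIV (\<lambda>z. g (x *\<^sub>R d + z))" for x
      by (intro continuous_on_compose2[OF c(1)] continuous_intros) auto
    show "continuous_on UNIV (\<lambda>(x, z). g' (x *\<^sub>R d + z))"
      unfolding split_beta by (intro continuous_on_compose2[OF c(2)] continuous_intros) auto
  qed (use deriv in auto)
  moreover have "(\<lambda>h. LBINT z. 1 * g (h *\<^sub>R d + z)) = (\<lambda>h. LBINT z. g z)"
    using borel_measurable_continuous_onI[OF c(1)] by (auto intro!: ext lborel_integral_translation)
  ultimately have "((\<lambda>h::real. LBINT z. g z) has_real_derivative (LBINT z. g' z)) (at 0)" by simp
  then show ?thesis using DERIV_unique DERIV_const by blast
qed

lemma integral_partial_x_eq_0:
  fixes g g' :: "real \<times> real \<Rightarrow> real"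
  assumes deriv: "\<And>x t. ((\<lambda>x. g (x, t)) has_real_derivative g' (x, t)) (at x)"
    and c: "continuous_on UNIV g" "continuous_on UNIV g'"
    and supp: "\<And>z. norm z > r \<Longrightarrow> g z = 0"
  shows "(LBINT z. g' z) = 0"
proof (rule integral_directional_derivative_eq_0[where d="(1, 0)", OF _ c supp])
  fix h :: real and z :: "real \<times> real"
  have "((\<lambda>h. g (fst z + h, snd z)) has_real_derivative g' (fst z + h, snd z)) (at h)"
    using deriv[of "snd z" "fst z + h"] by (simp add: DERIV_shift add.commute)
  then show "((\<lambda>h. g (h *\<^sub>R (1, 0) + z)) has_real_derivative g' (h *\<^sub>R (1, 0) + z)) (at h)"
    by (cases z) (simp add: add.commute)
qed

lemma integral_partial_t_eq_0:
  fixes g g' :: "real \<times> real \<Rightarrow> real"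
  assumes deriv: "\<And>x t. ((\<lambda>t. g (x, t)) has_real_derivative g' (x, t)) (at t)"
    and c: "continuous_on UNIV g" "continuous_on UNIV g'"
    and supp: "\<And>z. norm z > r \<Longrightarrow> g z = 0"
  shows "(LBINT z. g' z) = 0"
proof (rule integral_directional_derivative_eq_0[where d="(0, 1)", OF _ c supp])
  fix h :: real and z :: "real \<times> real"
  have "((\<lambda>h. g (fst z, snd z + h)) has_real_derivative g' (fst z, snd z + h)) (at h)"
    using deriv[of "fst z" "snd z + h"] by (simp add: DERIV_shift add.commute)
  then show "((\<lambda>h. g (h *\<^sub>R (0, 1) + z)) has_real_derivative g' (h *\<^sub>R (0, 1) + z)) (at h)"
    by (cases z) (simp add: add.commute)
qed

section \<open>Infinite differentiability on the plane\<close>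

lemma has_derivative_partials_real:
  fixes g gx gt :: "real \<times> real \<Rightarrow> real"
  assumes dx: "\<And>x t. ((\<lambda>y. g (y, t)) has_real_derivative gx (x, t)) (at x)"
    and dt: "\<And>x t. ((\<lambda>s. g (x, s)) has_real_derivative gt (x, t)) (at t)"
    and c: "continuous_on UNIV gt"
  shows "(g has_derivative (\<lambda>h. fst h * gx z + snd h * gt z)) (at z)"
proof -
  have "((\<lambda>(x, y). g (x, y)) has_derivative (\<lambda>(tx, ty). gx z * tx + blinfun_apply (blinfun_scaleR_left (gt (fst z, snd z))) ty))
     (at (fst z, snd z) within UNIV \<times> UNIV)"
  proof (rule has_derivative_partialsI)
    show "((\<lambda>x. g (x, snd z)) has_derivative (*) (gx z)) (at (fst z))"
      using dx[where x="fst z" and t="snd z"] by (simp add: has_field_derivative_def)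
    show "((\<lambda>y. g (x, y)) has_derivative blinfun_apply (blinfun_scaleR_left (gt (x, y)))) (at y)" for x y
      using dt[of x y] by (simp add: has_field_derivative_def mult_commute_abs)
    have "continuous_on UNIV (\<lambda>z. blinfun_scaleR_left (gt z) :: real \<Rightarrow>\<^sub>L real)"
      by (intro bounded_linear.continuous_on[OF bounded_linear_blinfun_scaleR_left] c)
    then show "continuous (at (fst z, snd z) within UNIV \<times> UNIV) (\<lambda>(x, y). blinfun_scaleR_left (gt (x, y)) :: real \<Rightarrow>\<^sub>L real)"
      unfolding case_prod_unfold prod.collapse by (simp add: continuous_on_eq_continuous_at del: split_paired_All)
  qed auto
  then show ?thesis by (simp add: case_prod_unfold mult.commute)
qed

text \<open>Induction on the order: the partial derivatives stay in the class. The closure condition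
  lets smoothness of products and of convolutions be checked once for a whole family, without
  computing each higher derivative.\<close>

lemma Ck_of_closed_class:
  fixes S :: "(real \<times> real \<Rightarrow> real) set"
  assumes cont: "\<And>g. g \<in> S \<Longrightarrow> continuous_on UNIV g"
    and part: "\<And>g. g \<in> S \<Longrightarrow> \<exists>gx\<in>S. \<exists>gt\<in>S. (\<forall>x t. ((\<lambda>y. g (y, t)) has_real_derivative gx (x, t)) (at x)) \<and>
       (\<forall>x t. ((\<lambda>s. g (x, s)) has_real_derivative gt (x, t)) (at t))"
  shows "g \<in> S \<Longrightarrow> Ck k g"
proof (induction k arbitrary: g)
  case 0
  then show ?case using cont by simp
next
  case (Suc k)
  obtain gx gt where S: "gx \<in> S" "gt \<in> S" and
    d: "\<And>x t. ((\<lambda>y. g (y, t)) has_real_derivative gx (x, t)) (at x)"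
       "\<And>x t. ((\<lambda>s. g (x, s)) has_real_derivative gt (x, t)) (at t)"
    using part[OF Suc.prems] by blast
  have D: "(g has_derivative (\<lambda>h. fst h * gx z + snd h * gt z)) (at z)" for z
    using has_derivative_partials_real[OF d cont[OF S(2)]] .
  have "frechet_derivative g (at z) = (\<lambda>h. fst h * gx z + snd h * gt z)" for z
    using frechet_derivative_at[OF D] by simp
  moreover have "g differentiable (at z)" for z using D[of z] unfolding differentiable_def by blast
  ultimately show ?case
    using Suc.IH[OF S(1)] Suc.IH[OF S(2)] by (auto simp: Basis_prod_def)
qed

section \<open>A smooth transition function\<close>

text \<open>At the two end points of a bump the formula changes and no chain rule applies; a
  quadratic bound there forces the difference quotient to 0.\<close>

lemma has_real_derivative_0_if_quadratic:
  fixes g :: "real \<Rightarrow> real"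
  assumes "g a = 0" "\<And>x. \<bar>g x\<bar> \<le> c * (x - a)^2"
  shows "(g has_real_derivative 0) (at a)"
  unfolding has_field_derivative_iff
proof (rule Lim_null_comparison)
  have "norm ((g y - g a) / (y - a)) \<le> c * \<bar>y - a\<bar>" for y
    using assms(1) assms(2)[of y] by (cases "y = a") (auto simp: divide_simps power2_eq_square abs_mult_self_eq mult.assoc)
  then show "\<forall>\<^sub>F y in at a. norm ((g y - g a) / (y - a)) \<le> c * \<bar>y - a\<bar>" by simp
  have "((\<lambda>y. c * \<bar>y - a\<bar>) \<longlongrightarrow> c * \<bar>a - a\<bar>) (at a)" by (intro tendsto_intros)
  then show "((\<lambda>y. c * \<bar>y - a\<bar>) \<longlongrightarrow> 0) (at a)" by simp
qed

text \<open>A single term of the exponential series is at most its sum, all terms being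
  non-negative.\<close>

lemma power_le_fact_mult_exp:
  fixes x :: real
  assumes "x \<ge> 0"
  shows "x ^ n \<le> fact n * exp x"
proof -
  have "sum (\<lambda>n. x^n /\<^sub>R fact n) {n} \<le> (\<Sum>n. x^n /\<^sub>R fact n)"
    using exp_converges[of x] assms by (intro sum_le_suminf) (auto simp: sums_iff)
  then have "x ^ n / fact n \<le> exp x"
    using exp_converges[of x] by (auto simp: sums_iff divide_inverse mult.commute)
  then show ?thesis by (simp add: field_simps)
qed

text \<open>The classical function exp (- 1/q) with q = (x - 1) (2 - x), multiplied by a polynomial
  and a power of 1/q. The two parameters make the family closed under differentiation, so
  derivatives of every order have the same shape.\<close>

definition bump :: "real poly \<Rightarrow> nat \<Rightarrow> real \<Rightarrow> real" where
  "bump P k x = (if 1 < x \<and> x < 2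
     then poly P x * inverse ((x - 1) * (2 - x)) ^ k * exp (- inverse ((x - 1) * (2 - x))) else 0)"

text \<open>With y = 1/q, the estimate \<open>y ^ (k + 2) \<le> fact (k + 2) * exp y\<close> turns
  into \<open>y ^ k * exp (- y) \<le> fact (k + 2) * q ^ 2\<close>: the exponential beats every pole
  and leaves two spare factors of q, that is, a double zero at each end point.\<close>

lemma bump_quadratic:
  obtains c where "\<And>x. \<bar>bump P k x\<bar> \<le> c * (x - 1)^2" "\<And>x. \<bar>bump P k x\<bar> \<le> c * (x - 2)^2"
proof -
  have "bounded (poly P ` {1..2})"
    by (intro compact_imp_bounded compact_continuous_image) (auto intro!: continuous_intros)
  then obtain m where m: "\<And>x. 1 \<le> x \<Longrightarrow> x \<le> 2 \<Longrightarrow> \<bar>poly P x\<bar> \<le> m"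
    unfolding bounded_iff by force
  have m0: "m \<ge> 0" using m[of 1] by force
  let ?c = "m * fact (k + 2)"
  have main: "\<bar>bump P k x\<bar> \<le> ?c * ((x - 1) * (2 - x))^2" if "1 < x" "x < 2" for x
  proof -
    define q where "q = (x - 1) * (2 - x)"
    have q: "q > 0" using that by (simp add: q_def)
    define Z :: real where "Z = fact (k + 2)"
    have "inverse q ^ (k + 2) \<le> Z * exp (inverse q)"
      unfolding Z_def using q by (intro power_le_fact_mult_exp) simp
    then have "inverse q ^ k * exp (- inverse q) \<le> Z * q^2"
      using q by (simp add: exp_minus field_simps power_add power2_eq_square)
    then have "inverse q ^ k * exp (- inverse q) \<le> fact (k + 2) * q^2" by (simp add: Z_def)
    then have "m * (inverse q ^ k * exp (- inverse q)) \<le> m * (fact (k + 2) * q^2)"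
      using m0 by (intro mult_left_mono)
    moreover have "\<bar>bump P k x\<bar> \<le> m * (inverse q ^ k * exp (- inverse q))"
      using that q m[of x] unfolding bump_def q_def[symmetric] by (auto simp: abs_mult mult.assoc intro!: mult_right_mono)
    ultimately show ?thesis by (simp add: q_def mult.assoc)
  qed
  show ?thesis
  proof (rule that[of ?c])
    fix x
    show "\<bar>bump P k x\<bar> \<le> ?c * (x - 1)^2"
    proof (cases "1 < x \<and> x < 2")
      case True
      then have "((x - 1) * (2 - x))^2 \<le> (x - 1)^2" by (intro power_mono) (auto simp: mult_left_le)
      then have "?c * ((x - 1) * (2 - x))^2 \<le> ?c * (x - 1)^2" using m0 by (intro mult_left_mono) simp_all
      then show ?thesis using main[of x] True by linarith
    qed (use m0 in \<open>auto simp: bump_def\<close>)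
    show "\<bar>bump P k x\<bar> \<le> ?c * (x - 2)^2"
    proof (cases "1 < x \<and> x < 2")
      case True
      then have "((x - 1) * (2 - x))^2 \<le> (2 - x)^2" by (intro power_mono) (auto simp: mult_left_le_one_le)
      then have "?c * ((x - 1) * (2 - x))^2 \<le> ?c * (x - 2)^2"
        unfolding power2_commute[of x 2] using m0 by (intro mult_left_mono) simp_all
      then show ?thesis using main[of x] True by linarith
    qed (use m0 in \<open>auto simp: bump_def\<close>)
  qed
qed

lemma bump_deriv:
  "\<exists>P' k'. \<forall>x. (bump P k has_real_derivative bump P' k' x) (at x)"
proof -
  let ?q = "[:-2, 3, -1:] :: real poly" and ?q' = "[:3, -2:] :: real poly"
  have q: "poly ?q x = (x - 1) * (2 - x)" for x by (simp add: algebra_simps)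
  \<comment> \<open>Product and chain rule for \<open>P * y ^ k * exp (- y)\<close> with y = 1/q,
    where the derivative of y is - q' y^2. Extracting the common factor \<open>y ^ (k + 2)\<close>
    from the three terms with the help of q y = 1 leaves this polynomial.\<close>
  let ?P = "pderiv P * ?q^2 - smult (of_nat k) (P * ?q' * ?q) + P * ?q'"
  obtain c where c: "\<And>x. \<bar>bump P k x\<bar> \<le> c * (x - 1)^2" "\<And>x. \<bar>bump P k x\<bar> \<le> c * (x - 2)^2"
    by (rule bump_quadratic[of P k]) blast
  have "(bump P k has_real_derivative bump ?P (k + 2) x) (at x)" for x
  proof -
    consider "x = 1 \<or> x = 2" | "1 < x" "x < 2" | "x < 1 \<or> x > 2" by linarith
    then show ?thesis
    proof cases
      case 1
      then show ?thesis
        using has_real_derivative_0_if_quadratic[of "bump P k" 1 c, OF _ c(1)]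
          has_real_derivative_0_if_quadratic[of "bump P k" 2 c, OF _ c(2)] by (auto simp: bump_def)
    next
      case 2
      define r where "r = (x - 1) * (2 - x)"
      have r: "r \<noteq> 0" using 2 by (simp add: r_def)
      have r': "((\<lambda>x. (x - 1) * (2 - x)) has_real_derivative (3 - 2 * x)) (at x)"
        by (auto intro!: derivative_eq_intros simp: algebra_simps)
      have i: "((\<lambda>x. inverse ((x - 1) * (2 - x))) has_real_derivative - ((3 - 2 * x) * inverse r ^ 2)) (at x)"
        using DERIV_inverse_fun[OF r'] r unfolding r_def by (simp add: power2_eq_square)
      define y where "y = inverse r"
      have ry: "r * y = 1" using r by (simp add: y_def)
      define p where "p = poly P x"
      define p' where "p' = poly (pderiv P) x"
      define d where "d = 3 - 2 * x"
      have "((\<lambda>x. poly P x * inverse ((x - 1) * (2 - x)) ^ k * exp (- inverse ((x - 1) * (2 - x))))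
          has_real_derivative
          ((p' * y ^ k + (of_nat k * (- (d * y ^ 2)) * y ^ (k - 1)) * p) * exp (- y)
            + exp (- y) * (d * y ^ 2) * (p * y ^ k))) (at x)"
        using DERIV_mult[OF DERIV_mult[OF poly_DERIV[of P x] DERIV_power[OF i, of k]] DERIV_chain2[OF DERIV_exp DERIV_minus[OF i]]]
        unfolding r_def[symmetric] y_def[symmetric] p_def[symmetric] p'_def[symmetric] d_def[symmetric]
        by (simp only: minus_minus mult_1_left mult_1_right mult.assoc mult.commute[of "y ^ (k - 1)"] One_nat_def of_nat_mult)
      also have "(p' * y ^ k + (of_nat k * (- (d * y ^ 2)) * y ^ (k - 1)) * p) * exp (- y)
            + exp (- y) * (d * y ^ 2) * (p * y ^ k) = bump ?P (k + 2) x"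
      proof -
        \<comment> \<open>For k = 0 the exponent \<open>k - 1\<close> is 0 in the natural numbers;
          the factor \<open>of_nat k\<close> then makes both sides vanish.\<close>
        have e2: "of_nat k * y ^ 2 * y ^ (k - 1) = of_nat k * (r * y ^ (k + 2))"
        proof (cases k)
          case (Suc j)
          have "r * y ^ (Suc j + 2) = (r * y) * (y ^ 2 * y ^ j)"
            by (simp add: power2_eq_square mult_ac)
          then have "r * y ^ (Suc j + 2) = y ^ 2 * y ^ j" by (simp only: ry mult_1_left)
          then show ?thesis unfolding Suc by (simp only: mult.assoc diff_Suc_1)
        qed simp
        have e3: "y ^ 2 * y ^ k = y ^ (k + 2)" by (simp only: power_add mult.commute)
        have e1: "y ^ k = r^2 * y ^ (k + 2)"
        proof -
          have "r^2 * y ^ (k + 2) = (r * y) * (r * y) * y ^ k" by (simp add: power2_eq_square mult_ac)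
          then show ?thesis using ry by simp
        qed
        have "p' * y ^ k + (of_nat k * (- (d * y ^ 2)) * y ^ (k - 1)) * p + (d * y ^ 2) * (p * y ^ k)
          = p' * y ^ k - d * p * (of_nat k * y ^ 2 * y ^ (k - 1)) + d * p * (y ^ 2 * y ^ k)"
          by (simp add: mult_ac)
        also have "\<dots> = p' * (r^2 * y ^ (k + 2)) - d * p * (of_nat k * (r * y ^ (k + 2))) + d * p * y ^ (k + 2)"
          unfolding e2 e3 using e1 by simp
        also have "\<dots> = (p' * r^2 - of_nat k * (p * d * r) + p * d) * y ^ (k + 2)"
          by (simp only: distrib_left distrib_right left_diff_distrib right_diff_distrib mult_ac)
        also have "p' * r^2 - of_nat k * (p * d * r) + p * d = poly ?P x"
        proof -
          have "poly [:3, -2:] x = d" by (simp add: d_def)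
          then show ?thesis
            unfolding p_def p'_def r_def q[symmetric] by (simp only: poly_add poly_diff poly_mult poly_power poly_smult)
        qed
        finally have *: "p' * y ^ k + (of_nat k * (- (d * y ^ 2)) * y ^ (k - 1)) * p + (d * y ^ 2) * (p * y ^ k) = poly ?P x * y ^ (k + 2)" .
        have "bump ?P (k + 2) x = poly ?P x * y ^ (k + 2) * exp (- y)"
          unfolding bump_def r_def[symmetric] y_def[symmetric] using 2 by simp
        then show ?thesis unfolding *[symmetric] by (simp only: distrib_right distrib_left mult_ac)
      qed
      finally have D: "((\<lambda>x. poly P x * inverse ((x - 1) * (2 - x)) ^ k * exp (- inverse ((x - 1) * (2 - x))))
          has_real_derivative bump ?P (k + 2) x) (at x)" .
      have "eventually (\<lambda>y. y \<in> {1<..<2}) (nhds x)" using 2 by (intro eventually_nhds_in_open) auto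
      then have "eventually (\<lambda>x. poly P x * inverse ((x - 1) * (2 - x)) ^ k * exp (- inverse ((x - 1) * (2 - x))) = bump P k x) (nhds x)"
        by (rule eventually_mono) (simp add: bump_def)
      then show ?thesis using D by (rule DERIV_cong_ev[OF refl _ refl, THEN iffD1])
    next
      case 3
      have "eventually (\<lambda>y. y \<in> - {1..2}) (nhds x)"
        using 3 by (intro eventually_nhds_in_open) auto
      then have "eventually (\<lambda>y. 0 = bump P k y) (nhds x)"
        by (rule eventually_mono) (auto simp: bump_def)
      then have "(bump P k has_real_derivative 0) (at x)"
        by (rule DERIV_cong_ev[OF refl _ refl, THEN iffD1]) simp
      then show ?thesis using 3 by (auto simp: bump_def)
    qed
  qed
  then show ?thesis by blast
qed

text \<open>A smooth transition function from \<open>0\<close> to \<open>1\<close> together with all its derivatives \<open>k i\<close>. Its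
  derivative \<open>k 1\<close> serves as mollifier; being supported in \<open>{1..2}\<close> it only looks forward in time,
  so that the mollified equation holds up to the initial time.\<close>

locale smooth_step =
  fixes k :: "nat \<Rightarrow> real \<Rightarrow> real"
  assumes deriv: "\<And>i x. (k i has_real_derivative k (Suc i) x) (at x)"
    and k1_nonneg: "\<And>x. 0 \<le> k 1 x"
    and k0_left: "\<And>x. x \<le> 1 \<Longrightarrow> k 0 x = 0"
    and k0_right: "\<And>x. x \<ge> 2 \<Longrightarrow> k 0 x = 1"

lemma ex_smooth_step: "\<exists>k. smooth_step k"
proof -
  obtain D where D: "\<And>P k x. (bump P k has_real_derivative bump (fst (D P k)) (snd (D P k)) x) (at x)"
  proof -
    have "\<forall>P k. \<exists>d. \<forall>x. (bump P k has_real_derivative bump (fst d) (snd d) x) (at x)"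
      using bump_deriv by (metis fst_conv snd_conv)
    then show ?thesis using that by metis
  qed
  \<comment> \<open>\<open>st i\<close> is the pair of polynomial and exponent after i
    differentiations, so \<open>b i\<close> is the i-th derivative of the bump with constant
    polynomial 1 and exponent 0.\<close>
  define st where "st i = ((\<lambda>(P, k). D P k) ^^ i) ([:1:], 0)" for i
  define b where "b i = (case st i of (P, k) \<Rightarrow> bump P k)" for i
  have st_Suc: "st (Suc i) = D (fst (st i)) (snd (st i))" for i by (simp add: st_def case_prod_unfold)
  have b: "(b i has_real_derivative b (Suc i) x) (at x)" for i x
    using D[of "fst (st i)" "snd (st i)"] by (simp add: b_def st_Suc case_prod_unfold)
  have b0: "b 0 = bump [:1:] 0" by (simp add: b_def st_def)
  have cont: "isCont (b 0) x" for x using b DERIV_isCont by blast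
  obtain F where F: "\<And>x. (F has_real_derivative b 0 x) (at x)"
    using einterval_antiderivative[of "-\<infinity>" "\<infinity>" "b 0"] cont
    by (auto simp: has_real_derivative_iff_has_vector_derivative)
  have F1: "F x = F 1" if "x \<le> 1" for x
  proof (cases "x = 1")
    case False
    then have "x < 1" using that by simp
    moreover have "b 0 y = 0" if "y < 1" for y using that by (simp add: b0 bump_def)
    ultimately show ?thesis using F by (intro DERIV_isconst_end[symmetric] continuous_at_imp_continuous_on) (auto intro: DERIV_isCont, metis)
  qed simp
  have F2: "F x = F 2" if "x \<ge> 2" for x
  proof (cases "x = 2")
    case False
    then have "x > 2" using that by simp
    moreover have "b 0 y = 0" if "y > 2" for y using that by (simp add: b0 bump_def)
    ultimately show ?thesis using F by (intro DERIV_isconst_end continuous_at_imp_continuous_on) (auto intro: DERIV_isCont, metis)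
  qed simp
  have pos: "F 1 < F 2"
    by (rule DERIV_pos_imp_increasing_open[of 1 2 F])
       (use F DERIV_isCont in \<open>auto simp: b0 bump_def intro!: continuous_at_imp_continuous_on exI\<close>)
  define c where "c = F 2 - F 1"
  have c: "c > 0" using pos by (simp add: c_def)
  \<comment> \<open>Index shift: \<open>k 0\<close> is the normalised antiderivative and
    \<open>k (Suc j)\<close> the j-th derivative of the bump, divided by c. This division makes the
    step rise from 0 to exactly 1, hence gives the mollifier \<open>k 1\<close> mass 1.\<close>
  define k where "k i x = (case i of 0 \<Rightarrow> (F x - F 1) / c | Suc j \<Rightarrow> b j x / c)" for i x
  have "smooth_step k"
  proof
    show "(k i has_real_derivative k (Suc i) x) (at x)" for i x
    proof (cases i)
      case 0
      have "((\<lambda>x. (F x - F 1) / c) has_real_derivative (b 0 x - 0) / c) (at x)"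
        by (intro DERIV_cdivide DERIV_diff F DERIV_const)
      then show ?thesis by (simp add: 0 k_def[abs_def])
    next
      case (Suc j)
      have "((\<lambda>x. b j x / c) has_real_derivative b (Suc j) x / c) (at x)"
        by (intro DERIV_cdivide b)
      then show ?thesis by (simp add: Suc k_def[abs_def])
    qed
    show "0 \<le> k 1 x" for x using c by (simp add: k_def b0 bump_def)
    show "k 0 x = 0" if "x \<le> 1" for x using F1[OF that] by (simp add: k_def)
    show "k 0 x = 1" if "x \<ge> 2" for x using F2[OF that] c by (simp add: k_def c_def)
  qed
  then show ?thesis by blast
qed

section \<open>Mollification\<close>

lemma Cc_inftyI:
  assumes "\<And>k. Ck k \<phi>" "compact K" "K \<subseteq> \<Omega>" "\<And>z. z \<notin> K \<Longrightarrow> \<phi> z = 0"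
  shows "\<phi> \<in> Cc_infty \<Omega>"
proof -
  have "closure {z. \<phi> z \<noteq> 0} \<subseteq> K"
    using assms(2,4) by (intro closure_minimal) (auto intro: compact_imp_closed)
  then show ?thesis
    using assms compact_Int_closed[OF assms(2) closed_closure, of "{z. \<phi> z \<noteq> 0}"]
    by (auto simp: Cc_infty_def Int_absorb1)
qed

text \<open>A whole sequence of iterated derivatives is taken as witness; its tail is a witness for
  the derivative, so closure under differentiation is immediate.\<close>

definition smooth :: "(real \<Rightarrow> real) \<Rightarrow> bool" where
  "smooth P \<longleftrightarrow> (\<exists>F. F (0::nat) = P \<and> (\<forall>i x. (F i has_real_derivative F (Suc i) x) (at x)))"

lemma smooth_deriv:
  assumes "smooth P"
  obtains P' where "smooth P'" "\<And>x. (P has_real_derivative P' x) (at x)"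
proof -
  obtain F where F: "F (0::nat) = P" "\<And>i x. (F i has_real_derivative F (Suc i) x) (at x)"
    using assms by (auto simp: smooth_def)
  have "smooth (F 1)" unfolding smooth_def by (rule exI[of _ "\<lambda>i. F (Suc i)"]) (use F in auto)
  then show ?thesis using that[of "F 1"] F(2)[of 0] F(1) by simp
qed

text \<open>Products of one-variable functions form a class closed under both partial derivatives,
  each of which acts on one factor only. Tensor products of step functions and mollifiers thereby
  qualify as test functions.\<close>

lemma Ck_product:
  assumes "smooth P" "smooth Q"
  shows "Ck k (\<lambda>z. P (fst z) * Q (snd z))"
proof (rule Ck_of_closed_class[where S="{(\<lambda>z. P (fst z) * Q (snd z)) | P Q. smooth P \<and> smooth Q}"])
  show "(\<lambda>z. P (fst z) * Q (snd z)) \<in> {(\<lambda>z. P (fst z) * Q (snd z)) | P Q. smooth P \<and> smooth Q}"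
    using assms by blast
next
  fix g assume "g \<in> {(\<lambda>z. P (fst z) * Q (snd z)) | P Q. smooth P \<and> smooth Q}"
  then obtain P Q where g: "g = (\<lambda>z. P (fst z) * Q (snd z))" "smooth P" "smooth Q" by blast
  have c: "continuous_on UNIV R" if "smooth R" for R
    by (rule smooth_deriv[OF that]) (auto intro!: continuous_at_imp_continuous_on intro: DERIV_isCont)
  show "continuous_on UNIV g"
    unfolding g by (intro continuous_intros continuous_on_compose2[OF c[OF g(2)]] continuous_on_compose2[OF c[OF g(3)]]) auto
  obtain P' where P': "smooth P'" "\<And>x. (P has_real_derivative P' x) (at x)" using smooth_deriv[OF g(2)] by blast
  obtain Q' where Q': "smooth Q'" "\<And>x. (Q has_real_derivative Q' x) (at x)" using smooth_deriv[OF g(3)] by blast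
  show "\<exists>gx\<in>{(\<lambda>z. P (fst z) * Q (snd z)) | P Q. smooth P \<and> smooth Q}.
        \<exists>gt\<in>{(\<lambda>z. P (fst z) * Q (snd z)) | P Q. smooth P \<and> smooth Q}.
        (\<forall>x t. ((\<lambda>y. g (y, t)) has_real_derivative gx (x, t)) (at x)) \<and>
        (\<forall>x t. ((\<lambda>s. g (x, s)) has_real_derivative gt (x, t)) (at t))"
  proof (intro bexI conjI allI)
    show "((\<lambda>y. g (y, t)) has_real_derivative (\<lambda>z. P' (fst z) * Q (snd z)) (x, t)) (at x)" for x t
      using DERIV_cmult_right[OF P'(2)] by (simp add: g)
    show "((\<lambda>s. g (x, s)) has_real_derivative (\<lambda>z. P (fst z) * Q' (snd z)) (x, t)) (at t)" for x t
      using DERIV_cmult[OF Q'(2)] by (simp add: g)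
  qed (use g P' Q' in auto)
qed

lemma lborel_integral_affine:
  fixes h :: "'b::euclidean_space \<Rightarrow> real"
  assumes "h \<in> borel_measurable borel" "c > 0"
  shows "(LBINT w. h w) = c ^ DIM('b) * (LBINT y. h (z + c *\<^sub>R y))"
proof -
  have "(LBINT w. h w) = (\<integral>w. h w \<partial>(density (distr lborel borel (\<lambda>x. z + c *\<^sub>R x)) (\<lambda>_. \<bar>c\<bar>^DIM('b))))"
    by (subst lborel_affine[of c z]) (use assms in auto)
  also have "\<dots> = (\<integral>w. c ^ DIM('b) * h w \<partial>distr lborel borel (\<lambda>x. z + c *\<^sub>R x))"
    using assms by (subst integral_density) auto
  also have "\<dots> = (LBINT y. c ^ DIM('b) * h (z + c *\<^sub>R y))"
    using assms by (subst integral_distr) auto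
  finally show ?thesis by simp
qed

context smooth_step
begin

lemma continuous_k: "continuous_on S (k i)"
  using deriv by (intro continuous_at_imp_continuous_on) (auto intro: DERIV_isCont)

text \<open>Outside {1..2} the function \<open>k 0\<close> is locally constant, with values 0 and 1;
  its derivative is locally constant 0 there, and this passes on to all higher derivatives.\<close>

lemma k_eq_0:
  assumes "x < 1 \<or> x > 2"
  shows "k (Suc i) x = 0"
proof -
  have *: "k (Suc i) x = 0" if S: "open S" "x \<in> S" and c: "\<And>y. y \<in> S \<Longrightarrow> k i y = c" for S x i c
  proof -
    have "eventually (\<lambda>y. y \<in> S) (nhds x)" using S by (intro eventually_nhds_in_open)
    then have "eventually (\<lambda>y. c = k i y) (nhds x)" by (rule eventually_mono) (use c in auto)
    then have "(k i has_real_derivative 0) (at x)"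
      by (rule DERIV_cong_ev[OF refl _ refl, THEN iffD1]) simp
    then show ?thesis using deriv DERIV_unique by blast
  qed
  show ?thesis using assms
  proof (induction i arbitrary: x)
    case 0
    then show ?case
      using *[of "{..<1}" x 0 0] *[of "{2<..}" x 0 1] k0_left k0_right by auto
  next
    case (Suc i)
    then show ?case
      using *[of "{..<1} \<union> {2<..}" x "Suc i" 0] open_Un[OF open_lessThan open_greaterThan] by auto
  qed
qed

lemma k0_nonneg: "0 \<le> k 0 x" and k0_le_1: "k 0 x \<le> 1"
proof -
  have mono: "k 0 x \<le> k 0 y" if "x \<le> y" for x y
    using that deriv k1_nonneg by (intro DERIV_nonneg_imp_nondecreasing[of x y "k 0"]) force+
  show "0 \<le> k 0 x"
    using mono[of 1 x] k0_left[of x] k0_left[of 1] by (cases "x \<le> 1") auto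
  show "k 0 x \<le> 1"
    using mono[of x 2] k0_right[of x] k0_right[of 2] by (cases "x \<ge> 2") auto
qed

lemma integrable_k1: "integrable lborel (k 1)" and integral_k1: "(LBINT x. k 1 x) = 1"
proof -
  have "has_bochner_integral lborel (\<lambda>x. k 1 x * indicator {1..2} x) (k 0 2 - k 0 1)"
    using deriv[of 0] by (intro has_bochner_integral_FTC_Icc_real) (auto intro: DERIV_isCont deriv)
  moreover have "(\<lambda>x. k 1 x * indicator {1..2} x) = k 1"
    using k_eq_0[of _ 0] by (intro ext) (force simp: indicator_def)
  ultimately have "has_bochner_integral lborel (k 1) 1"
    using k0_left[of 1] k0_right[of 2] by simp
  then show "integrable lborel (k 1)" "(LBINT x. k 1 x) = 1"
    by (auto simp: has_bochner_integral_iff)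
qed

text \<open>\<open>kn n i\<close> is the i-th derivative of the rescaled step
  \<open>k 0 (real (Suc n) * x)\<close>, the power being the chain-rule factor. So
  \<open>kn n 1\<close> is a mollifier of mass 1 supported in [1/(n+1), 2/(n+1)], at a positive
  distance from 0.\<close>

definition kn :: "nat \<Rightarrow> nat \<Rightarrow> real \<Rightarrow> real" where
  "kn n i x = real (Suc n) ^ i * k i (real (Suc n) * x)"

lemma kn_deriv: "(kn n i has_real_derivative kn n (Suc i) x) (at x)"
  unfolding kn_def[abs_def]
  by (rule DERIV_cong[OF DERIV_cmult[OF DERIV_chain2[OF deriv DERIV_cmult[OF DERIV_ident]]]]) simp

lemma continuous_kn [continuous_intros]: "continuous_on S g \<Longrightarrow> continuous_on S (\<lambda>x. kn n i (g x))"
  unfolding kn_def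
  by (intro continuous_intros continuous_on_compose2[OF continuous_k[of UNIV]]) auto

lemma borel_measurable_kn [measurable]: "kn n i \<in> borel_measurable borel"
  by (intro borel_measurable_continuous_onI continuous_intros)

lemma kn_eq_0: "x < 1 / real (Suc n) \<or> x > 2 / real (Suc n) \<Longrightarrow> kn n (Suc i) x = 0"
  using k_eq_0[of "real (Suc n) * x" i] by (auto simp: kn_def field_simps)

lemma kn_eq_0': "x \<le> 0 \<or> x > 2 \<Longrightarrow> kn n (Suc i) x = 0"
proof (rule kn_eq_0)
  assume "x \<le> 0 \<or> x > 2"
  moreover have "0 < 1 / real (Suc n)" "2 / real (Suc n) \<le> 2" by (auto simp: field_simps)
  ultimately show "x < 1 / real (Suc n) \<or> x > 2 / real (Suc n)" by linarith
qed

lemma kn0_left: "x \<le> 0 \<Longrightarrow> kn n 0 x = 0"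
  using k0_left[of "real (Suc n) * x"] mult_nonneg_nonpos[of "real (Suc n)" x] by (simp add: kn_def)

lemma kn0_right: "x \<ge> 2 \<Longrightarrow> kn n 0 x = 1"
proof -
  assume "x \<ge> 2"
  then have "1 * 2 \<le> real (Suc n) * x" by (intro mult_mono) auto
  then show ?thesis using k0_right[of "real (Suc n) * x"] by (simp add: kn_def)
qed

lemma kn0_bounds: "0 \<le> kn n 0 x" "kn n 0 x \<le> 1"
  using k0_nonneg k0_le_1 by (auto simp: kn_def)

lemma kn1_nonneg: "0 \<le> kn n (Suc 0) x"
  using k1_nonneg by (auto simp: kn_def)

lemma nn_integral_kn1: "(\<integral>\<^sup>+x. ennreal (kn n (Suc 0) x) \<partial>lborel) = 1"
proof -
  have m: "k 1 \<in> borel_measurable borel" using continuous_k by (rule borel_measurable_continuous_onI)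
  have "(\<integral>\<^sup>+x. ennreal (k 1 x) \<partial>lborel) = 1"
    using integrable_k1 integral_k1 k1_nonneg by (subst nn_integral_eq_integral) auto
  then have "ennreal (real (Suc n)) * (\<integral>\<^sup>+x. ennreal (k 1 (0 + real (Suc n) * x)) \<partial>lborel) = 1"
    using m by (subst (asm) nn_integral_real_affine[where c="real (Suc n)" and t=0]) auto
  also have "ennreal (real (Suc n)) * (\<integral>\<^sup>+x. ennreal (k 1 (0 + real (Suc n) * x)) \<partial>lborel) = (\<integral>\<^sup>+x. ennreal (kn n (Suc 0) x) \<partial>lborel)"
    using m by (subst nn_integral_cmult[symmetric]) (auto simp: kn_def ennreal_mult' simp del: of_nat_Suc)
  finally show ?thesis .
qed

lemma smooth_kn_shift: "smooth (\<lambda>y. kn n i (y - x))"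
  unfolding smooth_def
  by (rule exI[of _ "\<lambda>j y. kn n (i + j) (y - x)"])
     (auto intro!: DERIV_cong[OF DERIV_chain2[OF kn_deriv]] derivative_eq_intros)

lemma smooth_kn_diff: "smooth (\<lambda>y. kn n i y - kn n i (y - x))"
  unfolding smooth_def
  by (rule exI[of _ "\<lambda>j y. kn n (i + j) y - kn n (i + j) (y - x)"])
     (auto intro!: DERIV_diff kn_deriv DERIV_cong[OF DERIV_chain2[OF kn_deriv]] derivative_eq_intros)

text \<open>The kernel is evaluated at w - z and not at z - w: the value at z averages
  \<open>u\<close> over points to the right and later in time. Derivatives in z act on the kernel
  alone and raise i or j with a sign -1, so for positive indices the \<open>cv\<close> are, up to
  sign, the derivatives of \<open>mol\<close>.\<close>

definition cv :: "nat \<Rightarrow> nat \<Rightarrow> nat \<Rightarrow> (real \<times> real \<Rightarrow> real) \<Rightarrow> real \<times> real \<Rightarrow> real" where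
  "cv n i j u z = (LBINT w. u w * (kn n i (fst w - fst z) * kn n j (snd w - snd z)))"

definition mol :: "nat \<Rightarrow> (real \<times> real \<Rightarrow> real) \<Rightarrow> real \<times> real \<Rightarrow> real" where
  "mol n = cv n 1 1"

lemma kn_kn_eq_0:
  assumes "norm w > norm z + 4"
  shows "kn n (Suc i) (fst w - fst z) * kn n (Suc j) (snd w - snd z) = 0"
proof (rule ccontr)
  assume "\<not> ?thesis"
  then have "kn n (Suc i) (fst w - fst z) \<noteq> 0" "kn n (Suc j) (snd w - snd z) \<noteq> 0" by auto
  then have "\<bar>fst w - fst z\<bar> \<le> 2" "\<bar>snd w - snd z\<bar> \<le> 2"
    using kn_eq_0'[of "fst w - fst z" n i] kn_eq_0'[of "snd w - snd z" n j] by force+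
  then have "norm (w - z) \<le> 2 + 2"
    using norm_Pair_le[of "fst (w - z)" "snd (w - z)"] by (auto simp: minus_prod_def)
  then show False using assms norm_triangle_sub[of w z] by linarith
qed

lemma
  assumes u: "u \<in> borel_measurable borel" "\<And>w. \<bar>u w\<bar> \<le> L"
  shows cv_deriv_x: "((\<lambda>x. cv n (Suc i) (Suc j) u (x, t)) has_real_derivative - cv n (Suc (Suc i)) (Suc j) u (x0, t)) (at x0)"
    and cv_deriv_t: "((\<lambda>t. cv n (Suc i) (Suc j) u (x, t)) has_real_derivative - cv n (Suc i) (Suc (Suc j)) u (x, t0)) (at t0)"
    and continuous_cv: "continuous_on UNIV (cv n (Suc i) (Suc j) u)"
proof -
  have "((\<lambda>x. LBINT w. u w * (kn n (Suc i) (fst w - x) * kn n (Suc j) (snd w - t))) has_real_derivative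
     (LBINT w. u w * (- kn n (Suc (Suc i)) (fst w - x0) * kn n (Suc j) (snd w - t)))) (at x0)"
  proof (rule has_real_derivative_integral_compact[OF u, where P="\<lambda>x w. kn n (Suc i) (fst w - x) * kn n (Suc j) (snd w - t)"
     and P'="\<lambda>x w. - kn n (Suc (Suc i)) (fst w - x) * kn n (Suc j) (snd w - t)"])
    show "((\<lambda>x. kn n (Suc i) (fst w - x) * kn n (Suc j) (snd w - t)) has_real_derivative
       - kn n (Suc (Suc i)) (fst w - x) * kn n (Suc j) (snd w - t)) (at x)" for x w
      by (rule DERIV_cmult_right, rule DERIV_cong[OF DERIV_chain2[OF kn_deriv]])
         (auto intro!: derivative_eq_intros)
    show "\<exists>r. \<forall>x w. \<bar>x - x0\<bar> < 2 \<longrightarrow> r < norm w \<longrightarrow> kn n (Suc i) (fst w - x) * kn n (Suc j) (snd w - t) = 0" for x0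
    proof (intro exI[of _ "\<bar>x0\<bar> + 2 + \<bar>t\<bar> + 4"] allI impI)
      fix x w assume "\<bar>x - x0\<bar> < 2" "\<bar>x0\<bar> + 2 + \<bar>t\<bar> + 4 < norm (w :: real \<times> real)"
      then have "norm (x, t) + 4 < norm w" using norm_Pair_le[of x t] by simp
      from kn_kn_eq_0[OF this, of n i j] show "kn n (Suc i) (fst w - x) * kn n (Suc j) (snd w - t) = 0" by simp
    qed
  qed (auto intro!: continuous_intros simp: case_prod_unfold)
  then show "((\<lambda>x. cv n (Suc i) (Suc j) u (x, t)) has_real_derivative - cv n (Suc (Suc i)) (Suc j) u (x0, t)) (at x0)"
    by (simp add: cv_def)
  have "((\<lambda>t. LBINT w. u w * (kn n (Suc i) (fst w - x) * kn n (Suc j) (snd w - t))) has_real_derivative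
     (LBINT w. u w * (kn n (Suc i) (fst w - x) * - kn n (Suc (Suc j)) (snd w - t0)))) (at t0)"
  proof (rule has_real_derivative_integral_compact[OF u, where P="\<lambda>t w. kn n (Suc i) (fst w - x) * kn n (Suc j) (snd w - t)"
     and P'="\<lambda>t w. kn n (Suc i) (fst w - x) * - kn n (Suc (Suc j)) (snd w - t)"])
    show "((\<lambda>t. kn n (Suc i) (fst w - x) * kn n (Suc j) (snd w - t)) has_real_derivative
       kn n (Suc i) (fst w - x) * - kn n (Suc (Suc j)) (snd w - t)) (at t)" for t w
      by (rule DERIV_cmult, rule DERIV_cong[OF DERIV_chain2[OF kn_deriv]])
         (auto intro!: derivative_eq_intros)
    show "\<exists>r. \<forall>t w. \<bar>t - t0\<bar> < 2 \<longrightarrow> r < norm w \<longrightarrow> kn n (Suc i) (fst w - x) * kn n (Suc j) (snd w - t) = 0" for t0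
    proof (intro exI[of _ "\<bar>x\<bar> + (\<bar>t0\<bar> + 2) + 4"] allI impI)
      fix t w assume "\<bar>t - t0\<bar> < 2" "\<bar>x\<bar> + (\<bar>t0\<bar> + 2) + 4 < norm (w :: real \<times> real)"
      then have "norm (x, t) + 4 < norm w" using norm_Pair_le[of x t] by simp
      from kn_kn_eq_0[OF this, of n i j] show "kn n (Suc i) (fst w - x) * kn n (Suc j) (snd w - t) = 0" by simp
    qed
  qed (auto intro!: continuous_intros simp: case_prod_unfold)
  then show "((\<lambda>t. cv n (Suc i) (Suc j) u (x, t)) has_real_derivative - cv n (Suc i) (Suc (Suc j)) u (x, t0)) (at t0)"
    by (simp add: cv_def)
  show "continuous_on UNIV (cv n (Suc i) (Suc j) u)"
    unfolding cv_def[abs_def]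
  proof (rule continuous_on_integral_compact[OF u])
    show "\<exists>r. \<forall>z w. dist z z0 \<le> 1 \<longrightarrow> r < norm w \<longrightarrow> kn n (Suc i) (fst w - fst z) * kn n (Suc j) (snd w - snd z) = 0"
      for z0 :: "real \<times> real"
    proof (intro exI[of _ "norm z0 + 1 + 4"] allI impI)
      fix z w :: "real \<times> real" assume "dist z z0 \<le> 1" "norm z0 + 1 + 4 < norm w"
      then show "kn n (Suc i) (fst w - fst z) * kn n (Suc j) (snd w - snd z) = 0"
        using norm_triangle_sub[of z z0] by (intro kn_kn_eq_0) (auto simp: dist_norm)
    qed
  qed (auto intro!: continuous_intros simp: case_prod_unfold)
qed

text \<open>The constant c in the class absorbs the alternating signs of the kernel
  derivatives.\<close>

lemma Ck_mol:
  assumes u: "u \<in> borel_measurable borel" "\<And>w. \<bar>u w\<bar> \<le> L"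
  shows "Ck m (mol n u)"
proof (rule Ck_of_closed_class[where S="{(\<lambda>z. c * cv n (Suc i) (Suc j) u z) | c i j. True}"])
  show "mol n u \<in> {(\<lambda>z. c * cv n (Suc i) (Suc j) u z) | c i j. True}"
    unfolding mol_def by (rule CollectI) (rule exI[of _ 1], rule exI[of _ 0], rule exI[of _ 0], simp)
next
  fix g assume "g \<in> {(\<lambda>z. c * cv n (Suc i) (Suc j) u z) | c i j. True}"
  then obtain c i j where g: "g = (\<lambda>z. c * cv n (Suc i) (Suc j) u z)" by blast
  show "continuous_on UNIV g" unfolding g by (intro continuous_intros continuous_cv[OF u])
  show "\<exists>gx\<in>{(\<lambda>z. c * cv n (Suc i) (Suc j) u z) | c i j. True}.
        \<exists>gt\<in>{(\<lambda>z. c * cv n (Suc i) (Suc j) u z) | c i j. True}.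
        (\<forall>x t. ((\<lambda>y. g (y, t)) has_real_derivative gx (x, t)) (at x)) \<and>
        (\<forall>x t. ((\<lambda>s. g (x, s)) has_real_derivative gt (x, t)) (at t))"
  proof (intro bexI conjI allI)
    show "((\<lambda>y. g (y, t)) has_real_derivative (\<lambda>z. (-c) * cv n (Suc (Suc i)) (Suc j) u z) (x, t)) (at x)" for x t
      using DERIV_cmult[OF cv_deriv_x[OF u, of n i j t x], of c] by (simp add: g)
    show "((\<lambda>s. g (x, s)) has_real_derivative (\<lambda>z. (-c) * cv n (Suc i) (Suc (Suc j)) u z) (x, t)) (at t)" for x t
      using DERIV_cmult[OF cv_deriv_t[OF u, of n i j x t], of c] by (simp add: g)
  qed (use g in blast)+
qed

text \<open>Substituting w = z + y/(n+1) cancels the factor (n+1)^2 of the kernel against the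
  Jacobian, so that n enters only through the translation of \<open>u\<close>. Bounds and L^1
  estimates are read off this form, smoothness off \<open>cv\<close>.\<close>

lemma mol_shift:
  assumes u: "u \<in> borel_measurable borel"
  shows "mol n u z = (LBINT y. u (z + (1 / real (Suc n)) *\<^sub>R y) * (k 1 (fst y) * k 1 (snd y)))"
proof -
  define N where "N = real (Suc n)"
  have N: "N > 0" by (simp add: N_def)
  have [measurable]: "k 1 \<in> borel_measurable borel" using continuous_k by (rule borel_measurable_continuous_onI)
  note u[measurable]
  let ?h = "\<lambda>w. u w * (k 1 (N * (fst w - fst z)) * k 1 (N * (snd w - snd z)))"
  have [measurable]: "(\<lambda>w. k 1 (N * (fst w - fst z)) * k 1 (N * (snd w - snd z))) \<in> borel_measurable borel"
    by (intro borel_measurable_continuous_onI continuous_intros continuous_on_compose2[OF continuous_k[of UNIV]]) auto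
  have h: "?h \<in> borel_measurable borel" by measurable
  have "mol n u z = (LBINT w. N^2 * ?h w)"
    unfolding mol_def cv_def kn_def N_def[symmetric] by (simp add: power2_eq_square mult_ac)
  also have "\<dots> = N^2 * (LBINT w. ?h w)" by simp
  also have "(LBINT w. ?h w) = (1 / N) ^ DIM(real \<times> real) * (LBINT y. ?h (z + (1 / N) *\<^sub>R y))"
    by (rule lborel_integral_affine[OF h]) (use N in simp)
  also have "N^2 * \<dots> = (N * (1 / N))^2 * (LBINT y. ?h (z + (1 / N) *\<^sub>R y))"
    by (simp only: power_mult_distrib mult.assoc DIM_prod DIM_real one_add_one)
  finally show ?thesis unfolding N_def[symmetric] using N by simp
qed

end

section \<open>Convergence of mollifications in L^1 on balls\<close>

lemma tendsto_0_if_nonneg_le: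
  fixes a b :: "nat \<Rightarrow> real"
  assumes "\<And>n. 0 \<le> a n" "\<And>n. a n \<le> b n" "b \<longlonglongrightarrow> 0"
  shows "a \<longlonglongrightarrow> 0"
  using tendsto_sandwich[of "\<lambda>_. 0" a sequentially b 0] assms by (auto intro: always_eventually)

lemma cball_in_sets_borel [measurable]: "cball (a::'b::metric_space) r \<in> sets borel"
  by (intro borel_closed closed_cball)

text \<open>Lebesgue measurability yields continuous functions converging to \<open>u\<close>
  outside a negligible set. Truncating them at \<open>L\<close> and \<open>- L\<close> keeps them
  continuous, does not affect the limit and provides the majorant for dominated convergence on the
  ball.\<close>

lemma L1_continuous_approximation:
  fixes u :: "'b::euclidean_space \<Rightarrow> real"
  assumes u: "u \<in> borel_measurable borel" "\<And>w. \<bar>u w\<bar> \<le> L" and "\<epsilon> > 0"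
  obtains g where "continuous_on UNIV g" "\<And>w. \<bar>g w\<bar> \<le> L"
    "(LBINT w. indicator (cball 0 r) w * \<bar>u w - g w\<bar>) < \<epsilon>"
proof -
  have L: "L \<ge> 0" using u(2) abs_ge_zero order_trans by blast
  have "u \<in> borel_measurable lebesgue" using u(1) by (simp add: measurable_completion)
  then have "u measurable_on UNIV" by (rule lebesgue_measurable_imp_measurable_on) simp
  then obtain N g where N: "negligible N" and g: "\<And>n. continuous_on UNIV (g n)"
    "\<And>x. x \<notin> N \<Longrightarrow> (\<lambda>n. g n x) \<longlonglongrightarrow> u x"
    unfolding measurable_on_def by auto
  define h where "h n x = max (- L) (min L (g n x))" for n x
  have h: "continuous_on UNIV (h n)" "\<bar>h n x\<bar> \<le> L" for n x
    unfolding h_def using L g(1) by (auto intro!: continuous_intros)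
  note [measurable] = u(1) borel_measurable_continuous_onI[OF h(1)]
  have "AE x in lebesgue. x \<notin> N" using N by (simp add: AE_not_in negligible_iff_null_sets)
  then have ae: "AE x in lborel. x \<notin> N" by (simp add: AE_completion_iff)
  have "(\<lambda>n. LBINT w. indicator (cball 0 r) w * \<bar>u w - h n w\<bar>) \<longlonglongrightarrow> (\<integral>w. 0 \<partial>(lborel :: 'b measure))"
  proof (rule integral_dominated_convergence[where w="\<lambda>w. (2 * L) * indicator (cball (0::'b) r) w"])
    show "AE w in lborel. (\<lambda>n. indicator (cball 0 r) w * \<bar>u w - h n w\<bar>) \<longlonglongrightarrow> 0"
      using ae
    proof eventually_elim
      case (elim w)
      have "(\<lambda>n. h n w) \<longlonglongrightarrow> max (- L) (min L (u w))"
        unfolding h_def using g(2)[OF elim] by (intro tendsto_intros)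
      also have "max (- L) (min L (u w)) = u w" using u(2)[of w] by (auto simp: max_def min_def abs_le_iff)
      finally have "(\<lambda>n. indicator (cball 0 r) w * \<bar>u w - h n w\<bar>) \<longlonglongrightarrow> indicator (cball 0 r) w * \<bar>u w - u w\<bar>"
        by (intro tendsto_intros)
      then show ?case by simp
    qed
    show "AE w in lborel. norm (indicator (cball 0 r) w * \<bar>u w - h n w\<bar>) \<le> 2 * L * indicator (cball 0 r) w" for n
    proof (rule AE_I2)
      fix w show "norm (indicator (cball 0 r) w * \<bar>u w - h n w\<bar>) \<le> 2 * L * indicator (cball 0 r) w"
        using u(2)[of w] h(2)[of n w] by (auto simp: indicator_def)
    qed
    show "integrable lborel (\<lambda>w. (2 * L) * indicator (cball (0::'b) r) w :: real)" by (rule integrable_indicator_cball)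
  qed measurable
  then have "eventually (\<lambda>n. (LBINT w. indicator (cball 0 r) w * \<bar>u w - h n w\<bar>) < \<epsilon>) sequentially"
    using \<open>\<epsilon> > 0\<close> by (intro order_tendstoD) auto
  then obtain n where "(LBINT w. indicator (cball 0 r) w * \<bar>u w - h n w\<bar>) < \<epsilon>"
    by (auto simp: eventually_sequentially)
  then show ?thesis using that[of "h n"] h by blast
qed

lemma integrable_indicator_abs_diff:
  fixes u v :: "'b::euclidean_space \<Rightarrow> real"
  assumes [measurable]: "u \<in> borel_measurable borel" "v \<in> borel_measurable borel"
    and b: "\<And>w. \<bar>u w\<bar> \<le> L" "\<And>w. \<bar>v w\<bar> \<le> L"
  shows "integrable lborel (\<lambda>w. indicator (cball 0 r) w * \<bar>u w - v w\<bar>)"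
proof (rule integrable_bounded_compact[where r=r and c="2 * L"])
  show "\<bar>indicator (cball 0 r) w * \<bar>u w - v w\<bar>\<bar> \<le> 2 * L" for w
    using b[of w] by (auto simp: indicator_def)
qed auto

text \<open>Three-epsilon argument: \<open>u\<close> is replaced by a continuous bounded
  \<open>g\<close>, for which the claim is dominated convergence. Eventually the norm of
  \<open>X n\<close> is below 1, so the translated approximation error is controlled on the ball of
  radius r + 1.\<close>

lemma L1_translation_tendsto_0:
  fixes u :: "'b::euclidean_space \<Rightarrow> real" and X :: "nat \<Rightarrow> 'b"
  assumes u: "u \<in> borel_measurable borel" "\<And>w. \<bar>u w\<bar> \<le> L" and X: "X \<longlonglongrightarrow> 0"
  shows "(\<lambda>n. LBINT w. indicator (cball 0 r) w * \<bar>u (w + X n) - u w\<bar>) \<longlonglongrightarrow> 0"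
proof (rule LIMSEQ_I)
  fix \<epsilon> :: real assume "\<epsilon> > 0"
  then obtain g where g: "continuous_on UNIV g" "\<And>w. \<bar>g w\<bar> \<le> L"
    and ug: "(LBINT w. indicator (cball 0 (r + 1)) w * \<bar>u w - g w\<bar>) < \<epsilon> / 3"
    using L1_continuous_approximation[OF u, of "\<epsilon> / 3" "r + 1"] by auto
  note [measurable] = u(1) borel_measurable_continuous_onI[OF g(1)]
  let ?I = "\<lambda>r w. indicator (cball (0::'b) r) w :: real"
  have lim: "(\<lambda>n. LBINT w. ?I r w * \<bar>g (w + X n) - g w\<bar>) \<longlonglongrightarrow> (\<integral>w. 0 \<partial>(lborel :: 'b measure))"
  proof (rule integral_dominated_convergence[where w="\<lambda>w. (2 * L) * ?I r w"])
    show "AE w in lborel. (\<lambda>n. ?I r w * \<bar>g (w + X n) - g w\<bar>) \<longlonglongrightarrow> 0"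
    proof (rule AE_I2)
      fix w
      have "(\<lambda>n. w + X n) \<longlonglongrightarrow> w + 0" using X by (intro tendsto_intros)
      then have "(\<lambda>n. g (w + X n)) \<longlonglongrightarrow> g (w + 0)"
        using g(1) continuous_on_tendsto_compose[of UNIV g "\<lambda>n. w + X n" "w + 0" sequentially] by auto
      then have "(\<lambda>n. ?I r w * \<bar>g (w + X n) - g w\<bar>) \<longlonglongrightarrow> ?I r w * \<bar>g (w + 0) - g w\<bar>"
        by (intro tendsto_intros)
      then show "(\<lambda>n. ?I r w * \<bar>g (w + X n) - g w\<bar>) \<longlonglongrightarrow> 0" by simp
    qed
    show "AE w in lborel. norm (?I r w * \<bar>g (w + X n) - g w\<bar>) \<le> 2 * L * ?I r w" for n
    proof (rule AE_I2)
      fix w show "norm (?I r w * \<bar>g (w + X n) - g w\<bar>) \<le> 2 * L * ?I r w"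
        using g(2)[of w] g(2)[of "w + X n"] by (auto simp: indicator_def)
    qed
    show "integrable lborel (\<lambda>w. 2 * L * ?I r w)" by (rule integrable_indicator_cball)
  qed measurable
  have "eventually (\<lambda>n. (LBINT w. ?I r w * \<bar>g (w + X n) - g w\<bar>) < \<epsilon> / 3) sequentially"
    using lim \<open>\<epsilon> > 0\<close> by (intro order_tendstoD) auto
  moreover have "eventually (\<lambda>n. dist (X n) 0 < 1) sequentially"
    using X tendstoD zero_less_one by blast
  ultimately have "eventually (\<lambda>n. norm ((LBINT w. ?I r w * \<bar>u (w + X n) - u w\<bar>) - 0) < \<epsilon>) sequentially"
  proof eventually_elim
    case (elim n)
    have i1: "integrable lborel (\<lambda>w. ?I r w * \<bar>u w - g w\<bar>)" for r
      by (rule integrable_indicator_abs_diff[of u g L]) (use u g in auto)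
    have i2: "integrable lborel (\<lambda>w. ?I r w * \<bar>g (w + X n) - g w\<bar>)"
      by (rule integrable_indicator_abs_diff[of _ g L]) (use u g in auto)
    have i3: "integrable lborel (\<lambda>w. ?I (r + 1) (w + X n) * \<bar>u (w + X n) - g (w + X n)\<bar>)"
      using i1[of "r + 1"] unfolding add.commute[of _ "X n"]
      by (subst (asm) lborel_distr_plus[of "X n", symmetric], subst (asm) integrable_distr_eq) auto
    have i4: "integrable lborel (\<lambda>w. ?I r w * \<bar>u (w + X n) - u w\<bar>)"
      by (rule integrable_indicator_abs_diff[of _ u L]) (use u g in auto)
    have "(LBINT w. ?I r w * \<bar>u (w + X n) - u w\<bar>) \<le> (LBINT w. ?I (r + 1) (w + X n) * \<bar>u (w + X n) - g (w + X n)\<bar>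
        + (?I r w * \<bar>g (w + X n) - g w\<bar> + ?I r w * \<bar>u w - g w\<bar>))"
    proof (rule integral_mono)
      fix w
      show "?I r w * \<bar>u (w + X n) - u w\<bar> \<le> ?I (r + 1) (w + X n) * \<bar>u (w + X n) - g (w + X n)\<bar>
        + (?I r w * \<bar>g (w + X n) - g w\<bar> + ?I r w * \<bar>u w - g w\<bar>)"
      proof (cases "norm w \<le> r")
        case True
        then have "norm (w + X n) \<le> r + 1" using elim(2) norm_triangle_ineq[of w "X n"] by simp
        then show ?thesis using True by simp
      qed simp
    qed (use i1 i2 i3 i4 in auto)
    also have "\<dots> = (LBINT w. ?I (r + 1) (w + X n) * \<bar>u (w + X n) - g (w + X n)\<bar>)
        + ((LBINT w. ?I r w * \<bar>g (w + X n) - g w\<bar>) + (LBINT w. ?I r w * \<bar>u w - g w\<bar>))"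
      using i1 i2 i3 by simp
    also have "(LBINT w. ?I (r + 1) (w + X n) * \<bar>u (w + X n) - g (w + X n)\<bar>) = (LBINT w. ?I (r + 1) w * \<bar>u w - g w\<bar>)"
      using lborel_integral_translation[of "\<lambda>w. ?I (r + 1) w * \<bar>u w - g w\<bar>" "X n"] by (simp add: add.commute)
    also have "(LBINT w. ?I r w * \<bar>u w - g w\<bar>) \<le> (LBINT w. ?I (r + 1) w * \<bar>u w - g w\<bar>)"
      by (intro integral_mono i1) (auto simp: indicator_def)
    finally have "(LBINT w. ?I r w * \<bar>u (w + X n) - u w\<bar>) < \<epsilon>" using ug elim(1) by linarith
    moreover have "0 \<le> (LBINT w. ?I r w * \<bar>u (w + X n) - u w\<bar>)" by simp
    ultimately show ?case by simp
  qed
  then show "\<exists>no. \<forall>n\<ge>no. norm ((LBINT w. ?I r w * \<bar>u (w + X n) - u w\<bar>) - 0) < \<epsilon>"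
    by (simp add: eventually_sequentially)
qed

context smooth_step
begin

definition ker :: "real \<times> real \<Rightarrow> real" where
  "ker y = k 1 (fst y) * k 1 (snd y)"

lemma continuous_ker: "continuous_on UNIV ker"
  unfolding ker_def
  by (intro continuous_intros continuous_on_compose2[OF continuous_k[of UNIV]]) auto

lemma borel_measurable_ker [measurable]: "ker \<in> borel_measurable borel"
  using continuous_ker by (rule borel_measurable_continuous_onI)

lemma ker_nonneg: "0 \<le> ker y"
  unfolding ker_def by (intro mult_nonneg_nonneg k1_nonneg)

lemma ker_nonzeroD: "ker y \<noteq> 0 \<Longrightarrow> 1 \<le> fst y \<and> fst y \<le> 2 \<and> 1 \<le> snd y \<and> snd y \<le> 2"
  using k_eq_0[of "fst y" 0] k_eq_0[of "snd y" 0] by (force simp: ker_def)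

lemma ker_eq_0: "norm y > 4 \<Longrightarrow> ker y = 0"
  using ker_nonzeroD[of y] norm_Pair_le[of "fst y" "snd y"] by fastforce

lemma integrable_ker: "integrable lborel ker"
  using integrable_mult_compact[of "\<lambda>_. 1" 1 ker 4] continuous_ker ker_eq_0 by simp

lemma integral_ker: "(LBINT y. ker y) = 1"
proof -
  have "(\<integral>y. ker y \<partial>(lborel \<Otimes>\<^sub>M lborel)) = (LBINT x. (LBINT y. ker (x, y)))"
    using integrable_ker by (intro lborel_pair.integral_fst'[symmetric]) (simp add: lborel_prod)
  also have "\<dots> = 1" using integral_k1 by (simp add: ker_def)
  finally show ?thesis by (simp add: lborel_prod)
qed

lemma mol_eq: "u \<in> borel_measurable borel \<Longrightarrow> mol n u z = (LBINT y. u (z + (1 / real (Suc n)) *\<^sub>R y) * ker y)"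
  unfolding ker_def by (rule mol_shift)

lemma continuous_mol:
  assumes "u \<in> borel_measurable borel" "\<And>w. \<bar>u w\<bar> \<le> L"
  shows "continuous_on UNIV (mol n u)"
  using continuous_cv[OF assms, of n 0 0] by (simp add: mol_def)

lemma integrable_mult_ker:
  assumes [measurable]: "u \<in> borel_measurable borel" and "\<And>w. \<bar>u w\<bar> \<le> L"
  shows "integrable lborel (\<lambda>y. u y * ker y)"
  by (rule integrable_mult_compact[OF assms continuous_ker ker_eq_0])

lemma mol_bound:
  assumes [measurable]: "u \<in> borel_measurable borel" and b: "\<And>w. \<bar>u w\<bar> \<le> L"
  shows "\<bar>mol n u z\<bar> \<le> L"
proof -
  let ?v = "\<lambda>y. u (z + (1 / real (Suc n)) *\<^sub>R y)"
  have i: "integrable lborel (\<lambda>y. ?v y * ker y)" by (rule integrable_mult_ker[where L=L]) (use b in auto)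
  have "\<bar>mol n u z\<bar> \<le> (LBINT y. \<bar>?v y * ker y\<bar>)"
    using mol_eq[OF assms(1)] by (metis integral_abs_bound)
  also have "\<dots> \<le> (LBINT y. L * ker y)"
  proof (rule integral_mono)
    show "integrable lborel (\<lambda>y. \<bar>?v y * ker y\<bar>)" using i by (rule integrable_abs)
    show "integrable lborel (\<lambda>y. L * ker y)" using integrable_ker by simp
    show "\<bar>?v y * ker y\<bar> \<le> L * ker y" for y
      unfolding abs_mult abs_of_nonneg[OF ker_nonneg] by (rule mult_right_mono[OF b ker_nonneg])
  qed
  finally show ?thesis by (simp add: integral_ker)
qed

lemma mol_eq_0:
  assumes "u \<in> borel_measurable borel"
    and "\<And>w. fst z \<le> fst w \<Longrightarrow> fst w \<le> fst z + 2 / real (Suc n) \<Longrightarrow> snd z \<le> snd w \<Longrightarrow>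
       snd w \<le> snd z + 2 / real (Suc n) \<Longrightarrow> u w = 0"
  shows "mol n u z = 0"
proof -
  have "u (z + (1 / real (Suc n)) *\<^sub>R y) * ker y = 0" for y
    using ker_nonzeroD[of y] by (cases "ker y = 0") (auto intro!: assms(2) divide_right_mono)
  then show ?thesis unfolding mol_eq[OF assms(1)] by (simp only: integral_zero)
qed

lemma mol_nonneg:
  assumes "u \<in> borel_measurable borel" "\<And>w. 0 \<le> u w"
  shows "0 \<le> mol n u z"
  unfolding mol_eq[OF assms(1)] using assms(2) ker_nonneg by (intro integral_nonneg_AE) auto

text \<open>Here the derivative falls on the function and not on the kernel, so mollification
  commutes with the x-derivative; this is what makes mollified test functions converge together with
  their derivatives.\<close>

lemma mol_deriv_x:
  fixes g g' :: "real \<times> real \<Rightarrow> real"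
  assumes d: "\<And>x t. ((\<lambda>x. g (x, t)) has_real_derivative g' (x, t)) (at x)"
    and c: "continuous_on UNIV g" "continuous_on UNIV g'"
  shows "((\<lambda>x. mol n g (x, t)) has_real_derivative mol n g' (x0, t)) (at x0)"
proof -
  note m = borel_measurable_continuous_onI[OF c(1)] borel_measurable_continuous_onI[OF c(2)]
  let ?N = "1 / real (Suc n)"
  have "((\<lambda>x. LBINT y. 1 * (g ((x, t) + ?N *\<^sub>R y) * ker y)) has_real_derivative
    (LBINT y. 1 * (g' ((x0, t) + ?N *\<^sub>R y) * ker y))) (at x0)"
  proof (rule has_real_derivative_integral_compact[where L=1 and P="\<lambda>x y. g ((x, t) + ?N *\<^sub>R y) * ker y"
      and P'="\<lambda>x y. g' ((x, t) + ?N *\<^sub>R y) * ker y"])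
    show "((\<lambda>x. g ((x, t) + ?N *\<^sub>R y) * ker y) has_real_derivative g' ((x, t) + ?N *\<^sub>R y) * ker y) (at x)" for x y
      using DERIV_cmult_right[OF d[of "t + ?N * snd y" "x + ?N * fst y", unfolded DERIV_shift], of "ker y"]
      by (cases y) simp
    show "continuous_on UNIV (\<lambda>y. g ((x, t) + ?N *\<^sub>R y) * ker y)" for x
      by (intro continuous_intros continuous_on_compose2[OF c(1)] continuous_on_compose2[OF continuous_ker]) auto
    show "continuous_on UNIV (\<lambda>(x, y). g' ((x, t) + ?N *\<^sub>R y) * ker y)"
      unfolding case_prod_unfold
      by (intro continuous_intros continuous_on_compose2[OF c(2)] continuous_on_compose2[OF continuous_ker]) auto
    show "\<exists>r. \<forall>x y. \<bar>x - x0\<bar> < 2 \<longrightarrow> r < norm y \<longrightarrow> g ((x, t) + ?N *\<^sub>R y) * ker y = 0" for x0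
      using ker_eq_0 by auto
  qed auto
  then show ?thesis unfolding mol_eq[OF m(1)] mol_eq[OF m(2)] by simp
qed

lemma mol_tendsto:
  fixes g :: "real \<times> real \<Rightarrow> real"
  assumes c: "continuous_on UNIV g" and b: "\<And>w. \<bar>g w\<bar> \<le> L"
  shows "(\<lambda>n. mol n g z) \<longlonglongrightarrow> g z"
proof -
  note m[measurable] = borel_measurable_continuous_onI[OF c]
  have "(\<lambda>n. LBINT y. g (z + (1 / real (Suc n)) *\<^sub>R y) * ker y) \<longlonglongrightarrow> (LBINT y. g z * ker y)"
  proof (rule integral_dominated_convergence[where w="\<lambda>y. L * ker y"])
    show "AE y in lborel. (\<lambda>n. g (z + (1 / real (Suc n)) *\<^sub>R y) * ker y) \<longlonglongrightarrow> g z * ker y"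
    proof (rule AE_I2)
      fix y
      have "(\<lambda>n. 1 / real (Suc n)) \<longlonglongrightarrow> 0" by (rule lim_inverse_n'[THEN LIMSEQ_Suc])
      then have "(\<lambda>n. z + (1 / real (Suc n)) *\<^sub>R y) \<longlonglongrightarrow> z + 0 *\<^sub>R y" by (intro tendsto_intros)
      then have "(\<lambda>n. z + (1 / real (Suc n)) *\<^sub>R y) \<longlonglongrightarrow> z" by simp
      then have "(\<lambda>n. g (z + (1 / real (Suc n)) *\<^sub>R y)) \<longlonglongrightarrow> g z"
        using c continuous_on_tendsto_compose[of UNIV g "\<lambda>n. z + (1 / real (Suc n)) *\<^sub>R y" z sequentially] by auto
      then show "(\<lambda>n. g (z + (1 / real (Suc n)) *\<^sub>R y) * ker y) \<longlonglongrightarrow> g z * ker y" by (intro tendsto_intros)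
    qed
    show "AE y in lborel. norm (g (z + (1 / real (Suc n)) *\<^sub>R y) * ker y) \<le> L * ker y" for n
      unfolding real_norm_def abs_mult abs_of_nonneg[OF ker_nonneg] by (rule AE_I2) (rule mult_right_mono[OF b ker_nonneg])
  qed (use integrable_ker in auto)
  then show ?thesis unfolding mol_eq[OF m] by (simp add: integral_ker)
qed

text \<open>Fubini bounds the L^1 error by the \<open>ker\<close>-average over y of the L^1 distance
  between \<open>u\<close> and its translate by y/(n+1). Each such distance tends to 0 and is at
  most 2 L times the volume of the ball, which allows dominated convergence in y.\<close>

lemma mol_L1_tendsto:
  assumes u: "u \<in> borel_measurable borel" and b: "\<And>w. \<bar>u w\<bar> \<le> L"
  shows "(\<lambda>n. LBINT z. indicator (cball 0 r) z * \<bar>mol n u z - u z\<bar>) \<longlonglongrightarrow> 0"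
proof -
  note [measurable] = u
  have L: "L \<ge> 0" using b abs_ge_zero order_trans by blast
  let ?I = "\<lambda>z. indicator (cball (0 :: real \<times> real) r) z :: real"
  let ?s = "\<lambda>n y. (1 / real (Suc n)) *\<^sub>R y :: real \<times> real"
  let ?T = "\<lambda>n y. LBINT z. ?I z * \<bar>u (z + ?s n y) - u z\<bar>"
  have [measurable]: "mol n u \<in> borel_measurable borel" for n
    using continuous_mol[OF u b] by (rule borel_measurable_continuous_onI)
  have bound: "(LBINT z. ?I z * \<bar>mol n u z - u z\<bar>) \<le> (LBINT y. ?T n y * ker y)" for n
  proof -
    let ?f = "\<lambda>z y. ?I z * \<bar>u (z + ?s n y) - u z\<bar> * ker y"
    obtain c where c: "c \<ge> 0" "\<And>y. \<bar>ker y\<bar> \<le> c"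
      using continuous_compact_support_bounded[OF continuous_ker ker_eq_0] by blast
    have "integrable lborel (case_prod ?f)"
    proof (rule integrable_bounded_compact[where r="r + 4" and c="2 * L * c"])
      have "case_prod ?f \<in> borel_measurable (borel \<Otimes>\<^sub>M borel)" by measurable
      then show "case_prod ?f \<in> borel_measurable borel" by (simp add: borel_prod)
      show "\<bar>case_prod ?f w\<bar> \<le> 2 * L * c" for w
      proof -
        obtain z y where w: "w = (z, y)" by (cases w)
        have "\<bar>?I z * \<bar>u (z + ?s n y) - u z\<bar>\<bar> \<le> 2 * L"
          using b[of z] b[of "z + ?s n y"] L by (auto simp: indicator_def)
        then show ?thesis using c(2)[of y] L unfolding w prod.case abs_mult[of _ "ker y"]
          by (intro mult_mono) auto
      qed
      show "case_prod ?f w = 0" if w: "norm w > r + 4" for w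
      proof -
        obtain z y where w': "w = (z, y)" by (cases w)
        have "norm z > r \<or> norm y > 4" using norm_Pair_le[of z y] w w' by fastforce
        then show ?thesis using ker_eq_0[of y] by (auto simp: w')
      qed
    qed
    then have int: "integrable (lborel \<Otimes>\<^sub>M lborel) (case_prod ?f)" by (simp add: lborel_prod)
    have "(LBINT z. ?I z * \<bar>mol n u z - u z\<bar>) \<le> (LBINT z. (LBINT y. ?f z y))"
    proof (rule integral_mono)
      show "integrable lborel (\<lambda>z. ?I z * \<bar>mol n u z - u z\<bar>)"
        by (rule integrable_indicator_abs_diff[where L=L]) (use b mol_bound[OF u b] in auto)
      show "integrable lborel (\<lambda>z. LBINT y. ?f z y)"
        using lborel_pair.integrable_fst'[OF int] by simp
      fix z
      have i: "integrable lborel (\<lambda>y. (u (z + ?s n y) - u z) * ker y)"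
      proof (rule integrable_mult_ker[where L="2 * L"])
        show "\<bar>u (z + ?s n y) - u z\<bar> \<le> 2 * L" for y using b[of z] b[of "z + ?s n y"] by auto
      qed measurable
      have i': "integrable lborel (\<lambda>y. u (z + ?s n y) * ker y)"
        by (rule integrable_mult_ker[where L=L]) (use b in auto)
      have "mol n u z - u z = (LBINT y. (u (z + ?s n y) - u z) * ker y)"
        unfolding mol_eq[OF u] using i' integrable_ker by (simp add: left_diff_distrib integral_ker)
      then have "\<bar>mol n u z - u z\<bar> \<le> (LBINT y. \<bar>(u (z + ?s n y) - u z) * ker y\<bar>)"
        by (metis integral_abs_bound)
      also have "\<dots> = (LBINT y. \<bar>u (z + ?s n y) - u z\<bar> * ker y)"
        using ker_nonneg by (simp add: abs_mult)
      finally have "?I z * \<bar>mol n u z - u z\<bar> \<le> ?I z * (LBINT y. \<bar>u (z + ?s n y) - u z\<bar> * ker y)"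
        by (intro mult_left_mono) auto
      then show "?I z * \<bar>mol n u z - u z\<bar> \<le> (LBINT y. ?f z y)" by (simp add: mult.assoc)
    qed
    also have "\<dots> = (LBINT y. (LBINT z. ?f z y))"
      using lborel_pair.Fubini_integral[OF int] by simp
    finally show ?thesis by simp
  qed
  have "(\<lambda>n. LBINT y. ?T n y * ker y) \<longlonglongrightarrow> (LBINT y. 0 * ker y)"
  proof (rule integral_dominated_convergence[where w="\<lambda>y. (LBINT z. 2 * L * ?I z) * ker y"])
    show "AE y in lborel. (\<lambda>n. ?T n y * ker y) \<longlonglongrightarrow> 0 * ker y"
    proof (intro AE_I2 tendsto_mult tendsto_const)
      fix y :: "real \<times> real"
      have "(\<lambda>n. 1 / real (Suc n)) \<longlonglongrightarrow> 0" by (rule lim_inverse_n'[THEN LIMSEQ_Suc])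
      then have "(\<lambda>n. ?s n y) \<longlonglongrightarrow> 0 *\<^sub>R y" by (intro tendsto_intros)
      then show "(\<lambda>n. ?T n y) \<longlonglongrightarrow> 0" by (intro L1_translation_tendsto_0[OF u b]) simp
    qed
    show "AE y in lborel. norm (?T n y * ker y) \<le> (LBINT z. 2 * L * ?I z) * ker y" for n
    proof (rule AE_I2)
      fix y
      have "?T n y \<le> (LBINT z. 2 * L * ?I z)"
      proof (rule integral_mono)
        show "integrable lborel (\<lambda>z. ?I z * \<bar>u (z + ?s n y) - u z\<bar>)"
          by (rule integrable_indicator_abs_diff[where L=L]) (use b in auto)
        show "integrable lborel (\<lambda>z. 2 * L * ?I z)" by (rule integrable_indicator_cball)
        fix z show "?I z * \<bar>u (z + ?s n y) - u z\<bar> \<le> 2 * L * ?I z"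
          using b[of z] b[of "z + ?s n y"] by (auto simp: indicator_def)
      qed
      moreover have "?T n y \<ge> 0" by simp
      ultimately show "norm (?T n y * ker y) \<le> (LBINT z. 2 * L * ?I z) * ker y"
        using ker_nonneg[of y] by (simp add: abs_mult mult_right_mono)
    qed
    show "integrable lborel (\<lambda>y. (LBINT z. 2 * L * ?I z) * ker y)"
      using integrable_ker by simp
    have "(\<lambda>y. LBINT z. ?I z * \<bar>u (z + ?s n y) - u z\<bar>) \<in> borel_measurable borel" for n
      by (rule lborel.borel_measurable_lebesgue_integral) measurable
    then show "(\<lambda>y. ?T n y * ker y) \<in> borel_measurable lborel" for n by measurable
  qed simp
  then have "(\<lambda>n. LBINT y. ?T n y * ker y) \<longlonglongrightarrow> 0" by simp
  from tendsto_0_if_nonneg_le[OF _ bound this] show ?thesis by simp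
qed

end

section \<open>The mollified potential\<close>

context smooth_step
begin

text \<open>The mollifier looks forward, so supports spread backward in time by at most 2/(n+1) and
  not at all beyond T; the condition on \<delta> keeps them inside the open half plane. In space the
  spread 2/(n+1) is simply bounded by 2.\<close>

lemma mol_in_Cc_infty:
  assumes c: "continuous_on UNIV g"
    and supp: "\<And>x t. g (x, t) \<noteq> 0 \<Longrightarrow> \<bar>x\<bar> \<le> M \<and> \<delta> \<le> t \<and> t \<le> T"
    and \<delta>: "2 / real (Suc n) < \<delta>"
  shows "mol n g \<in> Cc_infty half_plane"
    and "\<And>x t. mol n g (x, t) \<noteq> 0 \<Longrightarrow> \<bar>x\<bar> \<le> M + 2 \<and> \<delta> - 2 / real (Suc n) \<le> t \<and> t \<le> T"
proof -
  have le2: "2 / real (Suc n) \<le> 2" by (simp add: field_simps)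
  show nz: "\<bar>x\<bar> \<le> M + 2 \<and> \<delta> - 2 / real (Suc n) \<le> t \<and> t \<le> T" if "mol n g (x, t) \<noteq> 0" for x t
  proof (rule ccontr)
    assume *: "\<not> ?thesis"
    have "mol n g (x, t) = 0"
    proof (rule mol_eq_0[OF borel_measurable_continuous_onI[OF c]], rule ccontr)
      fix w assume w: "fst (x, t) \<le> fst w" "fst w \<le> fst (x, t) + 2 / real (Suc n)"
        "snd (x, t) \<le> snd w" "snd w \<le> snd (x, t) + 2 / real (Suc n)" "g w \<noteq> 0"
      then have "\<bar>fst w\<bar> \<le> M" "\<delta> \<le> snd w" "snd w \<le> T" using supp[of "fst w" "snd w"] by auto
      moreover have "\<bar>x\<bar> \<le> \<bar>fst w\<bar> + 2"
        using w(1,2) le2 by (simp only: fst_conv; linarith)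
      moreover have "\<delta> - 2 / real (Suc n) \<le> t"
        using w(4) calculation(2) by (simp only: snd_conv; linarith)
      moreover have "t \<le> T" using w(3) calculation(3) by (simp only: snd_conv)
      ultimately show False using * by auto
    qed
    then show False using that by simp
  qed
  have supp': "norm z > \<bar>M\<bar> + (\<bar>\<delta>\<bar> + \<bar>T\<bar>) \<Longrightarrow> g z = 0" for z
    using supp[of "fst z" "snd z"] norm_Pair_le[of "fst z" "snd z"] by (cases "g z = 0") auto
  obtain L where L: "\<And>w. \<bar>g w\<bar> \<le> L" using continuous_compact_support_bounded[OF c supp'] by blast
  show "mol n g \<in> Cc_infty half_plane"
  proof (rule Cc_inftyI)
    show "Ck k (mol n g)" for k by (rule Ck_mol[OF borel_measurable_continuous_onI[OF c] L])
    show "compact ({- (M + 2)..M + 2} \<times> {\<delta> - 2 / real (Suc n)..T})" by (intro compact_Times) auto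
    show "{- (M + 2)..M + 2} \<times> {\<delta> - 2 / real (Suc n)..T} \<subseteq> half_plane" using \<delta> by auto
    show "mol n g z = 0" if "z \<notin> {- (M + 2)..M + 2} \<times> {\<delta> - 2 / real (Suc n)..T}" for z
    proof (rule ccontr)
      assume "mol n g z \<noteq> 0"
      then have "\<bar>fst z\<bar> \<le> M + 2 \<and> \<delta> - 2 / real (Suc n) \<le> snd z \<and> snd z \<le> T"
        using nz[of "fst z" "snd z"] by simp
      then have "z \<in> {- (M + 2)..M + 2} \<times> {\<delta> - 2 / real (Suc n)..T}"
        unfolding mem_Times_iff abs_le_iff by auto
      then show False using that by blast
    qed
  qed
qed

text \<open>The energy argument tests with powers of positive parts, which are only C^1. Their
  mollifications are admissible and converge pointwise together with their x-derivatives, dominated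
  on a fixed ball.\<close>

lemma one_sided_bound_C1:
  fixes b g g' :: "real \<times> real \<Rightarrow> real"
  assumes b: "b \<in> borel_measurable borel" "\<And>w. \<bar>b w\<bar> \<le> L"
    and one_sided: "\<And>\<phi>. \<phi> \<in> Cc_infty half_plane \<Longrightarrow> (\<And>z. \<phi> z \<ge> 0) \<Longrightarrow>
       (LBINT z. b z * partial_x \<phi> z) \<ge> - (LBINT z. C / snd z * \<phi> z)"
    and d: "\<And>x t. ((\<lambda>x. g (x, t)) has_real_derivative g' (x, t)) (at x)"
    and c: "continuous_on UNIV g" "continuous_on UNIV g'"
    and g: "\<And>z. g z \<ge> 0"
    and \<delta>: "\<delta> > 0" and supp: "\<And>x t. g (x, t) \<noteq> 0 \<Longrightarrow> \<bar>x\<bar> \<le> M \<and> \<delta> \<le> t \<and> t \<le> T"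
    and supp': "\<And>x t. g' (x, t) \<noteq> 0 \<Longrightarrow> \<bar>x\<bar> \<le> M \<and> \<delta> \<le> t \<and> t \<le> T"
  shows "(LBINT z. b z * g' z) \<ge> - (LBINT z. C / snd z * g z)"
proof -
  define r where "r = \<bar>M\<bar> + 2 + (\<bar>\<delta>\<bar> + \<bar>T\<bar>)"
  have out: "w = 0" if "norm z > r" "w \<noteq> 0 \<Longrightarrow> \<bar>fst z\<bar> \<le> M + 2 \<and> 0 \<le> snd z \<and> snd z \<le> T" for z :: "real \<times> real" and w :: real
    using that norm_Pair_le[of "fst z" "snd z"] by (cases "w = 0") (auto simp: r_def)
  have z: "norm z > r \<Longrightarrow> g z = 0" "norm z > r \<Longrightarrow> g' z = 0" for z
    by (erule out; use supp[of "fst z" "snd z"] supp'[of "fst z" "snd z"] \<delta> in force)+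
  obtain L1 where L1: "L1 \<ge> 0" "\<And>w. \<bar>g w\<bar> \<le> L1" using continuous_compact_support_bounded[OF c(1) z(1)] by blast
  obtain L2 where L2: "L2 \<ge> 0" "\<And>w. \<bar>g' w\<bar> \<le> L2" using continuous_compact_support_bounded[OF c(2) z(2)] by blast
  note m[measurable] = b(1) borel_measurable_continuous_onI[OF c(1)] borel_measurable_continuous_onI[OF c(2)]
  have [measurable]: "mol n g \<in> borel_measurable borel" "mol n g' \<in> borel_measurable borel" for n
    using continuous_mol[OF m(2) L1(2)] continuous_mol[OF m(3) L2(2)] by (auto intro: borel_measurable_continuous_onI)
  have msnd[measurable]: "(\<lambda>z::real \<times> real. snd z) \<in> borel_measurable borel"
    by (intro borel_measurable_continuous_onI continuous_intros)
  have L: "L \<ge> 0" using b(2) abs_ge_zero order_trans by blast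
  \<comment> \<open>Index shift: from \<open>n0\<close> on the mollified supports stay in t \<ge>
    \<delta>/2, so the singular coefficient C/t is bounded there uniformly in n.\<close>
  obtain n0 :: nat where "4 / \<delta> < real n0" using reals_Archimedean2 by blast
  then have n0: "2 / real (Suc (n + n0)) < \<delta> / 2" for n
  proof -
    have "4 / \<delta> < real (Suc (n + n0))" using \<open>4 / \<delta> < real n0\<close> by simp
    then show ?thesis using \<delta> by (simp add: field_simps)
  qed
  have n0': "2 / real (Suc (n + n0)) < \<delta>" for n using n0[of n] \<delta> by linarith
  note mm = mol_in_Cc_infty[OF c(1) supp n0'] mol_in_Cc_infty(2)[OF c(2) supp' n0']
  have sm: "\<bar>fst z\<bar> \<le> M + 2 \<and> \<delta> / 2 \<le> snd z \<and> snd z \<le> T" if "mol (n + n0) g z \<noteq> 0" for z n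
    using mm(2)[of n "fst z" "snd z"] n0[of n] that by simp
  have sm': "\<bar>fst z\<bar> \<le> M + 2 \<and> \<delta> / 2 \<le> snd z \<and> snd z \<le> T" if "mol (n + n0) g' z \<noteq> 0" for z n
    using mm(3)[of n "fst z" "snd z"] n0[of n] that by simp
  have px: "partial_x (mol n g) = mol n g'" for n
    using mol_deriv_x[OF d c, THEN DERIV_imp_deriv] by auto
  have ineq: "(LBINT z. b z * mol (n + n0) g' z) \<ge> - (LBINT z. C / snd z * mol (n + n0) g z)" for n
    using one_sided[OF mm(1) mol_nonneg[OF m(2) g]] unfolding px .
  have lim1: "(\<lambda>n. LBINT z. b z * mol (n + n0) g' z) \<longlonglongrightarrow> (LBINT z. b z * g' z)"
  proof (rule integral_dominated_convergence[where w="\<lambda>z. (L * L2) * indicator (cball 0 r) z"])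
    show "AE z in lborel. (\<lambda>n. b z * mol (n + n0) g' z) \<longlonglongrightarrow> b z * g' z"
      by (intro AE_I2 tendsto_mult tendsto_const LIMSEQ_ignore_initial_segment mol_tendsto[OF c(2) L2(2)])
    show "AE z in lborel. norm (b z * mol (n + n0) g' z) \<le> L * L2 * indicator (cball 0 r) z" for n
    proof (rule AE_I2)
      fix z show "norm (b z * mol (n + n0) g' z) \<le> L * L2 * indicator (cball 0 r) z"
      proof (cases "norm z \<le> r")
        case True
        then show ?thesis using b(2)[of z] mol_bound[OF m(3) L2(2), of "n + n0" z] L by (auto simp: abs_mult intro!: mult_mono)
      next
        case False
        then have "mol (n + n0) g' z = 0" by (intro out[of z]) (use sm'[of n z] \<delta> in auto)
        then show ?thesis using L L2(1) by simp
      qed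
    qed
    show "integrable lborel (\<lambda>z. L * L2 * indicator (cball (0::real\<times>real) r) z)" by (rule integrable_indicator_cball)
  qed measurable
  have lim2: "(\<lambda>n. LBINT z. C / snd z * mol (n + n0) g z) \<longlonglongrightarrow> (LBINT z. C / snd z * g z)"
  proof (rule integral_dominated_convergence[where w="\<lambda>z. (\<bar>C\<bar> / (\<delta> / 2) * L1) * indicator (cball 0 r) z"])
    show "AE z in lborel. (\<lambda>n. C / snd z * mol (n + n0) g z) \<longlonglongrightarrow> C / snd z * g z"
      by (intro AE_I2 tendsto_mult tendsto_const LIMSEQ_ignore_initial_segment mol_tendsto[OF c(1) L1(2)])
    show "AE z in lborel. norm (C / snd z * mol (n + n0) g z) \<le> \<bar>C\<bar> / (\<delta> / 2) * L1 * indicator (cball 0 r) z" for n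
    proof (rule AE_I2)
      fix z show "norm (C / snd z * mol (n + n0) g z) \<le> \<bar>C\<bar> / (\<delta> / 2) * L1 * indicator (cball 0 r) z"
      proof (cases "mol (n + n0) g z = 0")
        case True
        then show ?thesis using L1 \<delta> by simp
      next
        case False
        have s: "\<delta> / 2 \<le> snd z" using sm[OF False] by simp
        have "norm z \<le> r" using out[of z "mol (n + n0) g z"] sm[of n z] \<delta> False by force
        moreover have "\<bar>C / snd z\<bar> \<le> \<bar>C\<bar> / (\<delta> / 2)"
          unfolding abs_divide using s \<delta> by (intro divide_left_mono) auto
        moreover have "\<bar>C / snd z * mol (n + n0) g z\<bar> \<le> \<bar>C\<bar> / (\<delta> / 2) * L1"
          unfolding abs_mult[of "C / snd z"] using calculation(2) mol_bound[OF m(2) L1(2)] \<delta> by (intro mult_mono) auto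
        ultimately show ?thesis by simp
      qed
    qed
    show "integrable lborel (\<lambda>z. \<bar>C\<bar> / (\<delta> / 2) * L1 * indicator (cball (0::real\<times>real) r) z)" by (rule integrable_indicator_cball)
  qed measurable
  show ?thesis
    by (rule LIMSEQ_le[OF tendsto_minus[OF lim2] lim1]) (use ineq in auto)
qed

text \<open>\<open>pot n e F\<close> is a primitive of the closed form \<open>e\<^sub>n dx - F\<^sub>n dt\<close> formed by the mollifications of
  \<open>e\<close> and \<open>F\<close>, normalised to vanish at the origin. Its closedness is the equation \<open>e\<^sub>t + F\<^sub>x = 0\<close>,
  which only has to be tested with \<open>(kn n 0 y - kn n 0 (y - x)) * kn n 1 (s - t)\<close>.\<close>

definition pot :: "nat \<Rightarrow> (real \<times> real \<Rightarrow> real) \<Rightarrow> (real \<times> real \<Rightarrow> real) \<Rightarrow> real \<times> real \<Rightarrow> real" where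
  "pot n e F z =
     (LBINT w. e w * ((kn n 0 (fst w) - kn n 0 (fst w - fst z)) * kn n 1 (snd w - snd z))) -
     (LBINT w. F w * (kn n 1 (fst w) * (kn n 0 (snd w) - kn n 0 (snd w - snd z))))"

text \<open>The t-derivative of \<open>pot\<close>, valid for every t because it falls on the
  kernels alone. Its identification with the mollified flux, up to sign, rests on the conservation
  law and is made from t = 0 on.\<close>

definition pot_t :: "nat \<Rightarrow> (real \<times> real \<Rightarrow> real) \<Rightarrow> (real \<times> real \<Rightarrow> real) \<Rightarrow> real \<times> real \<Rightarrow> real" where
  "pot_t n e F z =
     - (LBINT w. e w * ((kn n 0 (fst w) - kn n 0 (fst w - fst z)) * kn n 2 (snd w - snd z))) -
     (LBINT w. F w * (kn n 1 (fst w) * kn n 1 (snd w - snd z)))"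

lemma pot_minus: "pot n (\<lambda>w. - e w) (\<lambda>w. - F w) z = - pot n e F z"
  by (simp add: pot_def)

text \<open>\<open>kn n 0\<close> alone does not decay at plus infinity. The difference of two
  translates vanishes for large |y|, both terms being 0 on the left and 1 on the right; this gives
  the kernels of the potential, and the associated test function, compact support.\<close>

lemma kn_diff_eq_0: "\<bar>y\<bar> \<ge> \<bar>x\<bar> + 2 \<Longrightarrow> kn n 0 y - kn n 0 (y - x) = 0"
  using kn0_left[of y n] kn0_left[of "y - x" n] kn0_right[of y n] kn0_right[of "y - x" n]
  by (cases "y \<ge> 0") auto

lemma kn_diff_kn_eq_0:
  assumes "norm w > \<bar>x\<bar> + \<bar>t\<bar> + 4"
  shows "(kn n 0 (fst w) - kn n 0 (fst w - x)) * kn n (Suc j) (snd w - t) = 0"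
    and "kn n (Suc j) (fst w - x) * (kn n 0 (snd w) - kn n 0 (snd w - t)) = 0"
proof -
  have w: "norm w \<le> \<bar>fst w\<bar> + \<bar>snd w\<bar>" using norm_Pair_le[of "fst w" "snd w"] by simp
  show "(kn n 0 (fst w) - kn n 0 (fst w - x)) * kn n (Suc j) (snd w - t) = 0"
  proof (cases "\<bar>fst w\<bar> \<ge> \<bar>x\<bar> + 2")
    case False
    then have "snd w - t \<le> 0 \<or> snd w - t > 2" using w assms by linarith
    then show ?thesis using kn_eq_0' by simp
  qed (simp add: kn_diff_eq_0)
  show "kn n (Suc j) (fst w - x) * (kn n 0 (snd w) - kn n 0 (snd w - t)) = 0"
  proof (cases "\<bar>snd w\<bar> \<ge> \<bar>t\<bar> + 2")
    case False
    then have "fst w - x \<le> 0 \<or> fst w - x > 2" using w assms by linarith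
    then show ?thesis using kn_eq_0' by simp
  qed (simp add: kn_diff_eq_0)
qed

lemma bounded_shift_dist: "dist z z0 \<le> 1 \<Longrightarrow> \<bar>fst z\<bar> + \<bar>snd z\<bar> \<le> \<bar>fst z0\<bar> + \<bar>snd z0\<bar> + 2" for z z0 :: "real \<times> real"
  using dist_fst_le[of z z0] dist_snd_le[of z z0] by (auto simp: dist_real_def)

lemma
  assumes e: "e \<in> borel_measurable borel" "\<And>w. \<bar>e w\<bar> \<le> L"
    and F: "F \<in> borel_measurable borel" "\<And>w. \<bar>F w\<bar> \<le> L"
  shows pot_deriv_x: "((\<lambda>x. pot n e F (x, t)) has_real_derivative mol n e (x0, t)) (at x0)"
    and pot_deriv_t: "((\<lambda>t. pot n e F (x, t)) has_real_derivative pot_t n e F (x, t0)) (at t0)"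
    and continuous_pot: "continuous_on UNIV (pot n e F)"
    and continuous_pot_t: "continuous_on UNIV (pot_t n e F)"
proof -
  have d0: "((\<lambda>x. kn n i (y - x)) has_real_derivative - kn n (Suc i) (y - x)) (at x)" for i x y
    by (rule DERIV_cong[OF DERIV_chain2[OF kn_deriv]]) (auto intro!: derivative_eq_intros)
  have dx: "((\<lambda>x. LBINT w. e w * ((kn n 0 (fst w) - kn n 0 (fst w - x)) * kn n 1 (snd w - t))) has_real_derivative
     (LBINT w. e w * (kn n 1 (fst w - x0) * kn n 1 (snd w - t)))) (at x0)"
  proof (rule has_real_derivative_integral_compact[OF e, where P="\<lambda>x w. (kn n 0 (fst w) - kn n 0 (fst w - x)) * kn n 1 (snd w - t)"
     and P'="\<lambda>x w. kn n 1 (fst w - x) * kn n 1 (snd w - t)"])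
    show "((\<lambda>x. (kn n 0 (fst w) - kn n 0 (fst w - x)) * kn n 1 (snd w - t)) has_real_derivative
       kn n 1 (fst w - x) * kn n 1 (snd w - t)) (at x)" for x w
      by (rule DERIV_cmult_right, rule DERIV_cong[OF DERIV_diff[OF DERIV_const d0]]) simp
    show "\<exists>r. \<forall>x w. \<bar>x - x0\<bar> < 2 \<longrightarrow> r < norm w \<longrightarrow> (kn n 0 (fst w) - kn n 0 (fst w - x)) * kn n 1 (snd w - t) = 0" for x0
      unfolding One_nat_def
      by (intro exI[of _ "\<bar>x0\<bar> + 2 + \<bar>t\<bar> + 4"] allI impI kn_diff_kn_eq_0) linarith
  qed (auto intro!: continuous_intros simp: case_prod_unfold)
  show "((\<lambda>x. pot n e F (x, t)) has_real_derivative mol n e (x0, t)) (at x0)"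
    unfolding pot_def mol_def cv_def fst_conv snd_conv
    by (rule DERIV_cong[OF DERIV_diff[OF dx DERIV_const]]) simp
  have dt1: "((\<lambda>t. LBINT w. e w * ((kn n 0 (fst w) - kn n 0 (fst w - x)) * kn n 1 (snd w - t))) has_real_derivative
     (LBINT w. e w * ((kn n 0 (fst w) - kn n 0 (fst w - x)) * - kn n 2 (snd w - t0)))) (at t0)"
  proof (rule has_real_derivative_integral_compact[OF e, where P="\<lambda>t w. (kn n 0 (fst w) - kn n 0 (fst w - x)) * kn n 1 (snd w - t)"
     and P'="\<lambda>t w. (kn n 0 (fst w) - kn n 0 (fst w - x)) * - kn n 2 (snd w - t)"])
    show "((\<lambda>t. (kn n 0 (fst w) - kn n 0 (fst w - x)) * kn n 1 (snd w - t)) has_real_derivative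
       (kn n 0 (fst w) - kn n 0 (fst w - x)) * - kn n 2 (snd w - t)) (at t)" for t w
      using d0[of 1 "snd w" t] by (intro DERIV_cmult) (simp add: numeral_2_eq_2)
    show "\<exists>r. \<forall>t w. \<bar>t - t0\<bar> < 2 \<longrightarrow> r < norm w \<longrightarrow> (kn n 0 (fst w) - kn n 0 (fst w - x)) * kn n 1 (snd w - t) = 0" for t0
      unfolding One_nat_def
      by (intro exI[of _ "\<bar>x\<bar> + (\<bar>t0\<bar> + 2) + 4"] allI impI kn_diff_kn_eq_0) linarith
  qed (auto intro!: continuous_intros simp: case_prod_unfold)
  have dt2: "((\<lambda>t. LBINT w. F w * (kn n 1 (fst w) * (kn n 0 (snd w) - kn n 0 (snd w - t)))) has_real_derivative
     (LBINT w. F w * (kn n 1 (fst w) * kn n 1 (snd w - t0)))) (at t0)"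
  proof (rule has_real_derivative_integral_compact[OF F, where P="\<lambda>t w. kn n 1 (fst w) * (kn n 0 (snd w) - kn n 0 (snd w - t))"
     and P'="\<lambda>t w. kn n 1 (fst w) * kn n 1 (snd w - t)"])
    show "((\<lambda>t. kn n 1 (fst w) * (kn n 0 (snd w) - kn n 0 (snd w - t))) has_real_derivative
       kn n 1 (fst w) * kn n 1 (snd w - t)) (at t)" for t w
      by (rule DERIV_cmult, rule DERIV_cong[OF DERIV_diff[OF DERIV_const d0]]) simp
    show "\<exists>r. \<forall>t w. \<bar>t - t0\<bar> < 2 \<longrightarrow> r < norm w \<longrightarrow> kn n 1 (fst w) * (kn n 0 (snd w) - kn n 0 (snd w - t)) = 0" for t0
    proof (intro exI[of _ "(\<bar>t0\<bar> + 2) + 4"] allI impI)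
      fix t w assume "\<bar>t - t0\<bar> < 2" "(\<bar>t0\<bar> + 2) + 4 < norm (w :: real \<times> real)"
      then show "kn n 1 (fst w) * (kn n 0 (snd w) - kn n 0 (snd w - t)) = 0"
        using kn_diff_kn_eq_0(2)[of 0 t w n 0] by simp
    qed
  qed (auto intro!: continuous_intros simp: case_prod_unfold)
  show "((\<lambda>t. pot n e F (x, t)) has_real_derivative pot_t n e F (x, t0)) (at t0)"
    unfolding pot_def pot_t_def fst_conv snd_conv
    by (rule DERIV_cong[OF DERIV_diff[OF dt1 dt2]]) simp
  have c1: "continuous_on UNIV (\<lambda>z. LBINT w. e w * ((kn n 0 (fst w) - kn n 0 (fst w - fst z)) * kn n (Suc j) (snd w - snd z)))" for j
  proof (rule continuous_on_integral_compact[OF e])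
    show "\<exists>r. \<forall>z w. dist z z0 \<le> 1 \<longrightarrow> r < norm w \<longrightarrow> (kn n 0 (fst w) - kn n 0 (fst w - fst z)) * kn n (Suc j) (snd w - snd z) = 0" for z0 :: "real \<times> real"
    proof (intro exI[of _ "\<bar>fst z0\<bar> + \<bar>snd z0\<bar> + 2 + 4"] allI impI kn_diff_kn_eq_0(1))
      fix z w :: "real \<times> real" assume "dist z z0 \<le> 1" "\<bar>fst z0\<bar> + \<bar>snd z0\<bar> + 2 + 4 < norm w"
      then show "\<bar>fst z\<bar> + \<bar>snd z\<bar> + 4 < norm w" using bounded_shift_dist[of z z0] by linarith
    qed
  qed (auto intro!: continuous_intros simp: case_prod_unfold)
  have c2: "continuous_on UNIV (\<lambda>z::real \<times> real. LBINT w. F w * (kn n 1 (fst w) * (kn n 0 (snd w) - kn n 0 (snd w - snd z))))"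
  proof (rule continuous_on_integral_compact[OF F])
    show "\<exists>r. \<forall>z w. dist z z0 \<le> 1 \<longrightarrow> r < norm w \<longrightarrow> kn n 1 (fst w) * (kn n 0 (snd w) - kn n 0 (snd w - snd z)) = 0" for z0 :: "real \<times> real"
    proof (intro exI[of _ "\<bar>fst z0\<bar> + \<bar>snd z0\<bar> + 2 + 4"] allI impI)
      fix z w :: "real \<times> real" assume "dist z z0 \<le> 1" "\<bar>fst z0\<bar> + \<bar>snd z0\<bar> + 2 + 4 < norm w"
      then have "\<bar>0\<bar> + \<bar>snd z\<bar> + 4 < norm w" using bounded_shift_dist[of z z0] by linarith
      from kn_diff_kn_eq_0(2)[OF this, of n 0]
      show "kn n 1 (fst w) * (kn n 0 (snd w) - kn n 0 (snd w - snd z)) = 0" by simp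
    qed
  qed (auto intro!: continuous_intros simp: case_prod_unfold)
  have c3: "continuous_on UNIV (\<lambda>z::real \<times> real. LBINT w. F w * (kn n 1 (fst w) * kn n 1 (snd w - snd z)))"
  proof (rule continuous_on_integral_compact[OF F])
    show "\<exists>r. \<forall>z w. dist z z0 \<le> 1 \<longrightarrow> r < norm w \<longrightarrow> kn n 1 (fst w) * kn n 1 (snd w - snd z) = 0" for z0 :: "real \<times> real"
    proof (intro exI[of _ "\<bar>fst z0\<bar> + \<bar>snd z0\<bar> + 2 + 4"] allI impI)
      fix z w :: "real \<times> real" assume "dist z z0 \<le> 1" "\<bar>fst z0\<bar> + \<bar>snd z0\<bar> + 2 + 4 < norm w"
      then have "norm (0, snd z) + 4 < norm w" using bounded_shift_dist[of z z0] by simp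
      from kn_kn_eq_0[OF this, of n 0 0]
      show "kn n 1 (fst w) * kn n 1 (snd w - snd z) = 0" by simp
    qed
  qed (auto intro!: continuous_intros simp: case_prod_unfold)
  show "continuous_on UNIV (pot n e F)"
    using continuous_on_diff[OF c1[of 0] c2] by (simp add: pot_def[abs_def])
  show "continuous_on UNIV (pot_t n e F)"
    using continuous_on_diff[OF continuous_on_minus[OF c1[of 1]] c3] by (simp add: pot_t_def[abs_def] numeral_2_eq_2)
qed

lemma pot_t_eq:
  assumes e: "e \<in> borel_measurable borel" "\<And>w. \<bar>e w\<bar> \<le> L"
    and F: "F \<in> borel_measurable borel" "\<And>w. \<bar>F w\<bar> \<le> L"
    and weak: "\<And>\<phi>. \<phi> \<in> Cc_infty half_plane \<Longrightarrow> (LBINT z. e z * partial_t \<phi> z + F z * partial_x \<phi> z) = 0"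
    and t: "t \<ge> 0"
  shows "pot_t n e F (x, t) = - mol n F (x, t)"
proof -
  \<comment> \<open>The kernel of \<open>mol\<close>, integrated over the segment from (0, t) to (x,
    t): testing with it amounts to integrating the mollified equation along this segment.\<close>
  let ?\<phi> = "\<lambda>w. (kn n 0 (fst w) - kn n 0 (fst w - x)) * kn n 1 (snd w - t)"
  have "?\<phi> \<in> Cc_infty half_plane"
  proof (rule Cc_inftyI)
    show "Ck k ?\<phi>" for k by (rule Ck_product[OF smooth_kn_diff smooth_kn_shift])
    let ?K = "{- (\<bar>x\<bar> + 2)..\<bar>x\<bar> + 2} \<times> {t + 1 / real (Suc n)..t + 2 / real (Suc n)}"
    show "compact ?K" by (intro compact_Times) auto
    \<comment> \<open>The mollifier starts at 1/(n+1) and not at 0, so the support stays strictly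
      inside the half plane even for t = 0.\<close>
    have "0 < 1 / real (Suc n)" by simp
    then have "0 < t + 1 / real (Suc n)" using t by linarith
    then show "?K \<subseteq> half_plane" by (auto simp del: of_nat_Suc)
    show "?\<phi> w = 0" if "w \<notin> ?K" for w
    proof (cases "\<bar>fst w\<bar> \<ge> \<bar>x\<bar> + 2")
      case False
      then have "snd w - t < 1 / real (Suc n) \<or> snd w - t > 2 / real (Suc n)"
        using that by (cases w) (auto simp del: of_nat_Suc)
      then show ?thesis using kn_eq_0[of "snd w - t" n 0] by simp
    qed (simp add: kn_diff_eq_0)
  qed
  from weak[OF this] have w0: "(LBINT z. e z * partial_t ?\<phi> z + F z * partial_x ?\<phi> z) = 0" .
  have sh: "((\<lambda>x. kn n i (x - c)) has_real_derivative kn n (Suc i) (x - c)) (at x)" for i x c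
    by (rule DERIV_cong[OF DERIV_chain2[OF kn_deriv]]) (auto intro!: derivative_eq_intros)
  have pt: "partial_t ?\<phi> = (\<lambda>w. (kn n 0 (fst w) - kn n 0 (fst w - x)) * kn n 2 (snd w - t))"
    unfolding numeral_2_eq_2 One_nat_def by (auto intro!: DERIV_imp_deriv DERIV_cmult sh)
  have px: "partial_x ?\<phi> = (\<lambda>w. (kn n 1 (fst w) - kn n 1 (fst w - x)) * kn n 1 (snd w - t))"
    unfolding One_nat_def by (auto intro!: DERIV_imp_deriv DERIV_cmult_right DERIV_diff sh kn_deriv)
  have i1: "integrable lborel (\<lambda>w. e w * ((kn n 0 (fst w) - kn n 0 (fst w - x)) * kn n 2 (snd w - t)))"
    unfolding numeral_2_eq_2
    by (rule integrable_mult_compact[OF e, where r="\<bar>x\<bar> + \<bar>t\<bar> + 4"])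
       (intro continuous_intros kn_diff_kn_eq_0)+
  have i2: "integrable lborel (\<lambda>w. F w * (kn n 1 (fst w) * kn n 1 (snd w - t)))"
  proof (rule integrable_mult_compact[OF F, where r="\<bar>t\<bar> + 4"])
    show "kn n 1 (fst w) * kn n 1 (snd w - t) = 0" if "\<bar>t\<bar> + 4 < norm w" for w
      using kn_kn_eq_0[of "(0, t)" w n 0 0] that by simp
  qed (intro continuous_intros)
  have i3: "integrable lborel (\<lambda>w. F w * (kn n 1 (fst w - x) * kn n 1 (snd w - t)))"
  proof (rule integrable_mult_compact[OF F, where r="norm (x, t) + 4"])
    show "kn n 1 (fst w - x) * kn n 1 (snd w - t) = 0" if "norm (x, t) + 4 < norm w" for w
      using kn_kn_eq_0[OF that, of n 0 0] by simp
  qed (intro continuous_intros)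
  have "(LBINT w. e w * ((kn n 0 (fst w) - kn n 0 (fst w - x)) * kn n 2 (snd w - t)))
      + ((LBINT w. F w * (kn n 1 (fst w) * kn n 1 (snd w - t))) - (LBINT w. F w * (kn n 1 (fst w - x) * kn n 1 (snd w - t))))
     = (LBINT w. e w * ((kn n 0 (fst w) - kn n 0 (fst w - x)) * kn n 2 (snd w - t)) +
         (F w * (kn n 1 (fst w) * kn n 1 (snd w - t)) - F w * (kn n 1 (fst w - x) * kn n 1 (snd w - t))))"
    using i1 i2 i3 by simp
  also have "\<dots> = 0" using w0 unfolding pt px by (simp add: algebra_simps)
  finally show ?thesis unfolding pot_t_def mol_def cv_def by simp
qed

text \<open>At t = 0 the term with \<open>F\<close> vanishes and the spatial factor lies between -1
  and 1; what remains is the time average, with weight \<open>kn n 1\<close>, of the L^1 norms of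
  the slices of \<open>e\<close>.\<close>

lemma pot_initial_bound:
  assumes e: "e \<in> borel_measurable borel" "\<And>w. \<bar>e w\<bar> \<le> L"
  shows "ennreal \<bar>pot n e F (x, 0)\<bar> \<le> (\<integral>\<^sup>+s. (\<integral>\<^sup>+y. ennreal \<bar>e (y, s)\<bar> \<partial>lborel) * ennreal (kn n 1 s) \<partial>lborel)"
proof -
  note [measurable] = e(1)
  let ?g = "\<lambda>w. e w * ((kn n 0 (fst w) - kn n 0 (fst w - x)) * kn n 1 (snd w - 0))"
  have i: "integrable lborel ?g"
    using kn_diff_kn_eq_0(1)[of x 0 _ n 0] by (intro integrable_mult_compact[OF e, where r="\<bar>x\<bar> + 4"]) (auto intro!: continuous_intros)
  have "pot n e F (x, 0) = (LBINT w. ?g w)" by (simp add: pot_def)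
  then have "ennreal \<bar>pot n e F (x, 0)\<bar> \<le> (\<integral>\<^sup>+w. ennreal (norm (?g w)) \<partial>lborel)"
    using integral_norm_bound_ennreal[OF i] by simp
  also have "\<dots> \<le> (\<integral>\<^sup>+w. ennreal (\<bar>e w\<bar>) * ennreal (kn n 1 (snd w)) \<partial>lborel)"
  proof (rule nn_integral_mono)
    fix w :: "real \<times> real"
    have "\<bar>kn n 0 (fst w) - kn n 0 (fst w - x)\<bar> \<le> 1"
      using kn0_bounds[of n "fst w"] kn0_bounds[of n "fst w - x"] by linarith
    then have "\<bar>e w\<bar> * (\<bar>kn n 0 (fst w) - kn n 0 (fst w - x)\<bar> * kn n 1 (snd w)) \<le> \<bar>e w\<bar> * kn n 1 (snd w)"
      using kn1_nonneg[of n "snd w"] by (intro mult_left_mono) (auto intro: mult_left_le_one_le)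
    then show "ennreal (norm (?g w)) \<le> ennreal (\<bar>e w\<bar>) * ennreal (kn n 1 (snd w))"
      using kn1_nonneg[of n "snd w"] by (simp add: abs_mult ennreal_mult'[symmetric] ennreal_leI)
  qed
  also have "\<dots> = (\<integral>\<^sup>+w. ennreal (\<bar>e w\<bar>) * ennreal (kn n 1 (snd w)) \<partial>(lborel \<Otimes>\<^sub>M lborel))"
    by (simp add: lborel_prod)
  also have "\<dots> = (\<integral>\<^sup>+s. (\<integral>\<^sup>+y. ennreal \<bar>e (y, s)\<bar> * ennreal (kn n 1 s) \<partial>lborel) \<partial>lborel)"
  proof -
    have "(\<lambda>w. ennreal \<bar>e w\<bar> * ennreal (kn n 1 (snd w))) \<in> borel_measurable (borel \<Otimes>\<^sub>M borel)"
      by (intro borel_measurable_times_ennreal measurable_compose[OF _ measurable_ennreal] borel_measurable_abs measurable_compose[OF measurable_snd borel_measurable_kn])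
         (use e(1) in \<open>simp add: borel_prod\<close>)
    then have "(\<lambda>w. ennreal \<bar>e w\<bar> * ennreal (kn n 1 (snd w))) \<in> borel_measurable (lborel \<Otimes>\<^sub>M lborel)"
      by (simp add: borel_prod lborel_prod)
    from lborel_pair.nn_integral_snd[OF this] show ?thesis by simp
  qed
  also have "\<dots> = (\<integral>\<^sup>+s. (\<integral>\<^sup>+y. ennreal \<bar>e (y, s)\<bar> \<partial>lborel) * ennreal (kn n 1 s) \<partial>lborel)"
    by (intro nn_integral_cong nn_integral_multc) measurable
  finally show ?thesis .
qed

text \<open>\<open>kn n 1\<close> has mass 1 and charges only times in (0, 2/(n+1)], where the
  slices of \<open>e\<close> are small in L^1 once n is large. Uniformity in x comes from
  integrating the slices over the whole line.\<close>

lemma pot_initial_small: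
  assumes e: "e \<in> borel_measurable borel" "\<And>w. \<bar>e w\<bar> \<le> L"
    and init: "\<And>\<epsilon>. \<epsilon> > 0 \<Longrightarrow> \<exists>\<tau>>0. AE s in lborel. 0 < s \<and> s < \<tau> \<longrightarrow> (\<integral>\<^sup>+y. ennreal \<bar>e (y, s)\<bar> \<partial>lborel) \<le> ennreal \<epsilon>"
    and \<epsilon>: "\<epsilon> > 0"
  shows "eventually (\<lambda>n. \<forall>x. \<bar>pot n e F (x, 0)\<bar> \<le> \<epsilon>) sequentially"
proof -
  obtain \<tau> where \<tau>: "\<tau> > 0" and ae: "AE s in lborel. 0 < s \<and> s < \<tau> \<longrightarrow> (\<integral>\<^sup>+y. ennreal \<bar>e (y, s)\<bar> \<partial>lborel) \<le> ennreal \<epsilon>"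
    using init[OF \<epsilon>] by blast
  obtain n0 :: nat where n0: "2 / \<tau> < real n0" using reals_Archimedean2 by blast
  have "\<bar>pot n e F (x, 0)\<bar> \<le> \<epsilon>" if "n \<ge> n0" for n x
  proof -
    have "2 / \<tau> < real (Suc n)" using n0 that by simp
    then have n: "2 / real (Suc n) < \<tau>" using \<tau> by (simp add: field_simps)
    have "ennreal \<bar>pot n e F (x, 0)\<bar> \<le> (\<integral>\<^sup>+s. (\<integral>\<^sup>+y. ennreal \<bar>e (y, s)\<bar> \<partial>lborel) * ennreal (kn n 1 s) \<partial>lborel)"
      by (rule pot_initial_bound[OF e])
    also have "\<dots> \<le> (\<integral>\<^sup>+s. ennreal \<epsilon> * ennreal (kn n 1 s) \<partial>lborel)"
    proof (rule nn_integral_mono_AE)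
      show "AE s in lborel. (\<integral>\<^sup>+y. ennreal \<bar>e (y, s)\<bar> \<partial>lborel) * ennreal (kn n 1 s) \<le> ennreal \<epsilon> * ennreal (kn n 1 s)"
        using ae
      proof eventually_elim
        case (elim s)
        show ?case
        proof (cases "0 < s \<and> s < \<tau>")
          case True
          then show ?thesis using elim by (intro mult_right_mono) auto
        next
          case False
          then have "s \<le> 0 \<or> s > 2 / real (Suc n)" using n by linarith
          then have "kn n 1 s = 0" using kn_eq_0'[of s n 0] kn_eq_0[of s n 0] by auto
          then show ?thesis by simp
        qed
      qed
    qed
    also have "\<dots> = ennreal \<epsilon>" using nn_integral_kn1 by (subst nn_integral_cmult) auto
    finally show ?thesis using \<epsilon> by simp
  qed
  then show ?thesis by (auto simp: eventually_sequentially)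
qed

text \<open>On [0, t] the time derivative is minus the mollified flux, which inherits the bound
  \<open>L\<close>.\<close>

lemma pot_bound:
  assumes e: "e \<in> borel_measurable borel" "\<And>w. \<bar>e w\<bar> \<le> L"
    and F: "F \<in> borel_measurable borel" "\<And>w. \<bar>F w\<bar> \<le> L"
    and weak: "\<And>\<phi>. \<phi> \<in> Cc_infty half_plane \<Longrightarrow> (LBINT z. e z * partial_t \<phi> z + F z * partial_x \<phi> z) = 0"
    and t: "t \<ge> 0"
  shows "\<bar>pot n e F (x, t)\<bar> \<le> \<bar>pot n e F (x, 0)\<bar> + L * t"
proof -
  have "norm (pot n e F (x, t) - pot n e F (x, 0)) \<le> L * norm (t - 0)"
  proof (rule field_differentiable_bound[where S="{0..t}" and f'="\<lambda>t. pot_t n e F (x, t)"])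
    show "((\<lambda>t. pot n e F (x, t)) has_field_derivative pot_t n e F (x, s)) (at s within {0..t})" for s
      using pot_deriv_t[OF e F] has_field_derivative_at_within by blast
    show "norm (pot_t n e F (x, s)) \<le> L" if "s \<in> {0..t}" for s
      using pot_t_eq[OF e F weak] mol_bound[OF F] that by simp
  qed (use t in auto)
  then show ?thesis using t by auto
qed

end

section \<open>The energy estimate\<close>

text \<open>An exponent of at least 2 makes the glued function differentiable at 0: for y > 0 the
  difference quotient there is \<open>y ^ Suc p\<close>, which tends to 0, and for y < 0 it is
  0.\<close>

lemma has_real_derivative_pos_part_power:
  fixes u :: real
  shows "((\<lambda>u. max 0 u ^ Suc (Suc p)) has_real_derivative (real p + 2) * max 0 u ^ Suc p) (at u)"
proof -
  consider "u > 0" | "u < 0" | "u = 0" by linarith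
  then show ?thesis
  proof cases
    case 1
    have "((\<lambda>u::real. u ^ Suc (Suc p)) has_real_derivative (real p + 2) * max 0 u ^ Suc p) (at u)"
      by (rule DERIV_cong[OF DERIV_pow]) (use 1 in simp)
    then show ?thesis
      by (rule DERIV_cong_ev[OF refl _ refl, THEN iffD1, rotated])
         (use 1 in \<open>auto intro!: eventually_mono[OF eventually_nhds_in_open[of "{0<..}" u]]\<close>)
  next
    case 2
    have "((\<lambda>u::real. 0) has_real_derivative (real p + 2) * max 0 u ^ Suc p) (at u)"
      using 2 by simp
    then show ?thesis
      by (rule DERIV_cong_ev[OF refl _ refl, THEN iffD1, rotated])
         (use 2 in \<open>auto intro!: eventually_mono[OF eventually_nhds_in_open[of "{..<0}" u]]\<close>)
  next
    case 3
    have "((\<lambda>y::real. max 0 y ^ Suc p) \<longlongrightarrow> max 0 0 ^ Suc p) (at 0)" by (intro tendsto_intros)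
    then have lim: "((\<lambda>y::real. max 0 y ^ Suc p) \<longlongrightarrow> 0) (at 0)" by simp
    have "((\<lambda>y::real. (max 0 y ^ Suc (Suc p) - max 0 0 ^ Suc (Suc p)) / (y - 0)) \<longlongrightarrow> 0) (at 0)"
      by (rule Lim_transform_eventually[OF lim])
         (auto simp: max_def eventually_at intro!: exI[of _ 1])
    then show ?thesis using 3 by (simp add: has_field_derivative_iff)
  qed
qed

lemma has_real_derivative_pos_part_power_chain:
  assumes "(g has_real_derivative g') (at x)"
  shows "((\<lambda>x. max 0 (g x) ^ Suc (Suc p)) has_real_derivative (real p + 2) * max 0 (g x) ^ Suc p * g') (at x)"
  by (rule DERIV_chain2[OF has_real_derivative_pos_part_power assms])

lemma has_real_derivative_pos_part_square:
  assumes "(g has_real_derivative g') (at x)"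
  shows "((\<lambda>x. max 0 (g x) ^ 2) has_real_derivative 2 * max 0 (g x) * g') (at x)"
  using has_real_derivative_pos_part_power_chain[OF assms, of 0] by (simp add: numeral_2_eq_2)

text \<open>The positive part vanishes for t < \<delta>, so the pole at 0 is never met: the function
  is 0 to the left of \<delta> and regular on the positive axis, and these two open sets cover the
  line.\<close>

lemma continuous_on_pos_part_inverse_power:
  fixes \<delta> :: real
  assumes "\<delta> > 0"
  shows "continuous_on UNIV (\<lambda>t. max 0 (t - \<delta>) ^ Suc m * inverse t ^ j)"
proof -
  have "continuous_on ({..<\<delta>} \<union> {0<..}) (\<lambda>t. max 0 (t - \<delta>) ^ Suc m * inverse t ^ j)"
  proof (rule continuous_on_open_Un)
    show "continuous_on {..<\<delta>} (\<lambda>t. max 0 (t - \<delta>) ^ Suc m * inverse t ^ j)"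
      by (rule continuous_on_eq[OF continuous_on_const[of _ 0]]) auto
  qed (auto intro!: continuous_intros)
  moreover have "{..<\<delta>} \<union> {0<..} = (UNIV :: real set)" using assms by auto
  ultimately show ?thesis by simp
qed

lemma has_real_derivative_pos_part_inverse_power:
  fixes \<delta> :: real
  assumes "\<delta> > 0"
  shows "((\<lambda>t. max 0 (t - \<delta>) ^ 2 * inverse t ^ (N + 2)) has_real_derivative
     2 * (max 0 (t - \<delta>) * inverse t ^ (N + 2)) - (real N + 2) * (max 0 (t - \<delta>) ^ 2 * inverse t ^ (N + 3))) (at t)"
proof (cases "t > 0")
  case True
  have 1: "((\<lambda>t. max 0 (t - \<delta>) ^ 2) has_real_derivative 2 * max 0 (t - \<delta>)) (at t)"
    by (rule DERIV_cong[OF has_real_derivative_pos_part_square[OF DERIV_diff[OF DERIV_ident DERIV_const]]]) simp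
  have 2: "((\<lambda>t. inverse t ^ (N + 2)) has_real_derivative - (real N + 2) * inverse t ^ (N + 3)) (at t)"
    by (rule DERIV_cong[OF DERIV_power[OF DERIV_inverse]]) (use True in \<open>auto simp: eval_nat_numeral algebra_simps\<close>)
  show ?thesis
    by (rule DERIV_cong[OF DERIV_mult[OF 1 2]]) (simp add: algebra_simps)
next
  case False
  then have t: "t < \<delta>" using assms by simp
  have "((\<lambda>t. 0) has_real_derivative
     2 * (max 0 (t - \<delta>) * inverse t ^ (N + 2)) - (real N + 2) * (max 0 (t - \<delta>) ^ 2 * inverse t ^ (N + 3))) (at t)"
    using t by simp
  then show ?thesis
    by (rule DERIV_cong_ev[OF refl _ refl, THEN iffD1, rotated])
       (use t in \<open>auto intro!: eventually_mono[OF eventually_nhds_in_open[of "{..<\<delta>}" t]]\<close>)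
qed

text \<open>The weight \<open>t powr -(N+2) * (t - \<delta>)\<^sup>2\<close>, \<open>N \<ge> C\<close>, absorbs the singular coefficient \<open>C / t\<close>
  up to an error which carries the factor \<open>\<delta>\<close>.\<close>

lemma weight_inequality:
  fixes \<delta> :: real
  assumes "\<delta> > 0" "C \<le> real N"
  shows "2 * (max 0 (t - \<delta>) * inverse t ^ (N + 2)) - (real N + 2) * (max 0 (t - \<delta>) ^ 2 * inverse t ^ (N + 3))
     + C / t * (max 0 (t - \<delta>) ^ 2 * inverse t ^ (N + 2)) \<le> 2 * \<delta> * (max 0 (t - \<delta>) * inverse t ^ (N + 3))"
proof (cases "t > \<delta>")
  case True
  define y where "y = inverse t ^ (N + 3)"
  have t: "t > 0" using True assms by simp
  have y: "y \<ge> 0" "inverse t ^ (N + 2) = t * y" using t by (auto simp: y_def eval_nat_numeral)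
  have "C / t * ((t - \<delta>)^2 * (t * y)) = C * ((t - \<delta>)^2 * y)" using t by simp
  also have "\<dots> \<le> real N * ((t - \<delta>)^2 * y)" using assms y by (intro mult_right_mono) auto
  finally have "C / t * ((t - \<delta>)^2 * (t * y)) \<le> real N * ((t - \<delta>)^2 * y)" .
  \<comment> \<open>Of the N + 2 copies of (t - \<delta>)^2 y, N dominate the singular term; the
    remaining 2 turn 2 (t - \<delta>) t y into 2 \<delta> (t - \<delta>) y.\<close>
  moreover have "2 * ((t - \<delta>) * (t * y)) - (real N + 2) * ((t - \<delta>)^2 * y) + real N * ((t - \<delta>)^2 * y) = 2 * \<delta> * ((t - \<delta>) * y)"
    by (simp add: power2_eq_square algebra_simps)
  ultimately show ?thesis using True unfolding y(2) y_def[symmetric] by simp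
qed simp

text \<open>The data of one ordered pair of solutions: \<open>e\<close> and \<open>F\<close> are the
  differences of densities and fluxes, \<open>b\<close> is the characteristic speed of the first
  solution, and \<open>be_le_F\<close> is the tangent inequality. Because \<open>b\<close> treats
  the two asymmetrically, an instance bounds the potential only from above. A single
  \<open>L\<close> bounds all three functions and is the speed of the cones.\<close>

locale oleinik_pair = smooth_step +
  fixes e F b :: "real \<times> real \<Rightarrow> real" and L C :: real
  assumes L_pos: "L > 0"
    and e: "e \<in> borel_measurable borel" "\<And>w. \<bar>e w\<bar> \<le> L"
    and F: "F \<in> borel_measurable borel" "\<And>w. \<bar>F w\<bar> \<le> L"
    and b: "b \<in> borel_measurable borel" "\<And>w. \<bar>b w\<bar> \<le> L"
    and be_le_F: "\<And>w. b w * e w \<le> F w"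
    and weak: "\<And>\<phi>. \<phi> \<in> Cc_infty half_plane \<Longrightarrow> (LBINT z. e z * partial_t \<phi> z + F z * partial_x \<phi> z) = 0"
    and one_sided: "\<And>\<phi>. \<phi> \<in> Cc_infty half_plane \<Longrightarrow> (\<And>z. \<phi> z \<ge> 0) \<Longrightarrow>
       (LBINT z. b z * partial_x \<phi> z) \<ge> - (LBINT z. C / snd z * \<phi> z)"
    and init: "\<And>\<epsilon>. \<epsilon> > 0 \<Longrightarrow> \<exists>\<tau>>0. AE s in lborel. 0 < s \<and> s < \<tau> \<longrightarrow> (\<integral>\<^sup>+y. ennreal \<bar>e (y, s)\<bar> \<partial>lborel) \<le> ennreal \<epsilon>"
begin

abbreviation D :: "nat \<Rightarrow> real \<times> real \<Rightarrow> real" where "D n \<equiv> pot n e F"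

text \<open>The one-sided bound is tested with G W, where G is the power of the positive part of
  \<open>D n\<close> and W a weight, and the vanishing integral of the t-derivative of G W is added.
  The order of the constants is the point: \<open>K\<close> depends on neither \<delta> nor n, and
  \<open>K1\<close> may depend on \<delta> but not on n, so the mollification error can be removed
  before \<delta> tends to 0.\<close>

lemma energy_inequality:
  fixes M T :: real and N :: nat
  defines "q \<equiv> \<lambda>t. max 0 (T - t)"
    and "kx \<equiv> \<lambda>x t. max 0 (M - x - L * t) ^ 2 * max 0 (M + x - L * t) ^ 2"
  defines "P \<equiv> \<lambda>\<delta> n z. max 0 (D n z) ^ (N + 2) * (max 0 (snd z - \<delta>) ^ 2 * inverse (snd z) ^ (N + 2))
      * q (snd z) * kx (fst z) (snd z)"
  assumes N: "C \<le> real N" and T: "T > 0" and M: "M > 0"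
  shows "\<exists>K. \<forall>\<delta>>0. \<exists>K1. \<forall>n. (\<forall>x. \<bar>D n (x, 0)\<bar> \<le> L * \<delta>) \<longrightarrow>
    integrable lborel (P \<delta> n) \<and>
    (LBINT z. P \<delta> n z)
    \<le> K1 * ((LBINT z. indicator (cball 0 (M + T)) z * \<bar>mol n e z - e z\<bar>)
         + (LBINT z. indicator (cball 0 (M + T)) z * \<bar>mol n F z - F z\<bar>)) + \<delta> * K"
proof -
  define I where "I z = (indicator (cball 0 (M + T)) z :: real)" for z :: "real \<times> real"
  define V where "V = (LBINT z. I z)"
  \<comment> \<open>Bounds on the support: 2 L for the positive part of D divided by t, T for the
    time factor and 2 M for each of the four cone factors, integrated over a ball that contains the
    support.\<close>
  define K where "K = (2 * L) ^ (N + 2) * T^2 * (2 * M)^4 * V"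
  have I: "I z = 1" if "\<bar>fst z\<bar> \<le> M" "0 \<le> snd z" "snd z \<le> T" for z
    using that norm_Pair_le[of "fst z" "snd z"] by (auto simp: I_def)
  have I0: "0 \<le> I z" for z by (simp add: I_def)
  have intI: "integrable lborel (\<lambda>z. c * I z)" for c unfolding I_def by (rule integrable_indicator_cball)
  have "\<exists>K1. \<forall>n. (\<forall>x. \<bar>D n (x, 0)\<bar> \<le> L * \<delta>) \<longrightarrow>
    integrable lborel (P \<delta> n) \<and>
    (LBINT z. P \<delta> n z)
    \<le> K1 * ((LBINT z. I z * \<bar>mol n e z - e z\<bar>) + (LBINT z. I z * \<bar>mol n F z - F z\<bar>)) + \<delta> * K"
    if \<delta>: "\<delta> > 0" for \<delta>
  proof -
    define h where "h t = max 0 (t - \<delta>) ^ 2 * inverse t ^ (N + 2)" for t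
    define h' where "h' t = 2 * (max 0 (t - \<delta>) * inverse t ^ (N + 2)) - (real N + 2) * (max 0 (t - \<delta>) ^ 2 * inverse t ^ (N + 3))" for t
    define A where "A x t = max 0 (M - x - L * t)" for x t
    define B where "B x t = max 0 (M + x - L * t)" for x t
    \<comment> \<open>\<open>h\<close> carries the singular time weight with a cutoff at \<delta>,
      \<open>q\<close> closes the time interval at T, and \<open>A\<close>, \<open>B\<close> measure
      the distance to the two sides of the backward cone of speed L. The squares keep the product
      C^1.\<close>
    define W where "W z = h (snd z) * q (snd z)^2 * (A (fst z) (snd z)^2 * B (fst z) (snd z)^2)" for z
    define Wx where "Wx z = h (snd z) * q (snd z)^2 * (2 * A (fst z) (snd z)^2 * B (fst z) (snd z) - 2 * A (fst z) (snd z) * B (fst z) (snd z)^2)" for z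
    define Wt where "Wt z = (h' (snd z) * q (snd z)^2 - 2 * h (snd z) * q (snd z)) * (A (fst z) (snd z)^2 * B (fst z) (snd z)^2)
       - L * (h (snd z) * q (snd z)^2 * (2 * A (fst z) (snd z)^2 * B (fst z) (snd z) + 2 * A (fst z) (snd z) * B (fst z) (snd z)^2))" for z
    note sq = has_real_derivative_pos_part_square
    have Ax: "((\<lambda>x. A x t ^ 2) has_real_derivative - 2 * A x t) (at x)" for x t
    proof -
      have "((\<lambda>x. M - x - L * t) has_real_derivative - 1) (at x)" by (auto intro!: derivative_eq_intros)
      from sq[OF this] show ?thesis unfolding A_def by simp
    qed
    have Bx: "((\<lambda>x. B x t ^ 2) has_real_derivative 2 * B x t) (at x)" for x t
    proof -
      have "((\<lambda>x. M + x - L * t) has_real_derivative 1) (at x)" by (auto intro!: derivative_eq_intros)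
      from sq[OF this] show ?thesis unfolding B_def by simp
    qed
    have At: "((\<lambda>t. A x t ^ 2) has_real_derivative - 2 * L * A x t) (at t)" for x t
    proof -
      have "((\<lambda>t. M - x - L * t) has_real_derivative - L) (at t)" by (auto intro!: derivative_eq_intros)
      from sq[OF this] show ?thesis unfolding A_def by (simp add: mult_ac)
    qed
    have Bt: "((\<lambda>t. B x t ^ 2) has_real_derivative - 2 * L * B x t) (at t)" for x t
    proof -
      have "((\<lambda>t. M + x - L * t) has_real_derivative - L) (at t)" by (auto intro!: derivative_eq_intros)
      from sq[OF this] show ?thesis unfolding B_def by (simp add: mult_ac)
    qed
    have qt: "((\<lambda>t. q t ^ 2) has_real_derivative - 2 * q t) (at t)" for t
    proof -
      have "((\<lambda>t. T - t) has_real_derivative - 1) (at t)" by (auto intro!: derivative_eq_intros)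
      from sq[OF this] show ?thesis unfolding q_def by simp
    qed
    have ht: "(h has_real_derivative h' t) (at t)" for t
      unfolding h_def h'_def by (rule has_real_derivative_pos_part_inverse_power[OF \<delta>])
    have Wx: "((\<lambda>x. W (x, t)) has_real_derivative Wx (x, t)) (at x)" for x t
      unfolding W_def Wx_def fst_conv snd_conv
      by (rule DERIV_cong[OF DERIV_cmult[OF DERIV_mult[OF Ax Bx]]]) (simp add: algebra_simps)
    have Wt: "((\<lambda>t. W (x, t)) has_real_derivative Wt (x, t)) (at t)" for x t
      unfolding W_def Wt_def fst_conv snd_conv
      by (rule DERIV_cong[OF DERIV_mult[OF DERIV_mult[OF ht qt] DERIV_mult[OF At Bt]]]) (simp add: algebra_simps)
    have ch: "continuous_on UNIV h"
      using continuous_on_pos_part_inverse_power[OF \<delta>, of 1 "N + 2"] by (simp add: h_def[abs_def] numeral_2_eq_2)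
    have ch': "continuous_on UNIV h'"
      unfolding h'_def[abs_def]
      by (intro continuous_on_diff continuous_on_mult continuous_on_const
          continuous_on_pos_part_inverse_power[OF \<delta>, where m=1, unfolded Suc_1]
          continuous_on_pos_part_inverse_power[OF \<delta>, where m=0, unfolded power_Suc0_right])
    have c_snd: "continuous_on UNIV (\<lambda>z::real\<times>real. h (snd z))" "continuous_on UNIV (\<lambda>z::real\<times>real. h' (snd z))"
      by (intro continuous_on_compose2[OF ch] continuous_on_compose2[OF ch'] continuous_intros subset_UNIV)+
    have cW: "continuous_on UNIV W" "continuous_on UNIV Wx" "continuous_on UNIV Wt"
      unfolding W_def[abs_def] Wx_def[abs_def] Wt_def[abs_def] A_def B_def q_def
      by (intro continuous_intros c_snd)+
    have nn: "0 \<le> h t" "0 \<le> q t" "0 \<le> A x t" "0 \<le> B x t" for x t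
    proof -
      show "0 \<le> h t" by (cases "t > \<delta>") (use \<delta> in \<open>auto simp: h_def\<close>)
    qed (auto simp: q_def A_def B_def)
    have Wnn: "0 \<le> W z" for z unfolding W_def using nn by simp
    have supp0: "h (snd z) = 0 \<and> h' (snd z) = 0 \<or> q (snd z) = 0 \<or> A (fst z) (snd z) = 0 \<or> B (fst z) (snd z) = 0"
      if nin: "\<not> (\<bar>fst z\<bar> \<le> M \<and> \<delta> \<le> snd z \<and> snd z \<le> T)" for z
    proof -
      consider "snd z < \<delta>" | "snd z > T" | "snd z \<ge> \<delta>" "\<bar>fst z\<bar> > M" using nin by linarith
      then show ?thesis
      proof cases
        case 3
        then have "L * snd z > 0" using \<delta> L_pos by simp
        then show ?thesis using 3 unfolding A_def B_def by linarith
      qed (auto simp: h_def h'_def q_def)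
    qed
    have sW: "W z = 0" "Wx z = 0" "Wt z = 0" if "\<not> (\<bar>fst z\<bar> \<le> M \<and> \<delta> \<le> snd z \<and> snd z \<le> T)" for z
      using supp0[OF that] unfolding W_def Wx_def Wt_def by auto
    have sr: "\<not> (\<bar>fst z\<bar> \<le> M \<and> \<delta> \<le> snd z \<and> snd z \<le> T)" if "norm z > M + T" for z
      using that norm_Pair_le[of "fst z" "snd z"] \<delta> by auto
    obtain c\<^sub>W where c\<^sub>W: "c\<^sub>W \<ge> 0" "\<And>z. \<bar>W z\<bar> \<le> c\<^sub>W"
      using continuous_compact_support_bounded[OF cW(1) sW(1)[OF sr]] by blast
    \<comment> \<open>Bound for the factor of the mollification error: \<open>G1 z * W z\<close>
      with D at most 2 L T on the support, times \<open>max L 1\<close> since the error in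
      \<open>e\<close> is multiplied by \<open>b\<close> and the error in \<open>F\<close> by
      1.\<close>
    define K1 where "K1 = (real N + 2) * (2 * L * T) ^ (N + 1) * c\<^sub>W * max L 1"
    have main: "integrable lborel (P \<delta> n) \<and> (LBINT z. P \<delta> n z)
       \<le> K1 * ((LBINT z. I z * \<bar>mol n e z - e z\<bar>) + (LBINT z. I z * \<bar>mol n F z - F z\<bar>)) + \<delta> * K"
      if D0: "\<And>x. \<bar>D n (x, 0)\<bar> \<le> L * \<delta>" for n
    proof -
      define G where "G z = max 0 (D n z) ^ (N + 2)" for z
      define G1 where "G1 z = (real N + 2) * max 0 (D n z) ^ (N + 1)" for z
      define g where "g z = G z * W z" for z
      define gx where "gx z = G1 z * mol n e z * W z + G z * Wx z" for z
      define gt where "gt z = G1 z * pot_t n e F z * W z + G z * Wt z" for z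
      have N2: "N + 2 = Suc (Suc N)" "N + 1 = Suc N" by simp_all
      have dG: "((\<lambda>x. G (x, t)) has_real_derivative G1 (x, t) * mol n e (x, t)) (at x)"
               "((\<lambda>t. G (x, t)) has_real_derivative G1 (x, t) * pot_t n e F (x, t)) (at t)" for x t
        unfolding G_def G1_def N2
        by (rule has_real_derivative_pos_part_power_chain[OF pot_deriv_x[OF e F]]
          has_real_derivative_pos_part_power_chain[OF pot_deriv_t[OF e F]])+
      have gx: "((\<lambda>x. g (x, t)) has_real_derivative gx (x, t)) (at x)" for x t
        unfolding g_def gx_def by (rule DERIV_cong[OF DERIV_mult[OF dG(1) Wx]]) (simp add: algebra_simps)
      have gt: "((\<lambda>t. g (x, t)) has_real_derivative gt (x, t)) (at t)" for x t
        unfolding g_def gt_def by (rule DERIV_cong[OF DERIV_mult[OF dG(2) Wt]]) (simp add: algebra_simps)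
      note cD = continuous_pot[OF e F, of n] continuous_pot_t[OF e F, of n] continuous_mol[OF e, of n] continuous_mol[OF F, of n]
      have cG: "continuous_on UNIV G" "continuous_on UNIV G1"
        unfolding G_def[abs_def] G1_def[abs_def] by (intro continuous_intros cD)+
      have cg: "continuous_on UNIV g" "continuous_on UNIV gx" "continuous_on UNIV gt"
        unfolding g_def[abs_def] gx_def[abs_def] gt_def[abs_def] by (intro continuous_intros cD cG cW)+
      have sg: "g z = 0" "gx z = 0" "gt z = 0" if "\<not> (\<bar>fst z\<bar> \<le> M \<and> \<delta> \<le> snd z \<and> snd z \<le> T)" for z
        using sW[OF that] by (simp_all add: g_def gx_def gt_def)
      have Gnn: "0 \<le> G z" "0 \<le> G1 z" for z by (simp_all add: G_def G1_def)
      have "- (LBINT z. C / snd z * g z) \<le> (LBINT z. b z * gx z)"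
      proof (rule one_sided_bound_C1[OF b one_sided gx cg(1,2) _ \<delta>, where M=M and T=T])
        show "0 \<le> g z" for z using Gnn Wnn by (simp add: g_def)
        show "\<bar>x\<bar> \<le> M \<and> \<delta> \<le> t \<and> t \<le> T" if "g (x, t) \<noteq> 0" for x t using sg(1)[of "(x, t)"] that by auto
        show "\<bar>x\<bar> \<le> M \<and> \<delta> \<le> t \<and> t \<le> T" if "gx (x, t) \<noteq> 0" for x t using sg(2)[of "(x, t)"] that by auto
      qed
      moreover have "(LBINT z. gt z) = 0"
        by (rule integral_partial_t_eq_0[OF gt cg(1,3) sg(1)[OF sr]])
      moreover have i1: "integrable lborel (\<lambda>z. b z * gx z)"
        by (rule integrable_mult_compact[OF b cg(2) sg(2)[OF sr]])
      moreover have i2: "integrable lborel gt"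
      proof -
        have "integrable lborel (\<lambda>z. 1 * gt z)"
          by (rule integrable_mult_compact[where L=1, OF _ _ cg(3) sg(3)[OF sr]]) simp_all
        then show ?thesis by simp
      qed
      moreover have i3: "integrable lborel (\<lambda>z. C / snd z * g z)"
      proof -
        \<comment> \<open>Replacing \<open>snd z\<close> by \<open>max \<delta> (snd z)\<close>
          removes the pole without changing the product, since \<open>g\<close> vanishes at times
          below \<delta>.\<close>
        have "integrable lborel (\<lambda>z. 1 * (C / max \<delta> (snd z) * g z))"
        proof (rule integrable_mult_compact[where L=1])
          show "continuous_on UNIV (\<lambda>z. C / max \<delta> (snd z) * g z)"
            using \<delta> by (intro continuous_intros cg) (simp add: max_def)
          show "C / max \<delta> (snd z) * g z = 0" if "norm z > M + T" for z using sg(1)[OF sr[OF that]] by simp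
        qed simp_all
        also have "(\<lambda>z. 1 * (C / max \<delta> (snd z) * g z)) = (\<lambda>z. C / snd z * g z)"
          using sg(1) by (intro ext) (auto simp: max_def)
        finally show ?thesis .
      qed
      \<comment> \<open>The t-derivative integrates to 0 and the one-sided bound controls the rest.
        What follows is an upper estimate of this integrand.\<close>
      ultimately have nonneg: "0 \<le> (LBINT z. gt z + (b z * gx z + C / snd z * g z))" by simp
      let ?P = "\<lambda>z. G z * h (snd z) * q (snd z) * kx (fst z) (snd z)"
      have kx: "kx x t = A x t^2 * B x t^2" for x t by (simp add: kx_def A_def B_def)
      have sP: "?P z = 0" if "\<not> (\<bar>fst z\<bar> \<le> M \<and> \<delta> \<le> snd z \<and> snd z \<le> T)" for z
        using supp0[OF that] by (auto simp: kx)
      have iP: "integrable lborel ?P"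
      proof -
        have "integrable lborel (\<lambda>z. 1 * ?P z)"
        proof (rule integrable_mult_compact[where L=1])
          show "continuous_on UNIV ?P"
            unfolding kx A_def B_def q_def by (intro continuous_intros cG c_snd)
          show "?P z = 0" if "norm z > M + T" for z by (rule sP[OF sr[OF that]])
        qed simp_all
        then show ?thesis by simp
      qed
      note mb[measurable] = e(1) F(1) borel_measurable_continuous_onI[OF cD(3)] borel_measurable_continuous_onI[OF cD(4)]
      have iE: "integrable lborel (\<lambda>z. I z * \<bar>mol n e z - e z\<bar>)" "integrable lborel (\<lambda>z. I z * \<bar>mol n F z - F z\<bar>)"
        unfolding I_def by (rule integrable_indicator_abs_diff[where L=L]; use e F mol_bound in auto)+
      have pointwise: "gt z + (b z * gx z + C / snd z * g z)
         \<le> K1 * (I z * \<bar>mol n e z - e z\<bar> + I z * \<bar>mol n F z - F z\<bar>) + 2 * \<delta> * ((2 * L) ^ (N + 2) * T^2 * (2 * M)^4 * I z) - 2 * ?P z" for z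
      proof (cases "\<bar>fst z\<bar> \<le> M \<and> \<delta> \<le> snd z \<and> snd z \<le> T")
        case False
        have "K1 \<ge> 0" unfolding K1_def using T L_pos c\<^sub>W by simp
        then have "0 \<le> K1 * (I z * \<bar>mol n e z - e z\<bar> + I z * \<bar>mol n F z - F z\<bar>)"
          "0 \<le> 2 * \<delta> * ((2 * L) ^ (N + 2) * T^2 * (2 * M)^4 * I z)"
          using I0[of z] \<delta> L_pos M by (simp_all add: less_imp_le)
        moreover have "gt z + (b z * gx z + C / snd z * g z) = 0" using sg[OF False] by simp
        ultimately show ?thesis unfolding sP[OF False] by linarith
      next
        case True
        obtain x t where z: "z = (x, t)" by (cases z)
        have xt: "\<bar>x\<bar> \<le> M" "\<delta> \<le> t" "t \<le> T" "t > 0" using True \<delta> by (auto simp: z)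
        have Iz: "I z = 1" using I[of z] True \<delta> by auto
        \<comment> \<open>On the support t \<ge> \<delta>, so the initial error L \<delta> is
          absorbed into L t: D is at most 2 L t, as if it vanished at t = 0 with twice the Lipschitz
          constant.\<close>
        have "\<bar>D n (x, t)\<bar> \<le> \<bar>D n (x, 0)\<bar> + L * t" using pot_bound[OF e F weak] xt by simp
        also have "\<dots> \<le> L * t + L * t"
          using D0[of x] mult_left_mono[of \<delta> t L] xt L_pos by linarith
        finally have Dz: "max 0 (D n z) \<le> 2 * L * t" using xt L_pos by (auto simp: z)
        then have DT: "max 0 (D n z) \<le> 2 * L * T" using mult_left_mono[of t T "2 * L"] xt L_pos by linarith
        have pt: "pot_t n e F z = - mol n F z" using pot_t_eq[OF e F weak] xt by (simp add: z)
        define E where "E = \<bar>mol n e z - e z\<bar> + \<bar>mol n F z - F z\<bar>"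
        \<comment> \<open>The inequality \<open>b e \<le> F\<close> is used for the unmollified
          functions; the differences to the mollified ones make up the error
          \<open>E\<close>.\<close>
        have dev: "b z * mol n e z - mol n F z \<le> max L 1 * E"
        proof -
          have "b z * mol n e z - mol n F z = b z * (mol n e z - e z) + (b z * e z - F z) - (mol n F z - F z)"
            by (simp add: algebra_simps)
          also have "\<dots> \<le> \<bar>b z * (mol n e z - e z)\<bar> + \<bar>mol n F z - F z\<bar>" using be_le_F[of z] by linarith
          also have "\<dots> \<le> max L 1 * \<bar>mol n e z - e z\<bar> + max L 1 * \<bar>mol n F z - F z\<bar>"
          proof (rule add_mono)
            show "\<bar>b z * (mol n e z - e z)\<bar> \<le> max L 1 * \<bar>mol n e z - e z\<bar>"
              unfolding abs_mult by (rule mult_right_mono) (use b(2)[of z] in auto)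
            show "\<bar>mol n F z - F z\<bar> \<le> max L 1 * \<bar>mol n F z - F z\<bar>"
              using mult_right_mono[of 1 "max L 1" "\<bar>mol n F z - F z\<bar>"] by simp
          qed
          finally show ?thesis by (simp add: E_def algebra_simps)
        qed
        have "G1 z * W z * (b z * mol n e z - mol n F z) \<le> G1 z * W z * (max L 1 * E)"
          using dev Gnn Wnn by (intro mult_left_mono) auto
        also have "\<dots> \<le> ((real N + 2) * (2 * L * T) ^ (N + 1) * c\<^sub>W) * (max L 1 * E)"
        proof (rule mult_right_mono)
          have "W z \<le> c\<^sub>W" using c\<^sub>W(2)[of z] by simp
          then show "G1 z * W z \<le> (real N + 2) * (2 * L * T) ^ (N + 1) * c\<^sub>W"
            unfolding G1_def using DT T L_pos Wnn[of z] by (intro mult_mono power_mono) auto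
        qed (auto simp: E_def)
        also have "\<dots> = K1 * E" by (simp add: K1_def)
        finally have term1: "G1 z * W z * (b z * mol n e z - mol n F z) \<le> K1 * E" .
        define a where "a = A x t"
        define b' where "b' = B x t"
        have ab: "0 \<le> a" "0 \<le> b'" "a \<le> 2 * M" "b' \<le> 2 * M"
        proof -
          have "0 \<le> L * t" using L_pos xt by simp
          then have "M - x - L * t \<le> 2 * M" "M + x - L * t \<le> 2 * M" using xt(1) by linarith+
          then show "0 \<le> a" "0 \<le> b'" "a \<le> 2 * M" "b' \<le> 2 * M" using M by (simp_all add: a_def b'_def A_def B_def)
        qed
        have q: "0 \<le> q t" "q t \<le> T" using xt T by (auto simp: q_def)
        have bz: "- L \<le> b z" "b z \<le> L" using b(2)[of z] by auto
        \<comment> \<open>The lateral terms carry the factors L - b and L + b, non-negative because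
          the cone shrinks at least as fast as the characteristics move. Dropping them leaves the
          time weight and the good term from the derivative of q^2.\<close>
        have "Wt z + (b z * Wx z + C / t * W z)
          = (h' t + C / t * h t) * (q t^2 * (a^2 * b'^2)) - 2 * (h t * q t * (a^2 * b'^2))
            - h t * q t^2 * (2 * a^2 * b' * (L - b z) + 2 * a * b'^2 * (L + b z))"
          unfolding W_def Wx_def Wt_def z fst_conv snd_conv a_def[symmetric] b'_def[symmetric] by (simp add: algebra_simps)
        also have "\<dots> \<le> (h' t + C / t * h t) * (q t^2 * (a^2 * b'^2)) - 2 * (h t * q t * (a^2 * b'^2))"
          using nn(1)[of t] ab bz by simp
        also have "\<dots> \<le> 2 * \<delta> * (max 0 (t - \<delta>) * inverse t ^ (N + 3)) * (q t^2 * (a^2 * b'^2)) - 2 * (h t * q t * (a^2 * b'^2))"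
          unfolding h_def h'_def using weight_inequality[OF \<delta> N, of t] by (intro diff_right_mono mult_right_mono) auto
        finally have "G z * (Wt z + (b z * Wx z + C / t * W z))
           \<le> G z * (2 * \<delta> * (max 0 (t - \<delta>) * inverse t ^ (N + 3)) * (q t^2 * (a^2 * b'^2)) - 2 * (h t * q t * (a^2 * b'^2)))"
          using Gnn by (intro mult_left_mono) auto
        also have "\<dots> = 2 * \<delta> * ((G z * (max 0 (t - \<delta>) * inverse t ^ (N + 3))) * (q t^2 * (a^2 * b'^2))) - 2 * ?P z"
          unfolding kx z fst_conv snd_conv a_def[symmetric] b'_def[symmetric] by (simp add: algebra_simps)
        also have "\<dots> \<le> 2 * \<delta> * ((2 * L) ^ (N + 2) * (T^2 * ((2 * M)^2 * (2 * M)^2))) - 2 * ?P z"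
        proof (intro diff_right_mono mult_left_mono mult_mono power_mono)
          \<comment> \<open>The powers of t cancel exactly: N + 2 from D and 1 from the cutoff
            against N + 3 in the weight. This ties the exponent of D to that of the weight.\<close>
          have "G z * (max 0 (t - \<delta>) * inverse t ^ (N + 3)) \<le> (2 * L * t) ^ (N + 2) * (t * inverse t ^ (N + 3))"
            unfolding G_def using Dz xt \<delta> L_pos by (intro mult_mono power_mono) auto
          also have "\<dots> = (2 * L) ^ (N + 2) * ((t * inverse t) ^ (N + 3))"
            by (simp add: power_mult_distrib eval_nat_numeral mult_ac)
          also have "\<dots> = (2 * L) ^ (N + 2)" using xt by simp
          finally show "G z * (max 0 (t - \<delta>) * inverse t ^ (N + 3)) \<le> (2 * L) ^ (N + 2)" .
        qed (use ab q \<delta> L_pos xt Gnn in auto)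
        finally have term2: "G z * (Wt z + (b z * Wx z + C / t * W z))
           \<le> 2 * \<delta> * ((2 * L) ^ (N + 2) * T^2 * (2 * M)^4) - 2 * ?P z"
          by (simp add: power_mult_distrib power4_eq_xxxx power2_eq_square mult_ac)
        have "gt z + (b z * gx z + C / snd z * g z) = G1 z * W z * (b z * mol n e z - mol n F z) + G z * (Wt z + (b z * Wx z + C / t * W z))"
          unfolding gt_def gx_def g_def pt by (simp add: z algebra_simps)
        then show ?thesis using term1 term2 Iz by (simp add: E_def)
      qed
      have "0 \<le> (LBINT z. K1 * (I z * \<bar>mol n e z - e z\<bar> + I z * \<bar>mol n F z - F z\<bar>) + 2 * \<delta> * ((2 * L) ^ (N + 2) * T^2 * (2 * M)^4 * I z) - 2 * ?P z)"
        by (rule order_trans[OF nonneg integral_mono[OF _ _ pointwise]]) (use i1 i2 i3 iE iP intI in auto)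
      also have "\<dots> = K1 * ((LBINT z. I z * \<bar>mol n e z - e z\<bar>) + (LBINT z. I z * \<bar>mol n F z - F z\<bar>))
          + 2 * \<delta> * K - 2 * (LBINT z. ?P z)"
        using iE iP intI[of 1] by (simp add: K_def V_def mult.assoc)
      finally have "2 * (LBINT z. ?P z) \<le> K1 * ((LBINT z. I z * \<bar>mol n e z - e z\<bar>) + (LBINT z. I z * \<bar>mol n F z - F z\<bar>))
          + 2 * \<delta> * K" by simp
      \<comment> \<open>Since the error term is non-negative, \<open>K1\<close> can be kept
        unchanged when the inequality is halved.\<close>
      moreover have "0 \<le> K1 * ((LBINT z. I z * \<bar>mol n e z - e z\<bar>) + (LBINT z. I z * \<bar>mol n F z - F z\<bar>))"
        unfolding K1_def using T L_pos c\<^sub>W I0 by (intro mult_nonneg_nonneg add_nonneg_nonneg integral_nonneg_AE) auto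
      ultimately show ?thesis using iP unfolding G_def P_def h_def by simp
    qed
    show ?thesis
      by (rule exI[of _ K1]) (use main in blast)
  qed
  then show ?thesis unfolding I_def by blast
qed

end

section \<open>Passage to the limit in the energy estimate\<close>

lemma tendsto_integral_mult_0:
  fixes w :: "nat \<Rightarrow> 'b \<Rightarrow> real"
  assumes lim: "(\<lambda>n. \<integral>z. indicator S z * \<bar>w n z\<bar> \<partial>M) \<longlonglongrightarrow> 0"
    and int: "\<And>n. integrable M (\<lambda>z. indicator S z * \<bar>w n z\<bar>)"
    and [measurable]: "\<And>n. w n \<in> borel_measurable M" "g \<in> borel_measurable M"
    and g: "\<And>z. \<bar>g z\<bar> \<le> c" "\<And>z. z \<notin> S \<Longrightarrow> g z = 0"
  shows "(\<lambda>n. \<integral>z. w n z * g z \<partial>M) \<longlonglongrightarrow> 0"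
proof -
  have le: "\<bar>w n z * g z\<bar> \<le> c * (indicator S z * \<bar>w n z\<bar>)" for n z
    using g mult_left_mono[OF g(1)[of z], of "\<bar>w n z\<bar>"] by (cases "z \<in> S") (auto simp: abs_mult mult.commute)
  have "\<bar>\<integral>z. w n z * g z \<partial>M\<bar> \<le> c * (\<integral>z. indicator S z * \<bar>w n z\<bar> \<partial>M)" for n
  proof -
    have i: "integrable M (\<lambda>z. w n z * g z)"
      by (rule Bochner_Integration.integrable_bound[OF integrable_mult_right[OF int, of c n]])
         (use le in \<open>auto intro!: AE_I2 order_trans[OF le]\<close>)
    have "\<bar>\<integral>z. w n z * g z \<partial>M\<bar> \<le> (\<integral>z. \<bar>w n z * g z\<bar> \<partial>M)" by (rule integral_abs_bound)
    also have "\<dots> \<le> (\<integral>z. c * (indicator S z * \<bar>w n z\<bar>) \<partial>M)"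
      using i int le by (intro integral_mono) auto
    finally show ?thesis by simp
  qed
  moreover have "(\<lambda>n. c * (\<integral>z. indicator S z * \<bar>w n z\<bar> \<partial>M)) \<longlonglongrightarrow> 0"
    using tendsto_mult[OF tendsto_const lim, of c] by simp
  ultimately have "(\<lambda>n. \<bar>\<integral>z. w n z * g z \<partial>M\<bar>) \<longlonglongrightarrow> 0"
    by (intro tendsto_0_if_nonneg_le[of "\<lambda>n. \<bar>\<integral>z. w n z * g z \<partial>M\<bar>"]) auto
  then show ?thesis by (rule tendsto_rabs_zero_cancel)
qed

text \<open>These rectangles increase to the open half plane as R grows and keep away from t = 0,
  where C/t is singular. For 0 < R < 1 the rectangle is empty.\<close>

definition region :: "real \<Rightarrow> (real \<times> real) set" where
  "region R = {-R..R} \<times> {1 / R..R}"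

lemma compact_region: "compact (region R)"
  unfolding region_def by (intro compact_Times) auto

lemma integrable_region:
  fixes g :: "real \<times> real \<Rightarrow> real"
  assumes "continuous_on UNIV g"
  shows "integrable lborel (\<lambda>z. indicator (region R) z * g z)"
  using borel_integrable_compact[OF compact_region continuous_on_subset[OF assms subset_UNIV]]
  by (simp add: indicator_def if_distrib cong: if_cong)

text \<open>On the rectangle the weights of the energy estimate have a positive lower bound that is
  uniform for small \<delta>, so the power N + 2 of the positive part tends to 0 in L^1. A
  Young-type inequality then recovers the first power.\<close>

lemma (in oleinik_pair) pos_part_tendsto_0:
  assumes R: "R > 0"
  shows "(\<lambda>n. LBINT z. indicator (region R) z * max 0 (D n z)) \<longlonglongrightarrow> 0"
proof -
  obtain N :: nat where N: "C \<le> real N" using real_arch_simple by blast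
  \<comment> \<open>With these T and M each of T - t, M - x - L t and M + x - L t is at least 1 on
    the rectangle, which thus lies well inside the cone.\<close>
  define T where "T = R + 1"
  define M where "M = R + 1 + L * (R + 1)"
  have T: "T > 0" and M: "M > 0" using R L_pos by (simp_all add: T_def M_def add_pos_pos)
  let ?P = "\<lambda>\<delta> n z. max 0 (D n z) ^ (N + 2) * (max 0 (snd z - \<delta>) ^ 2 * inverse (snd z) ^ (N + 2)) * max 0 (T - snd z)
      * (max 0 (M - fst z - L * snd z) ^ 2 * max 0 (M + fst z - L * snd z) ^ 2)"
  define Er where "Er n = (LBINT z. indicator (cball 0 (M + T)) z * \<bar>mol n e z - e z\<bar>)
         + (LBINT z. indicator (cball 0 (M + T)) z * \<bar>mol n F z - F z\<bar>)" for n
  obtain K where "\<forall>\<delta>>0. \<exists>K1. \<forall>n. (\<forall>x. \<bar>D n (x, 0)\<bar> \<le> L * \<delta>) \<longrightarrow>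
    integrable lborel (?P \<delta> n) \<and> (LBINT z. ?P \<delta> n z) \<le> K1 * Er n + \<delta> * K"
    using energy_inequality[OF N T M] unfolding Er_def by blast
  then have K: "\<And>\<delta>. \<delta> > 0 \<Longrightarrow> \<exists>K1. \<forall>n. (\<forall>x. \<bar>D n (x, 0)\<bar> \<le> L * \<delta>) \<longrightarrow>
    integrable lborel (?P \<delta> n) \<and> (LBINT z. ?P \<delta> n z) \<le> K1 * Er n + \<delta> * K" by blast
  have Er: "Er \<longlonglongrightarrow> 0"
    unfolding Er_def[abs_def] using tendsto_add[OF mol_L1_tendsto[OF e] mol_L1_tendsto[OF F]] by simp
  \<comment> \<open>Lower bound of the weight: \<delta> \<le> 1/(2R) and t \<ge> 1/R leave t -
    \<delta> \<ge> 1/(2R), and t \<le> R gives the power of 1/R.\<close>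
  define c0 where "c0 = (1 / (2 * R))^2 * (1 / R) ^ (N + 2)"
  have c0: "c0 > 0" using R by (simp add: c0_def)
  note cD = continuous_pot[OF e F]
  define Y where "Y n = (LBINT z. indicator (region R) z * max 0 (D n z) ^ (N + 2))" for n
  have intY: "integrable lborel (\<lambda>z. indicator (region R) z * max 0 (D n z) ^ (N + 2))" for n
    by (intro integrable_region continuous_intros cD)
  have low: "c0 * (indicator (region R) z * max 0 (D n z) ^ (N + 2)) \<le> ?P \<delta> n z" if \<delta>: "\<delta> > 0" "\<delta> \<le> 1 / (2 * R)" for \<delta> n z
  proof (cases "z \<in> region R")
    case True
    obtain x t where z: "z = (x, t)" by (cases z)
    have xt: "\<bar>x\<bar> \<le> R" "1 / R \<le> t" "t \<le> R" using True by (auto simp: z region_def abs_le_iff)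
    have t: "t > 0" using xt R by (meson less_le_trans zero_less_divide_1_iff)
    have "1 / R = 1 / (2 * R) + 1 / (2 * R)" using R by (simp add: field_simps)
    then have 1: "1 / (2 * R) \<le> max 0 (t - \<delta>)" using xt \<delta> by linarith
    have 2: "1 / R \<le> inverse t" using xt t R by (simp add: field_simps)
    have Lt: "L * t \<le> L * (R + 1)" using xt L_pos by (intro mult_left_mono) auto
    have 3: "1 \<le> max 0 (T - t)" "1 \<le> max 0 (M - x - L * t)" "1 \<le> max 0 (M + x - L * t)"
      using xt Lt by (auto simp: T_def M_def)
    have "c0 * 1 * (1 * 1) \<le> (max 0 (t - \<delta>) ^ 2 * inverse t ^ (N + 2)) * max 0 (T - t) * (max 0 (M - x - L * t) ^ 2 * max 0 (M + x - L * t) ^ 2)"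
      unfolding c0_def using 1 2 3 R t by (intro mult_mono power_mono one_le_power) auto
    from mult_left_mono[OF this, of "max 0 (D n z) ^ (N + 2)"] show ?thesis using True by (simp add: z mult_ac)
  next
    case False
    have "0 \<le> max 0 (snd z - \<delta>) ^ 2 * inverse (snd z) ^ (N + 2)"
      using \<delta> by (cases "snd z > \<delta>") auto
    then show ?thesis using False by simp
  qed
  have Y: "Y \<longlonglongrightarrow> 0"
  proof (rule LIMSEQ_I)
    fix \<epsilon> :: real assume \<epsilon>: "\<epsilon> > 0"
    \<comment> \<open>\<delta> is fixed first, so that \<delta> K takes at most half of the allowed
      error; only then is n taken large. The summand 1 avoids a division by zero when K = 0.\<close>
    define \<delta> where "\<delta> = min (1 / (2 * R)) (c0 * \<epsilon> / (2 * (\<bar>K\<bar> + 1)))"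
    have \<delta>: "\<delta> > 0" "\<delta> \<le> 1 / (2 * R)" using R c0 \<epsilon> by (auto simp: \<delta>_def intro!: divide_pos_pos)
    have \<delta>K: "\<delta> * K \<le> c0 * \<epsilon> / 2"
    proof -
      have "\<delta> * K \<le> \<delta> * (\<bar>K\<bar> + 1)" using \<delta> by (intro mult_left_mono) auto
      also have "\<dots> \<le> c0 * \<epsilon> / (2 * (\<bar>K\<bar> + 1)) * (\<bar>K\<bar> + 1)" by (intro mult_right_mono) (auto simp: \<delta>_def)
      also have "\<dots> = c0 * \<epsilon> / 2" by (simp add: field_simps)
      finally show ?thesis .
    qed
    obtain K1 where K1: "\<And>n. (\<forall>x. \<bar>D n (x, 0)\<bar> \<le> L * \<delta>) \<Longrightarrow>
      integrable lborel (?P \<delta> n) \<and> (LBINT z. ?P \<delta> n z) \<le> K1 * Er n + \<delta> * K"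
      using K[OF \<delta>(1)] by blast
    have "(\<lambda>n. K1 * Er n) \<longlonglongrightarrow> 0" using tendsto_mult[OF tendsto_const Er, of K1] by simp
    then have "eventually (\<lambda>n. K1 * Er n < c0 * \<epsilon> / 2) sequentially"
      using c0 \<epsilon> by (intro order_tendstoD) auto
    moreover have "eventually (\<lambda>n. \<forall>x. \<bar>D n (x, 0)\<bar> \<le> L * \<delta>) sequentially"
      by (rule pot_initial_small[OF e init]) (use L_pos \<delta> in auto)
    ultimately have "eventually (\<lambda>n. norm (Y n - 0) < \<epsilon>) sequentially"
    proof eventually_elim
      case (elim n)
      have "c0 * Y n = (LBINT z. c0 * (indicator (region R) z * max 0 (D n z) ^ (N + 2)))"
        by (simp add: Y_def)
      also have "\<dots> \<le> (LBINT z. ?P \<delta> n z)"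
        using K1[OF elim(2)] low[OF \<delta>] intY by (intro integral_mono integrable_mult_right) auto
      also have "\<dots> < c0 * \<epsilon>" using K1[OF elim(2)] elim(1) \<delta>K by linarith
      finally have "Y n < \<epsilon>" using c0 by simp
      moreover have "0 \<le> Y n" by (simp add: Y_def)
      ultimately show ?case by simp
    qed
    then show "\<exists>no. \<forall>n\<ge>no. norm (Y n - 0) < \<epsilon>" by (simp add: eventually_sequentially)
  qed
  define V where "V = (LBINT z. indicator (region R) z * (1::real))"
  have intV: "integrable lborel (\<lambda>z. indicator (region R) z * 1 :: real)" by (intro integrable_region continuous_intros)
  have V: "V \<ge> 0" unfolding V_def by simp
  show ?thesis
  proof (rule LIMSEQ_I)
    fix \<epsilon> :: real assume \<epsilon>: "\<epsilon> > 0"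
    define l where "l = \<epsilon> / (2 * (V + 1))"
    have l: "l > 0" using \<epsilon> V by (simp add: l_def)
    have lV: "l * V \<le> \<epsilon> / 2"
    proof -
      have "l * V \<le> l * (V + 1)" using l by simp
      also have "\<dots> = \<epsilon> / 2" using V by (simp add: l_def field_simps)
      finally show ?thesis .
    qed
    \<comment> \<open>Either the positive part is at most the level l, or each of N + 1 further
      factors \<open>max 0 d / l\<close> is at least 1. The level is so small that l times the area
      V stays within half of the error.\<close>
    have young: "max 0 d \<le> l + max 0 d ^ (N + 2) / l ^ (N + 1)" for d :: real
    proof (cases "max 0 d \<le> l")
      case True
      moreover have "0 \<le> max 0 d ^ (N + 2) / l ^ (N + 1)" using l by simp
      ultimately show ?thesis by linarith
    next
      case False
      then have "max 0 d * l ^ (N + 1) \<le> max 0 d * max 0 d ^ (N + 1)"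
        using l by (intro mult_left_mono power_mono) auto
      also have "\<dots> = max 0 d ^ (N + 2)" by simp
      finally have "max 0 d \<le> max 0 d ^ (N + 2) / l ^ (N + 1)"
        unfolding pos_le_divide_eq[OF zero_less_power[OF l]] .
      then show ?thesis using l by linarith
    qed
    have "eventually (\<lambda>n. Y n < l ^ (N + 1) * (\<epsilon> / 2)) sequentially"
      using Y l \<epsilon> by (intro order_tendstoD) auto
    then have "eventually (\<lambda>n. norm ((LBINT z. indicator (region R) z * max 0 (D n z)) - 0) < \<epsilon>) sequentially"
    proof eventually_elim
      case (elim n)
      have "(LBINT z. indicator (region R) z * max 0 (D n z))
        \<le> (LBINT z. l * (indicator (region R) z * 1) + (1 / l ^ (N + 1)) * (indicator (region R) z * max 0 (D n z) ^ (N + 2)))"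
      proof (rule integral_mono)
        show "integrable lborel (\<lambda>z. indicator (region R) z * max 0 (D n z))"
          by (intro integrable_region continuous_intros cD)
        show "indicator (region R) z * max 0 (D n z) \<le> l * (indicator (region R) z * 1) + (1 / l ^ (N + 1)) * (indicator (region R) z * max 0 (D n z) ^ (N + 2))" for z
          using young[of "D n z"] by (cases "z \<in> region R") auto
      qed (intro Bochner_Integration.integrable_add integrable_mult_right intV intY)
      also have "\<dots> = l * V + (1 / l ^ (N + 1)) * Y n"
        using intV intY by (simp add: V_def Y_def)
      also have "\<dots> < \<epsilon> / 2 + \<epsilon> / 2"
      proof (rule add_le_less_mono[OF lV])
        show "1 / l ^ (N + 1) * Y n < \<epsilon> / 2" using elim l by (simp add: pos_divide_less_eq mult.commute)
      qed
      finally have "(LBINT z. indicator (region R) z * max 0 (D n z)) < \<epsilon>" by simp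
      moreover have "0 \<le> (LBINT z. indicator (region R) z * max 0 (D n z))" by simp
      ultimately show ?case by simp
    qed
    then show "\<exists>no. \<forall>n\<ge>no. norm ((LBINT z. indicator (region R) z * max 0 (D n z)) - 0) < \<epsilon>"
      by (simp add: eventually_sequentially)
  qed
qed

section \<open>From vanishing potentials to equality of the densities\<close>

text \<open>For R > 0 it is positive exactly in the interior of \<open>region R\<close>; the squared
  positive parts make it C^1, which suffices for a factor in a test function.\<close>

definition cutoff :: "real \<Rightarrow> real \<times> real \<Rightarrow> real" where
  "cutoff R z = max 0 (R - fst z) ^ 2 * max 0 (R + fst z) ^ 2 * (max 0 (snd z - 1 / R) ^ 2 * max 0 (R - snd z) ^ 2)"

lemma tendsto_integral_abs_region:
  fixes g :: "nat \<Rightarrow> real \<times> real \<Rightarrow> real"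
  assumes c: "\<And>n. continuous_on UNIV (g n)"
    and pos: "(\<lambda>n. LBINT z. indicator (region R) z * max 0 (g n z)) \<longlonglongrightarrow> 0"
    and neg: "(\<lambda>n. LBINT z. indicator (region R) z * max 0 (- g n z)) \<longlonglongrightarrow> 0"
  shows "(\<lambda>n. LBINT z. indicator (region R) z * \<bar>g n z\<bar>) \<longlonglongrightarrow> 0"
proof -
  have "(LBINT z. indicator (region R) z * \<bar>g n z\<bar>)
      = (LBINT z. indicator (region R) z * max 0 (g n z)) + (LBINT z. indicator (region R) z * max 0 (- g n z))" for n
  proof -
    have pos: "continuous_on UNIV (\<lambda>z. max 0 (g n z))" and neg: "continuous_on UNIV (\<lambda>z. max 0 (- g n z))"
      by (rule continuous_on_max[OF continuous_on_const c])
         (rule continuous_on_max[OF continuous_on_const continuous_on_minus[OF c]])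
    have "(LBINT z. indicator (region R) z * \<bar>g n z\<bar>)
        = (LBINT z. indicator (region R) z * max 0 (g n z) + indicator (region R) z * max 0 (- g n z))"
      by (intro Bochner_Integration.integral_cong) (auto simp: indicator_def)
    then show ?thesis
      using Bochner_Integration.integral_add[OF integrable_region[OF pos] integrable_region[OF neg]] by simp
  qed
  then show ?thesis using tendsto_add[OF pos neg] by simp
qed

text \<open>The x-derivative of \<open>pot n e F\<close> is \<open>mol n e\<close>. Integration by
  parts moves it onto a C^1 test function, so potentials tending to 0 make \<open>e\<close>
  orthogonal to such functions. Taking \<open>mol m e\<close> times a cutoff and letting m tend to
  infinity annihilates the integral of e^2 against the cutoff.\<close>

lemma (in smooth_step) AE_eq_0_if_pot_tendsto_0:
  assumes e: "e \<in> borel_measurable borel" "\<And>w. \<bar>e w\<bar> \<le> L"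
    and F: "F \<in> borel_measurable borel" "\<And>w. \<bar>F w\<bar> \<le> L"
    and lim: "\<And>R. R > 0 \<Longrightarrow> (\<lambda>n. LBINT z. indicator (region R) z * \<bar>pot n e F z\<bar>) \<longlonglongrightarrow> 0"
  shows "AE z in lborel. snd z > 0 \<longrightarrow> e z = 0"
proof -
  note [measurable] = e(1)
  have cm: "continuous_on UNIV (mol m e)" for m by (rule continuous_mol[OF e])
  have [measurable]: "mol m e \<in> borel_measurable borel" for m by (rule borel_measurable_continuous_onI[OF cm])
  note cD = continuous_pot[OF e F]
  have [measurable]: "pot n e F \<in> borel_measurable borel" for n by (rule borel_measurable_continuous_onI[OF cD])
  have "AE z in lborel. e z * e z * cutoff R z = 0"
    if R: "R > 0" for R
  proof -
    define \<eta>t where "\<eta>t z = max 0 (snd z - 1 / R) ^ 2 * max 0 (R - snd z) ^ 2" for z :: "real \<times> real"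
    define \<eta> where "\<eta> z = (max 0 (R - fst z) ^ 2 * max 0 (R + fst z) ^ 2) * \<eta>t z" for z
    define \<eta>x where "\<eta>x z = (2 * max 0 (R - fst z) ^ 2 * max 0 (R + fst z) - 2 * max 0 (R - fst z) * max 0 (R + fst z) ^ 2) * \<eta>t z" for z
    have \<eta>x: "((\<lambda>x. \<eta> (x, t)) has_real_derivative \<eta>x (x, t)) (at x)" for x t
    proof -
      have 1: "((\<lambda>x. R - x) has_real_derivative - 1) (at x)" "((\<lambda>x. R + x) has_real_derivative 1) (at x)"
        by (auto intro!: derivative_eq_intros)
      show ?thesis unfolding \<eta>_def \<eta>x_def \<eta>t_def fst_conv snd_conv
        by (rule DERIV_cong[OF DERIV_cmult_right[OF DERIV_mult[OF has_real_derivative_pos_part_square[OF 1(1)]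
              has_real_derivative_pos_part_square[OF 1(2)]]]]) (simp add: algebra_simps)
    qed
    have c\<eta>: "continuous_on UNIV \<eta>" "continuous_on UNIV \<eta>x"
      unfolding \<eta>_def[abs_def] \<eta>x_def[abs_def] \<eta>t_def[abs_def] by (intro continuous_intros)+
    have z\<eta>: "\<eta> z = 0" "\<eta>x z = 0" if "z \<notin> region R" for z
    proof -
      have "max 0 (R - fst z) = 0 \<or> max 0 (R + fst z) = 0 \<or> max 0 (snd z - 1 / R) = 0 \<or> max 0 (R - snd z) = 0"
        using that by (cases z) (auto simp: region_def)
      then show "\<eta> z = 0" "\<eta>x z = 0" by (auto simp: \<eta>_def \<eta>x_def \<eta>t_def)
    qed
    have box: "z \<notin> region R" if "norm z > R + R" for z
    proof
      assume "z \<in> region R"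
      then have "\<bar>fst z\<bar> \<le> R" "1 / R \<le> snd z" "snd z \<le> R" by (auto simp: region_def)
      moreover have "0 < 1 / R" using R by simp
      ultimately show False using that norm_Pair_le[of "fst z" "snd z"] unfolding prod.collapse real_norm_def by linarith
    qed
    have [measurable]: "\<eta> \<in> borel_measurable borel" by (rule borel_measurable_continuous_onI[OF c\<eta>(1)])
    obtain c\<^sub>\<eta> where c\<^sub>\<eta>: "c\<^sub>\<eta> \<ge> 0" "\<And>z. \<bar>\<eta> z\<bar> \<le> c\<^sub>\<eta>"
      using continuous_compact_support_bounded[OF c\<eta>(1) z\<eta>(1)[OF box]] by blast
    let ?I = "\<lambda>z. indicator (cball 0 (R + R)) z :: real"
    have iE: "integrable lborel (\<lambda>z. ?I z * \<bar>mol n e z - e z\<bar>)" for n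
      by (rule integrable_indicator_abs_diff[where L=L]) (use e mol_bound in auto)
    have L: "L \<ge> 0" using e(2) abs_ge_zero order_trans by blast
    \<comment> \<open>Two mollification indices: m is frozen in the test function while n tends to
      infinity in the identity; the limit in m is taken afterwards.\<close>
    have orth: "(LBINT z. e z * (mol m e z * \<eta> z)) = 0" for m
    proof -
      define g where "g z = mol m e z * \<eta> z" for z
      define gx where "gx z = - cv m 2 1 e z * \<eta> z + mol m e z * \<eta>x z" for z
      have gx: "((\<lambda>x. g (x, t)) has_real_derivative gx (x, t)) (at x)" for x t
        unfolding g_def gx_def mol_def
        by (rule DERIV_cong[OF DERIV_mult[OF _ \<eta>x]], unfold One_nat_def, rule cv_deriv_x[OF e])
           (simp add: numeral_2_eq_2 algebra_simps)
      have ccv: "continuous_on UNIV (cv m 2 1 e)"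
        using continuous_cv[OF e, of m 1 0] by (simp add: numeral_2_eq_2)
      have cg: "continuous_on UNIV g" "continuous_on UNIV gx"
        unfolding g_def[abs_def] gx_def[abs_def] by (intro continuous_intros cm c\<eta> ccv)+
      have zg: "g z = 0" "gx z = 0" if "z \<notin> region R" for z using z\<eta>[OF that] by (simp_all add: g_def gx_def)
      have [measurable]: "g \<in> borel_measurable borel" "gx \<in> borel_measurable borel"
        using cg by (auto intro: borel_measurable_continuous_onI)
      obtain c where c: "\<And>z. \<bar>gx z\<bar> \<le> c" using continuous_compact_support_bounded[OF cg(2) zg(2)[OF box]] by blast
      obtain c' where c': "\<And>z. \<bar>g z\<bar> \<le> c'" using continuous_compact_support_bounded[OF cg(1) zg(1)[OF box]] by blast
      have lim1: "(\<lambda>n. LBINT z. pot n e F z * gx z) \<longlonglongrightarrow> 0"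
        by (rule tendsto_integral_mult_0[OF lim[OF R] _ _ _ c zg(2)])
           (auto intro!: integrable_region continuous_intros cD)
      have lim2: "(\<lambda>n. LBINT z. (mol n e z - e z) * g z) \<longlonglongrightarrow> 0"
        by (rule tendsto_integral_mult_0[OF mol_L1_tendsto[OF e] iE _ _ c'])
           (use zg(1)[OF box] in auto)
      have i1: "integrable lborel (\<lambda>z. mol n e z * g z)" for n
        by (rule integrable_mult_compact[OF _ mol_bound[OF e] cg(1) zg(1)[OF box]]) simp
      have i2: "integrable lborel (\<lambda>z. e z * g z)"
        by (rule integrable_mult_compact[OF e cg(1) zg(1)[OF box]])
      have i3: "integrable lborel (\<lambda>z. pot n e F z * gx z)" for n
      proof -
        have "integrable lborel (\<lambda>z. 1 * (pot n e F z * gx z))"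
          by (rule integrable_mult_compact[where L=1 and r="R + R"])
             (use zg(2)[OF box] in \<open>auto intro!: continuous_intros cD cg\<close>)
        then show ?thesis by simp
      qed
      have "(LBINT z. mol n e z * g z + pot n e F z * gx z) = 0" for n
      proof (rule integral_partial_x_eq_0[where g="\<lambda>z. pot n e F z * g z"])
        show "((\<lambda>x. pot n e F (x, t) * g (x, t)) has_real_derivative mol n e (x, t) * g (x, t) + pot n e F (x, t) * gx (x, t)) (at x)" for x t
          by (rule DERIV_cong[OF DERIV_mult[OF pot_deriv_x[OF e F] gx]]) (simp add: algebra_simps)
        show "pot n e F z * g z = 0" if "norm z > R + R" for z using zg(1)[OF box[OF that]] by simp
      qed (intro continuous_intros cD cg cm)+
      then have eq: "(LBINT z. e z * g z) = - ((LBINT z. (mol n e z - e z) * g z) + (LBINT z. pot n e F z * gx z))" for n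
        using i1 i2 i3 by (simp add: left_diff_distrib) (metis add.commute add_diff_cancel_left' add_eq_0_iff minus_diff_eq uminus_add_conv_diff)
      have "(\<lambda>n. - ((LBINT z. (mol n e z - e z) * g z) + (LBINT z. pot n e F z * gx z))) \<longlonglongrightarrow> - (0 + 0)"
        by (intro tendsto_intros lim1 lim2)
      then have "(\<lambda>n::nat. LBINT z. e z * g z) \<longlonglongrightarrow> 0" unfolding eq[symmetric] by simp
      then show ?thesis unfolding g_def using LIMSEQ_const_iff by blast
    qed
    have lim3: "(\<lambda>m. LBINT z. (mol m e z - e z) * (e z * \<eta> z)) \<longlonglongrightarrow> 0"
    proof (rule tendsto_integral_mult_0[OF mol_L1_tendsto[OF e] iE])
      show "\<bar>e z * \<eta> z\<bar> \<le> L * c\<^sub>\<eta>" for z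
        unfolding abs_mult using e(2) c\<^sub>\<eta>(2) L by (intro mult_mono) auto
      show "e z * \<eta> z = 0" if "z \<notin> cball 0 (R + R)" for z using that z\<eta>(1)[OF box] by simp
    qed auto
    have i4: "integrable lborel (\<lambda>z. e z * (mol m e z * \<eta> z))" for m
    proof (rule integrable_mult_compact[OF e])
      show "mol m e z * \<eta> z = 0" if "R + R < norm z" for z using z\<eta>(1)[OF box[OF that]] by simp
    qed (intro continuous_intros cm c\<eta>)
    have i5: "integrable lborel (\<lambda>z. e z * e z * \<eta> z)"
    proof (rule integrable_mult_compact[where L="L * L", OF _ _ c\<eta>(1) z\<eta>(1)[OF box]])
      show "\<bar>e w * e w\<bar> \<le> L * L" for w unfolding abs_mult using e(2)[of w] L by (intro mult_mono) auto
    qed measurable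
    have "(LBINT z. (mol m e z - e z) * (e z * \<eta> z)) = - (LBINT z. e z * e z * \<eta> z)" for m
    proof -
      have "(LBINT z. (mol m e z - e z) * (e z * \<eta> z)) = (LBINT z. e z * (mol m e z * \<eta> z) - e z * e z * \<eta> z)"
        by (intro Bochner_Integration.integral_cong) (auto simp: algebra_simps)
      then show ?thesis using i4[of m] i5 orth[of m] by simp
    qed
    then have "(\<lambda>m::nat. - (LBINT z. e z * e z * \<eta> z)) \<longlonglongrightarrow> 0" using lim3 by simp
    then have zero: "(LBINT z. e z * e z * \<eta> z) = 0" by (simp add: LIMSEQ_const_iff)
    have "0 \<le> e z * e z * \<eta> z" for z by (simp add: \<eta>_def \<eta>t_def)
    then have "AE z in lborel. e z * e z * \<eta> z = 0"
      using zero i5 by (subst (asm) integral_nonneg_eq_0_iff_AE) auto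
    then show ?thesis by (simp add: cutoff_def \<eta>_def \<eta>t_def)
  qed
  \<comment> \<open>Countably many cutoffs exhaust the half plane, so one null set serves for all of
    them.\<close>
  then have "AE z in lborel. \<forall>j::nat. e z * e z * cutoff (real (Suc j)) z = 0"
    unfolding AE_all_countable by simp
  then show ?thesis
  proof eventually_elim
    case (elim z)
    show ?case
    proof
      assume z: "snd z > 0"
      obtain j :: nat where j: "\<bar>fst z\<bar> + snd z + 1 / snd z < real j" using reals_Archimedean2 by blast
      have pos: "1 / snd z > 0" using z by simp
      then have *: "\<bar>fst z\<bar> < real (Suc j)" "snd z < real (Suc j)" "1 / snd z < real (Suc j)" using j z pos unfolding of_nat_Suc by linarith+
      then have "1 / real (Suc j) < snd z" using z by (simp add: field_simps)
      then have "max 0 (real (Suc j) - fst z) > 0" "max 0 (real (Suc j) + fst z) > 0"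
        "max 0 (snd z - 1 / real (Suc j)) > 0" "max 0 (real (Suc j) - snd z) > 0" using * by linarith+
      moreover have "e z * e z * cutoff (real (Suc j)) z = 0"
        using elim by blast
      ultimately show "e z = 0" unfolding cutoff_def mult_eq_0_iff power_eq_0_iff by (metis less_irrefl)
    qed
  qed
qed

section \<open>Uniqueness of extended entropy solutions\<close>

lemma half_plane_borel [measurable]: "half_plane \<in> sets borel"
  by (intro borel_open open_Times) auto

text \<open>\<open>Ck\<close> is stated with Frechet derivatives in the basis directions, the
  solution concept with one-variable \<open>deriv\<close>. Identifying the two yields continuity and
  bounded support of the partial derivatives.\<close>

lemma Cc_infty_half_planeD:
  assumes "\<phi> \<in> Cc_infty half_plane"
  shows "continuous_on UNIV \<phi>" "continuous_on UNIV (partial_x \<phi>)" "continuous_on UNIV (partial_t \<phi>)"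
    and "z \<notin> half_plane \<Longrightarrow> \<phi> z = 0"
    and "\<exists>r. \<forall>z. norm z > r \<longrightarrow> partial_x \<phi> z = 0 \<and> partial_t \<phi> z = 0"
proof -
  have C1: "Ck 1 \<phi>" and C0: "Ck 0 \<phi>" and comp: "compact (closure {z. \<phi> z \<noteq> 0})" and sub: "closure {z. \<phi> z \<noteq> 0} \<subseteq> half_plane"
    using assms by (auto simp: Cc_infty_def)
  obtain r where r: "\<And>z. z \<in> closure {z. \<phi> z \<noteq> 0} \<Longrightarrow> norm z \<le> r"
    using compact_imp_bounded[OF comp] unfolding bounded_iff by blast
  have out: "\<phi> z = 0" if "z \<notin> closure {z. \<phi> z \<noteq> 0}" for z
    using that closure_subset[of "{z. \<phi> z \<noteq> 0}"] by blast
  have z0: "\<phi> z = 0" if "norm z > r" for z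
    using out[of z] r[of z] that by linarith
  have D: "(\<phi> has_derivative frechet_derivative \<phi> (at z)) (at z)" for z
  proof -
    have "\<forall>x. \<phi> differentiable (at x)" using C1 unfolding One_nat_def Ck.simps by (rule conjunct1)
    then show ?thesis using frechet_derivative_works by blast
  qed
  have Cb: "\<forall>b\<in>Basis. continuous_on UNIV (\<lambda>x. frechet_derivative \<phi> (at x) b)"
    using C1 unfolding One_nat_def Ck.simps by (rule conjunct2)
  have lin: "linear (frechet_derivative \<phi> (at z))" for z
    using has_derivative_linear[OF D] .
  have px: "((\<lambda>y. \<phi> (y, t)) has_real_derivative frechet_derivative \<phi> (at (x, t)) (1, 0)) (at x)" for x t
  proof -
    have "((\<lambda>y. \<phi> (y, t)) has_derivative (\<lambda>h. frechet_derivative \<phi> (at (x, t)) (h, 0))) (at x)"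
      by (rule has_derivative_compose[OF has_derivative_Pair[OF has_derivative_ident has_derivative_const] D])
    moreover have "frechet_derivative \<phi> (at (x, t)) (h, 0) = frechet_derivative \<phi> (at (x, t)) (1, 0) * h" for h
      using linear_cmul[OF lin, of "(x, t)" h "(1, 0)"] by simp
    then have "(\<lambda>h. frechet_derivative \<phi> (at (x, t)) (h, 0)) = (*) (frechet_derivative \<phi> (at (x, t)) (1, 0))" by (rule ext)
    ultimately show ?thesis by (simp only: has_field_derivative_def)
  qed
  have pt: "((\<lambda>s. \<phi> (x, s)) has_real_derivative frechet_derivative \<phi> (at (x, t)) (0, 1)) (at t)" for x t
  proof -
    have "((\<lambda>s. \<phi> (x, s)) has_derivative (\<lambda>h. frechet_derivative \<phi> (at (x, t)) (0, h))) (at t)"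
      by (rule has_derivative_compose[OF has_derivative_Pair[OF has_derivative_const has_derivative_ident] D])
    moreover have "frechet_derivative \<phi> (at (x, t)) (0, h) = frechet_derivative \<phi> (at (x, t)) (0, 1) * h" for h
      using linear_cmul[OF lin, of "(x, t)" h "(0, 1)"] by simp
    then have "(\<lambda>h. frechet_derivative \<phi> (at (x, t)) (0, h)) = (*) (frechet_derivative \<phi> (at (x, t)) (0, 1))" by (rule ext)
    ultimately show ?thesis by (simp only: has_field_derivative_def)
  qed
  have fx: "partial_x \<phi> = (\<lambda>z. frechet_derivative \<phi> (at z) (1, 0))"
    using px[THEN DERIV_imp_deriv] by auto
  have ft: "partial_t \<phi> = (\<lambda>z. frechet_derivative \<phi> (at z) (0, 1))"
    using pt[THEN DERIV_imp_deriv] by auto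
  have d0: "frechet_derivative \<phi> (at z) = (\<lambda>_. 0)" if "norm z > r" for z
  proof -
    have "(\<phi> has_derivative (\<lambda>_. 0)) (at z)"
    proof (rule has_derivative_transform_within_open)
      show "((\<lambda>_. 0) has_derivative (\<lambda>_. 0)) (at z)" by simp
      show "open (- cball (0::real \<times> real) r)" by (rule open_Compl[OF closed_cball])
      show "z \<in> - cball 0 r" using that by simp
      show "0 = \<phi> y" if "y \<in> - cball 0 r" for y using z0[of y] that by simp
    qed
    from has_derivative_unique[OF D this] show ?thesis .
  qed
  have B: "(1, 0) \<in> (Basis :: (real \<times> real) set)" "(0, 1) \<in> (Basis :: (real \<times> real) set)" by (auto simp: Basis_prod_def)
  show "continuous_on UNIV \<phi>" using C0 by simp
  show "continuous_on UNIV (partial_x \<phi>)" "continuous_on UNIV (partial_t \<phi>)"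
    unfolding fx ft by (rule bspec[OF Cb B(1)] bspec[OF Cb B(2)])+
  show "z \<notin> half_plane \<Longrightarrow> \<phi> z = 0" using out sub by blast
  show "\<exists>r. \<forall>z. norm z > r \<longrightarrow> partial_x \<phi> z = 0 \<and> partial_t \<phi> z = 0"
    unfolding fx ft using d0 by (intro exI[of _ r]) simp
qed

lemma AE_half_plane_iff: "(AE z in lebesgue_on half_plane. P z) \<longleftrightarrow> (AE z in lborel. z \<in> half_plane \<longrightarrow> P z)"
  by (simp add: AE_restrict_space_iff AE_completion_iff)

text \<open>Measurability of the integrand with \<open>g\<close> comes from almost everywhere
  agreement with a Borel function and completeness of Lebesgue measure. This accommodates
  compositions with \<open>f\<close> or its derivative, which are controlled only on {0..R}.\<close>

lemma integral_half_plane_eq: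
  fixes g h :: "real \<times> real \<Rightarrow> real"
  assumes h: "h \<in> borel_measurable borel" "\<And>z. z \<notin> half_plane \<Longrightarrow> h z = 0"
    and ae: "AE z in lebesgue_on half_plane. g z = h z"
  shows "(LINT z|lebesgue_on half_plane. g z) = (LBINT z. h z)"
proof -
  have hm: "h \<in> borel_measurable lebesgue" using h(1) by (simp add: measurable_completion)
  have "AE z in lebesgue. h z = indicator half_plane z *\<^sub>R g z"
    using ae[unfolded AE_half_plane_iff] h(2) unfolding AE_completion_iff by (auto simp: indicator_def elim!: eventually_mono)
  moreover from this have "(\<lambda>z. indicator half_plane z *\<^sub>R g z) \<in> borel_measurable lebesgue"
    by (rule borel_measurable_AE[OF hm])
  ultimately have "(LINT z|lebesgue. indicator half_plane z *\<^sub>R g z) = (LINT z|lebesgue. h z)"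
    using hm by (intro integral_cong_AE) (auto elim!: eventually_mono)
  then show ?thesis
    using h(1) by (subst integral_restrict_space) (auto simp: integral_completion)
qed

text \<open>Clipping to {0..R} makes the bounds hold at every point, so \<open>f\<close> and its
  derivative are evaluated only where they are controlled, and the tangent inequality holds
  everywhere.\<close>

lemma borel_representative:
  fixes \<rho> :: "real \<times> real \<Rightarrow> real"
  assumes m: "\<rho> \<in> borel_measurable (lebesgue_on half_plane)"
    and ae: "AE z in lebesgue_on half_plane. \<rho> z \<in> {0..R}" and R: "R \<ge> 0"
  obtains r where "r \<in> borel_measurable borel" "\<And>z. r z \<in> {0..R}" "\<And>z. z \<notin> half_plane \<Longrightarrow> r z = 0"
    "AE z in lebesgue_on half_plane. \<rho> z = r z"
proof -
  have "(\<lambda>z. if z \<in> half_plane then \<rho> z else 0) \<in> borel_measurable lebesgue"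
    using m by (subst borel_measurable_if) auto
  then obtain r' where r': "r' \<in> borel_measurable lborel" "AE z in lborel. (if z \<in> half_plane then \<rho> z else 0) = r' z"
    using completion_ex_borel_measurable_real by blast
  have [measurable]: "r' \<in> borel_measurable borel" using r'(1) by simp
  show ?thesis
  proof (rule that[of "\<lambda>z. indicator half_plane z * max 0 (min R (r' z))"])
    show "AE z in lebesgue_on half_plane. \<rho> z = indicator half_plane z * max 0 (min R (r' z))"
      unfolding AE_half_plane_iff using r'(2) ae[unfolded AE_half_plane_iff]
      by eventually_elim (auto simp: indicator_def)
    show "(\<lambda>z. indicator half_plane z * max 0 (min R (r' z))) \<in> borel_measurable borel" by measurable
  qed (use R in \<open>auto simp: indicator_def\<close>)
qed

text \<open>Null sets of the product measure are sliced along the first coordinate; exchanging the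
  coordinates gives slices at fixed time, of which the initial condition speaks.\<close>

lemma AE_lborel_pair_swap:
  assumes "AE z in (lborel :: (real \<times> real) measure). P z"
  shows "AE s in lborel. AE x in lborel. P (x, s)"
proof -
  have "(lborel :: (real \<times> real) measure) = lborel \<Otimes>\<^sub>M lborel" by (rule lborel_prod[symmetric])
  also have "\<dots> = distr (lborel \<Otimes>\<^sub>M lborel) (lborel \<Otimes>\<^sub>M lborel) (\<lambda>(x, y). (y, x))" by (rule lborel_pair.distr_pair_swap)
  finally have eq: "(lborel :: (real \<times> real) measure) = \<dots>" .
  have "AE z in distr (lborel \<Otimes>\<^sub>M lborel) (lborel \<Otimes>\<^sub>M lborel) (\<lambda>(x, y). (y, x)). P z"
    by (subst eq[symmetric]) (rule assms)
  then have "AE z in (lborel :: real measure) \<Otimes>\<^sub>M (lborel :: real measure). P (case z of (x, y) \<Rightarrow> (y, x))"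
    by (rule AE_distrD[rotated]) (rule measurable_pair_swap')
  from lborel_pair.AE_pair[OF this] show ?thesis by simp
qed

text \<open>Triangle inequality through \<open>\<rho>\<^sub>0\<close> for the two time
  representatives, which agree with the Borel representatives on almost every time slice. Single
  slices of a solution are not determined, hence the restriction to almost every small time.\<close>

lemma attains_initial_datum_diff_small:
  assumes \<rho>\<^sub>0: "integrable lebesgue \<rho>\<^sub>0"
    and 1: "attains_initial_datum \<rho>\<^sub>0 \<rho>\<^sub>1" and 2: "attains_initial_datum \<rho>\<^sub>0 \<rho>\<^sub>2"
    and r1: "AE z in lebesgue_on half_plane. \<rho>\<^sub>1 z = r\<^sub>1 z" and r2: "AE z in lebesgue_on half_plane. \<rho>\<^sub>2 z = r\<^sub>2 z"
    and \<epsilon>: "\<epsilon> > 0"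
  shows "\<exists>\<tau>>0. AE s in lborel. 0 < s \<and> s < \<tau> \<longrightarrow> (\<integral>\<^sup>+y. ennreal \<bar>r\<^sub>1 (y, s) - r\<^sub>2 (y, s)\<bar> \<partial>lborel) \<le> ennreal \<epsilon>"
proof -
  have *: "\<exists>g. (AE s in lborel. s > 0 \<longrightarrow> (AE x in lborel. g s x = r (x, s))) \<and> (\<forall>t>0. integrable lebesgue (g t)) \<and>
     (\<exists>\<tau>>0. \<forall>t. 0 < t \<and> t < \<tau> \<longrightarrow> (LINT x|lebesgue. \<bar>g t x - \<rho>\<^sub>0 x\<bar>) < \<epsilon> / 2)"
    if a: "attains_initial_datum \<rho>\<^sub>0 \<rho>" and r: "AE z in lebesgue_on half_plane. \<rho> z = r z" for \<rho> r
  proof -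
    obtain g where g: "AE t in lebesgue_on {0<..}. AE x in lebesgue. g t x = \<rho> (x, t)"
      "\<And>t. t > 0 \<Longrightarrow> integrable lebesgue (g t)"
      "((\<lambda>t. LINT x|lebesgue. \<bar>g t x - \<rho>\<^sub>0 x\<bar>) \<longlongrightarrow> 0) (at_right 0)"
      using a unfolding attains_initial_datum_def by blast
    have "AE s in lborel. s > 0 \<longrightarrow> (AE x in lborel. g s x = \<rho> (x, s))"
      using g(1) by (simp add: AE_restrict_space_iff AE_completion_iff)
    moreover have "AE s in lborel. AE x in lborel. (x, s) \<in> half_plane \<longrightarrow> \<rho> (x, s) = r (x, s)"
      using AE_lborel_pair_swap[OF r[unfolded AE_half_plane_iff]] .
    ultimately have "AE s in lborel. s > 0 \<longrightarrow> (AE x in lborel. g s x = r (x, s))"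
    proof eventually_elim
      case (elim s)
      show ?case
      proof
        assume "s > 0"
        then have "AE x in lborel. g s x = \<rho> (x, s)" using elim(1) by blast
        with elim(2) show "AE x in lborel. g s x = r (x, s)"
          by eventually_elim (use \<open>s > 0\<close> in auto)
      qed
    qed
    moreover have "eventually (\<lambda>t. (LINT x|lebesgue. \<bar>g t x - \<rho>\<^sub>0 x\<bar>) < \<epsilon> / 2) (at_right 0)"
      using g(3) \<epsilon> by (intro order_tendstoD) auto
    then have "\<exists>\<tau>>0. \<forall>t. 0 < t \<and> t < \<tau> \<longrightarrow> (LINT x|lebesgue. \<bar>g t x - \<rho>\<^sub>0 x\<bar>) < \<epsilon> / 2"
      by (auto simp: eventually_at_right_field)
    ultimately show ?thesis using g(2) by blast
  qed
  obtain g1 \<tau>1 where g1: "AE s in lborel. s > 0 \<longrightarrow> (AE x in lborel. g1 s x = r\<^sub>1 (x, s))"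
    "\<And>t. t > 0 \<Longrightarrow> integrable lebesgue (g1 t)" "\<tau>1 > 0"
    "\<And>t. 0 < t \<Longrightarrow> t < \<tau>1 \<Longrightarrow> (LINT x|lebesgue. \<bar>g1 t x - \<rho>\<^sub>0 x\<bar>) < \<epsilon> / 2"
    using *[OF 1 r1] by blast
  obtain g2 \<tau>2 where g2: "AE s in lborel. s > 0 \<longrightarrow> (AE x in lborel. g2 s x = r\<^sub>2 (x, s))"
    "\<And>t. t > 0 \<Longrightarrow> integrable lebesgue (g2 t)" "\<tau>2 > 0"
    "\<And>t. 0 < t \<Longrightarrow> t < \<tau>2 \<Longrightarrow> (LINT x|lebesgue. \<bar>g2 t x - \<rho>\<^sub>0 x\<bar>) < \<epsilon> / 2"
    using *[OF 2 r2] by blast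
  show ?thesis
  proof (intro exI[of _ "min \<tau>1 \<tau>2"] conjI)
    show "AE s in lborel. 0 < s \<and> s < min \<tau>1 \<tau>2 \<longrightarrow> (\<integral>\<^sup>+y. ennreal \<bar>r\<^sub>1 (y, s) - r\<^sub>2 (y, s)\<bar> \<partial>lborel) \<le> ennreal \<epsilon>"
      using g1(1) g2(1)
    proof eventually_elim
      case (elim s)
      show ?case
      proof
        assume s: "0 < s \<and> s < min \<tau>1 \<tau>2"
        have i: "integrable lebesgue (\<lambda>x. \<bar>g1 s x - \<rho>\<^sub>0 x\<bar>)" "integrable lebesgue (\<lambda>x. \<bar>g2 s x - \<rho>\<^sub>0 x\<bar>)"
          "integrable lebesgue (\<lambda>x. \<bar>g1 s x - g2 s x\<bar>)"
          using g1(2) g2(2) \<rho>\<^sub>0 s by auto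
        have "AE x in lborel. g1 s x = r\<^sub>1 (x, s)" "AE x in lborel. g2 s x = r\<^sub>2 (x, s)" using elim s by auto
        then have "AE x in lborel. ennreal \<bar>r\<^sub>1 (x, s) - r\<^sub>2 (x, s)\<bar> = ennreal \<bar>g1 s x - g2 s x\<bar>"
          by eventually_elim simp
        then have "(\<integral>\<^sup>+y. ennreal \<bar>r\<^sub>1 (y, s) - r\<^sub>2 (y, s)\<bar> \<partial>lborel) = (\<integral>\<^sup>+x. ennreal \<bar>g1 s x - g2 s x\<bar> \<partial>lborel)"
          by (rule nn_integral_cong_AE)
        also have "\<dots> = (\<integral>\<^sup>+x. ennreal \<bar>g1 s x - g2 s x\<bar> \<partial>lebesgue)" by (simp add: nn_integral_completion)
        also have "\<dots> = ennreal (LINT x|lebesgue. \<bar>g1 s x - g2 s x\<bar>)"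
          using i(3) by (intro nn_integral_eq_integral) auto
        also have "\<dots> \<le> ennreal (LINT x|lebesgue. \<bar>g1 s x - \<rho>\<^sub>0 x\<bar> + \<bar>g2 s x - \<rho>\<^sub>0 x\<bar>)"
          using i by (intro ennreal_leI integral_mono) auto
        also have "\<dots> \<le> ennreal \<epsilon>"
          using i(1,2) g1(4)[of s] g2(4)[of s] s by (intro ennreal_leI) simp
        finally show "(\<integral>\<^sup>+y. ennreal \<bar>r\<^sub>1 (y, s) - r\<^sub>2 (y, s)\<bar> \<partial>lborel) \<le> ennreal \<epsilon>" .
      qed
    qed
  qed (use g1 g2 in auto)
qed

section \<open>Concavity of the flux and the pair of solutions\<close>

text \<open>By the mean value theorem the slope of the chord is a value of f' strictly between u and
  w; monotonicity compares it with \<open>f' u\<close>, and the sign of u - w turns either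
  comparison into the same inequality.\<close>

lemma concave_above_tangent:
  fixes f f' :: "real \<Rightarrow> real"
  assumes d: "\<And>x. x \<in> {0..R} \<Longrightarrow> (f has_real_derivative f' x) (at x within {0..R})"
    and mono: "\<And>x y. x \<in> {0..R} \<Longrightarrow> y \<in> {0..R} \<Longrightarrow> x \<le> y \<Longrightarrow> f' y \<le> f' x"
    and u: "u \<in> {0..R}" and w: "w \<in> {0..R}"
  shows "f' u * (u - w) \<le> f u - f w"
proof -
  have mvt: "\<exists>\<xi>\<in>{x<..<y}. f y - f x = f' \<xi> * (y - x)" if "x < y" "x \<in> {0..R}" "y \<in> {0..R}" for x y
  proof -
    have "\<exists>\<xi>\<in>{x<..<y}. f y - f x = (\<lambda>h. f' \<xi> * h) (y - x)"
    proof (rule mvt_simple[OF \<open>x < y\<close>])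
      show "(f has_derivative (*) (f' \<xi>)) (at \<xi> within {x..y})" if "x \<le> \<xi>" "\<xi> \<le> y" for \<xi>
        using d[of \<xi>] that \<open>x \<in> {0..R}\<close> \<open>y \<in> {0..R}\<close>
        by (auto simp: has_field_derivative_def intro: has_derivative_subset)
    qed
    then show ?thesis by simp
  qed
  consider "u = w" | "w < u" | "u < w" by linarith
  then show ?thesis
  proof cases
    case 2
    then obtain \<xi> where \<xi>: "\<xi> \<in> {w<..<u}" "f u - f w = f' \<xi> * (u - w)" using mvt[of w u] u w by blast
    then have "f' u \<le> f' \<xi>" using mono[of \<xi> u] u w by auto
    then show ?thesis using \<xi> 2 by (simp add: mult_right_mono)
  next
    case 3
    then obtain \<xi> where \<xi>: "\<xi> \<in> {u<..<w}" "f w - f u = f' \<xi> * (w - u)" using mvt[of u w] u w by blast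
    then have "f' \<xi> \<le> f' u" using mono[of u \<xi>] u w by auto
    then have "f' \<xi> * (w - u) \<le> f' u * (w - u)" using 3 by (intro mult_right_mono) auto
    then show ?thesis using \<xi>(2) by (simp add: algebra_simps)
  qed simp
qed

text \<open>Clamping the argument to {0..R} extends \<open>g\<close> continuously to the line and
  changes nothing on the range of \<open>r\<close>.\<close>

lemma borel_measurable_compose_continuous_on_Icc:
  fixes g :: "real \<Rightarrow> real"
  assumes "continuous_on {0..R} g" "r \<in> borel_measurable borel" "\<And>z. r z \<in> {0..R}"
  shows "(\<lambda>z. g (r z)) \<in> borel_measurable borel"
proof -
  have R: "0 \<le> R" using assms(3) by fastforce
  have "continuous_on UNIV (\<lambda>x. g (max 0 (min R x)))"
    by (rule continuous_on_compose2[OF assms(1)]) (use R in \<open>auto intro!: continuous_intros\<close>)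
  then have "(\<lambda>z. g (max 0 (min R (r z)))) \<in> borel_measurable borel"
    using assms(2) by (intro measurable_compose[OF assms(2) borel_measurable_continuous_onI])
  also have "(\<lambda>z. g (max 0 (min R (r z)))) = (\<lambda>z. g (r z))"
  proof
    fix z show "g (max 0 (min R (r z))) = g (r z)" using assms(3)[of z] by simp
  qed
  finally show ?thesis .
qed

lemma continuous_on_Icc_bounded:
  fixes g :: "real \<Rightarrow> real"
  assumes "continuous_on {a..b} g"
  obtains c where "c \<ge> 0" "\<And>x. x \<in> {a..b} \<Longrightarrow> \<bar>g x\<bar> \<le> c"
proof -
  have "bounded (g ` {a..b})" by (intro compact_imp_bounded compact_continuous_image assms) auto
  then obtain c where "\<forall>x\<in>{a..b}. \<bar>g x\<bar> \<le> c" unfolding bounded_iff by auto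
  then show ?thesis by (intro that[of "\<bar>c\<bar>"]) fastforce+
qed

text \<open>\<open>f 0 = 0\<close> makes the integrand vanish on the lower half plane, where the
  representative is 0, so the integral extends to the whole plane. Integrability is recorded because
  the equations of two solutions will be subtracted.\<close>

lemma weak_solution_representative:
  assumes w: "weak_solution f \<rho>" and f0: "f 0 = 0"
    and f: "continuous_on {0..R} f"
    and r: "r \<in> borel_measurable borel" "\<And>z. r z \<in> {0..R}" "\<And>z. z \<notin> half_plane \<Longrightarrow> r z = 0"
    and ae: "AE z in lebesgue_on half_plane. \<rho> z = r z"
    and \<phi>: "\<phi> \<in> Cc_infty half_plane"
  shows "integrable lborel (\<lambda>z. r z * partial_t \<phi> z + f (r z) * partial_x \<phi> z)"
    and "(LBINT z. r z * partial_t \<phi> z + f (r z) * partial_x \<phi> z) = 0"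
proof -
  note s = Cc_infty_half_planeD(2,3)[OF \<phi>]
  obtain d where d: "\<forall>z. norm z > d \<longrightarrow> partial_x \<phi> z = 0 \<and> partial_t \<phi> z = 0"
    using Cc_infty_half_planeD(5)[OF \<phi>] ..
  then have d: "norm z > d \<Longrightarrow> partial_x \<phi> z = 0" "norm z > d \<Longrightarrow> partial_t \<phi> z = 0" for z by blast+
  have fr: "(\<lambda>z. f (r z)) \<in> borel_measurable borel" by (rule borel_measurable_compose_continuous_on_Icc[OF f r(1,2)])
  obtain c where c: "\<And>x. x \<in> {0..R} \<Longrightarrow> \<bar>f x\<bar> \<le> c" using continuous_on_Icc_bounded[OF f] by blast
  have rR: "\<bar>r z\<bar> \<le> R" for z using r(2)[of z] by auto
  show int: "integrable lborel (\<lambda>z. r z * partial_t \<phi> z + f (r z) * partial_x \<phi> z)"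
    by (intro Bochner_Integration.integrable_add integrable_mult_compact[OF r(1) rR s(2) d(2)] integrable_mult_compact[OF fr c[OF r(2)] s(1) d(1)])
  have "(LINT z|lebesgue_on half_plane. \<rho> z * partial_t \<phi> z + f (\<rho> z) * partial_x \<phi> z)
     = (LBINT z. r z * partial_t \<phi> z + f (r z) * partial_x \<phi> z)"
  proof (rule integral_half_plane_eq)
    show "(\<lambda>z. r z * partial_t \<phi> z + f (r z) * partial_x \<phi> z) \<in> borel_measurable borel"
      using borel_measurable_integrable[OF int] by simp
    show "r z * partial_t \<phi> z + f (r z) * partial_x \<phi> z = 0" if "z \<notin> half_plane" for z
      using r(3)[OF that] f0 by simp
    show "AE z in lebesgue_on half_plane. \<rho> z * partial_t \<phi> z + f (\<rho> z) * partial_x \<phi> z = r z * partial_t \<phi> z + f (r z) * partial_x \<phi> z"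
      using ae by eventually_elim simp
  qed
  then show "(LBINT z. r z * partial_t \<phi> z + f (r z) * partial_x \<phi> z) = 0"
    using w \<phi> unfolding weak_solution_def by simp
qed

text \<open>\<open>f'\<close> need not vanish at 0, so it takes the indicator, beyond the zero
  extension of \<open>r\<close>, to remove the lower half plane. The derivative \<open>d\<close> is
  replaced by a continuous function that agrees with it on {0..R}.\<close>

lemma one_sided_bound_representative:
  assumes o: "one_sided_bound d \<rho>"
    and d: "\<And>x. x \<in> {0..R} \<Longrightarrow> d x = f' x" and f': "continuous_on {0..R} f'"
    and r: "r \<in> borel_measurable borel" "\<And>z. r z \<in> {0..R}" "\<And>z. z \<notin> half_plane \<Longrightarrow> r z = 0"
    and ae: "AE z in lebesgue_on half_plane. \<rho> z = r z"
  shows "\<exists>C. \<forall>\<phi>\<in>Cc_infty half_plane. (\<forall>z. \<phi> z \<ge> 0) \<longrightarrow>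
     (LBINT z. indicator half_plane z * f' (r z) * partial_x \<phi> z) \<ge> - (LBINT z. C / snd z * \<phi> z)"
proof -
  obtain C where C: "\<And>\<phi>. \<phi> \<in> Cc_infty half_plane \<Longrightarrow> (\<And>z. \<phi> z \<ge> 0) \<Longrightarrow>
     (LINT z|lebesgue_on half_plane. d (\<rho> z) * partial_x \<phi> z) \<ge> - (LINT z|lebesgue_on half_plane. C / snd z * \<phi> z)"
    using o unfolding one_sided_bound_def by blast
  have [measurable]: "(\<lambda>z. f' (r z)) \<in> borel_measurable borel" by (rule borel_measurable_compose_continuous_on_Icc[OF f' r(1,2)])
  have [measurable]: "(\<lambda>z::real \<times> real. snd z) \<in> borel_measurable borel"
    by (intro borel_measurable_continuous_onI continuous_intros)
  show ?thesis
  proof (intro exI[of _ C] ballI impI)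
    fix \<phi> assume \<phi>: "\<phi> \<in> Cc_infty half_plane" "\<forall>z. \<phi> z \<ge> 0"
    note cx = Cc_infty_half_planeD(2)[OF \<phi>(1)] and c = Cc_infty_half_planeD(1)[OF \<phi>(1)] and out = Cc_infty_half_planeD(4)[OF \<phi>(1)]
    have [measurable]: "partial_x \<phi> \<in> borel_measurable borel" "\<phi> \<in> borel_measurable borel"
      by (rule borel_measurable_continuous_onI[OF cx] borel_measurable_continuous_onI[OF c])+
    have 1: "(LINT z|lebesgue_on half_plane. d (\<rho> z) * partial_x \<phi> z) = (LBINT z. indicator half_plane z * f' (r z) * partial_x \<phi> z)"
    proof (rule integral_half_plane_eq)
      show "(\<lambda>z. indicator half_plane z * f' (r z) * partial_x \<phi> z) \<in> borel_measurable borel" by measurable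
      show "AE z in lebesgue_on half_plane. d (\<rho> z) * partial_x \<phi> z = indicator half_plane z * f' (r z) * partial_x \<phi> z"
        using ae unfolding AE_half_plane_iff by eventually_elim (use d r(2) in \<open>auto simp: indicator_def\<close>)
    qed simp
    have 2: "(LINT z|lebesgue_on half_plane. C / snd z * \<phi> z) = (LBINT z. C / snd z * \<phi> z)"
      by (rule integral_half_plane_eq) (use out in auto)
    show "(LBINT z. indicator half_plane z * f' (r z) * partial_x \<phi> z) \<ge> - (LBINT z. C / snd z * \<phi> z)"
      using C[OF \<phi>(1)] \<phi>(2) unfolding 1 2 by blast
  qed
qed

text \<open>Borel representatives are extended by \<open>0\<close> to the lower half plane, so that all integrals
  can be taken over the whole plane.\<close>

locale borel_solution =
  fixes R :: real and f f' :: "real \<Rightarrow> real" and C :: real and r :: "real \<times> real \<Rightarrow> real"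
  assumes borel: "r \<in> borel_measurable borel" and range: "\<And>z. r z \<in> {0..R}"
    and outside: "\<And>z. z \<notin> half_plane \<Longrightarrow> r z = 0"
    and integrable: "\<And>\<phi>. \<phi> \<in> Cc_infty half_plane \<Longrightarrow>
       integrable lborel (\<lambda>z. r z * partial_t \<phi> z + f (r z) * partial_x \<phi> z)"
    and weak: "\<And>\<phi>. \<phi> \<in> Cc_infty half_plane \<Longrightarrow>
       (LBINT z. r z * partial_t \<phi> z + f (r z) * partial_x \<phi> z) = 0"
    and one_sided: "\<And>\<phi>. \<phi> \<in> Cc_infty half_plane \<Longrightarrow> (\<And>z. \<phi> z \<ge> 0) \<Longrightarrow>
       (LBINT z. indicator half_plane z * f' (r z) * partial_x \<phi> z) \<ge> - (LBINT z. C / snd z * \<phi> z)"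

text \<open>Subtracting the two weak equations gives the one for the differences, and the tangent
  inequality at the values of \<open>r\<close> gives \<open>be_le_F\<close>; on the lower half plane
  both sides of it are 0. The factor 2 in the bound of \<open>f\<close> pays for the difference of
  two fluxes.\<close>

lemma oleinik_pair_of_solutions:
  assumes k: "smooth_step k" and L: "0 < L"
    and f: "continuous_on {0..R} f" "\<And>x. x \<in> {0..R} \<Longrightarrow> 2 * \<bar>f x\<bar> \<le> L" and RL: "R \<le> L"
    and f': "continuous_on {0..R} f'" "\<And>x. x \<in> {0..R} \<Longrightarrow> \<bar>f' x\<bar> \<le> L"
    and tangent: "\<And>x y. x \<in> {0..R} \<Longrightarrow> y \<in> {0..R} \<Longrightarrow> f' x * (x - y) \<le> f x - f y"
    and r: "borel_solution R f f' C r" and s: "borel_solution R f f' C' s"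
    and init: "\<And>\<epsilon>. \<epsilon> > 0 \<Longrightarrow> \<exists>\<tau>>0. AE t in lborel. 0 < t \<and> t < \<tau> \<longrightarrow> (\<integral>\<^sup>+y. ennreal \<bar>r (y, t) - s (y, t)\<bar> \<partial>lborel) \<le> ennreal \<epsilon>"
  shows "oleinik_pair k (\<lambda>z. r z - s z) (\<lambda>z. f (r z) - f (s z)) (\<lambda>z. indicator half_plane z * f' (r z)) L C"
proof -
  interpret r: borel_solution R f f' C r by (rule r)
  interpret s: borel_solution R f f' C' s by (rule s)
  note r = r.borel r.range r.outside r.integrable r.weak r.one_sided
  note s = s.borel s.range s.outside s.integrable s.weak
  note [measurable] = r(1) s(1) borel_measurable_compose_continuous_on_Icc[OF f(1) r(1,2)]
    borel_measurable_compose_continuous_on_Icc[OF f(1) s(1,2)] borel_measurable_compose_continuous_on_Icc[OF f'(1) r(1,2)]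
  interpret smooth_step k by (rule k)
  show ?thesis
  proof (unfold_locales)
    show "L > 0" by (rule L)
    show "(\<lambda>z. r z - s z) \<in> borel_measurable borel" by measurable
    show "(\<lambda>z. f (r z) - f (s z)) \<in> borel_measurable borel" by measurable
    show "(\<lambda>z. indicator half_plane z * f' (r z)) \<in> borel_measurable borel" by measurable
    show "\<bar>r w - s w\<bar> \<le> L" for w using r(2)[of w] s(2)[of w] RL by auto
    show "\<bar>f (r w) - f (s w)\<bar> \<le> L" for w using f(2)[OF r(2)[of w]] f(2)[OF s(2)[of w]] by linarith
    show "\<bar>indicator half_plane w * f' (r w)\<bar> \<le> L" for w
      using f'(2)[OF r(2)[of w]] L by (cases "w \<in> half_plane") simp_all
    show "indicator half_plane w * f' (r w) * (r w - s w) \<le> f (r w) - f (s w)" for w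
      using tangent[OF r(2)[of w] s(2)[of w]] r(3)[of w] s(3)[of w] by (cases "w \<in> half_plane") simp_all
    show "(LBINT z. (r z - s z) * partial_t \<phi> z + (f (r z) - f (s z)) * partial_x \<phi> z) = 0"
      if \<phi>: "\<phi> \<in> Cc_infty half_plane" for \<phi>
    proof -
      have "(LBINT z. (r z - s z) * partial_t \<phi> z + (f (r z) - f (s z)) * partial_x \<phi> z)
        = (LBINT z. (r z * partial_t \<phi> z + f (r z) * partial_x \<phi> z) - (s z * partial_t \<phi> z + f (s z) * partial_x \<phi> z))"
        by (rule arg_cong[where f="integral\<^sup>L lborel"]) (rule ext, simp only: left_diff_distrib diff_diff_eq2 add_diff_eq diff_add_eq diff_diff_eq add_ac)
      also have "\<dots> = (LBINT z. r z * partial_t \<phi> z + f (r z) * partial_x \<phi> z) - (LBINT z. s z * partial_t \<phi> z + f (s z) * partial_x \<phi> z)"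
        by (rule Bochner_Integration.integral_diff[OF r(4)[OF \<phi>] s(4)[OF \<phi>]])
      finally show ?thesis unfolding r(5)[OF \<phi>] s(5)[OF \<phi>] by (simp only: diff_self)
    qed
    show "(LBINT z. indicator half_plane z * f' (r z) * partial_x \<phi> z) \<ge> - (LBINT z. C / snd z * \<phi> z)"
      if "\<phi> \<in> Cc_infty half_plane" "\<And>z. \<phi> z \<ge> 0" for \<phi>
      by (rule r(6)[OF that])
    show "\<exists>\<tau>>0. AE t in lborel. 0 < t \<and> t < \<tau> \<longrightarrow> (\<integral>\<^sup>+y. ennreal \<bar>r (y, t) - s (y, t)\<bar> \<partial>lborel) \<le> ennreal \<epsilon>"
      if "\<epsilon> > 0" for \<epsilon>
      by (rule init[OF that])
  qed
qed

theorem theorem2p1: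
  fixes \<rho>\<^sub>0 v v' \<phi> f :: "real \<Rightarrow> real" and R K :: real
    and \<rho>\<^sub>1 \<rho>\<^sub>2 :: "real \<times> real \<Rightarrow> real"
  assumes "BV \<rho>\<^sub>0" and "integrable lebesgue \<rho>\<^sub>0" and "Linfty_norm \<rho>\<^sub>0 < \<infinity>"
    and "AE x in lebesgue. \<rho>\<^sub>0 x \<ge> 0"
    and "essentially_compact_support \<rho>\<^sub>0"
    and R_def: "R = real_of_ereal (Linfty_norm \<rho>\<^sub>0)"
    and v_deriv: "\<And>r. r \<in> {0..R} \<Longrightarrow> (v has_real_derivative v' r) (at r within {0..R})"
    and v_C1: "continuous_on {0..R} v'"
    and v_decreasing: "strict_antimono_on {0..R} v"
    and phi_def: "\<And>r. \<phi> r = r * v' r"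
    and "K \<ge> 0"
    and phi_bound: "\<And>r s. r \<in> {0..R} \<Longrightarrow> s \<in> {0..R} \<Longrightarrow> r \<noteq> s \<Longrightarrow>
           0 \<le> (\<phi> r - \<phi> s) / (v r - v s) \<and> (\<phi> r - \<phi> s) / (v r - v s) \<le> K"
    and f_def: "\<And>r. f r = r * v r"
    and "extended_entropy_solution R f \<rho>\<^sub>0 \<rho>\<^sub>1"
    and "extended_entropy_solution R f \<rho>\<^sub>0 \<rho>\<^sub>2"
  shows "AE z in lebesgue_on half_plane. \<rho>\<^sub>1 z = \<rho>\<^sub>2 z"
proof (cases "R > 0")
  \<comment> \<open>If R is not positive, {0..R} has at most one point, and the solutions agree
    because of their range.\<close>
  case False
  have "AE z in lebesgue_on half_plane. \<rho>\<^sub>1 z \<in> {0..R}" "AE z in lebesgue_on half_plane. \<rho>\<^sub>2 z \<in> {0..R}"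
    using assms(14,15) by (auto simp: extended_entropy_solution_def)
  then show ?thesis by eventually_elim (use False in auto)
next
  case True
  define f' where "f' r = v r + \<phi> r" for r
  have cv: "continuous_on {0..R} v" using v_deriv by (rule DERIV_continuous_on)
  have cf: "continuous_on {0..R} f" unfolding f_def[abs_def] by (intro continuous_intros cv)
  have cf': "continuous_on {0..R} f'" unfolding f'_def[abs_def] phi_def[abs_def] by (intro continuous_intros cv v_C1)
  have df: "(f has_real_derivative f' r) (at r within {0..R})" if "r \<in> {0..R}" for r
    unfolding f_def[abs_def] f'_def phi_def
    by (rule DERIV_cong[OF DERIV_mult[OF DERIV_ident v_deriv[OF that]]]) simp
  \<comment> \<open>Positivity of R enters here: in a nondegenerate interval the derivative within
    the interval is unique, also at the end points.\<close>
  have vd: "vector_derivative f (at r within {0..R}) = f' r" if "r \<in> {0..R}" for r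
    using df[OF that] that True
    by (intro vector_derivative_within_closed_interval) (auto simp: has_real_derivative_iff_has_vector_derivative)
  have mono: "f' s \<le> f' r" if "r \<in> {0..R}" "s \<in> {0..R}" "r \<le> s" for r s
  proof (cases "r = s")
    case False
    then have "v s < v r" using v_decreasing that by (auto simp: monotone_on_def)
    \<comment> \<open>The denominator is positive, so the lower bound 0 of the quotient says that
      \<phi> does not increase; \<open>v\<close> decreases as well, and so does their sum
      f'.\<close>
    moreover have "0 \<le> (\<phi> r - \<phi> s) / (v r - v s)" using phi_bound[of r s] that False by blast
    ultimately have "\<phi> s \<le> \<phi> r" by (simp add: zero_le_divide_iff)
    then show ?thesis using \<open>v s < v r\<close> by (simp add: f'_def)
  qed simp
  have sol: "\<exists>r C. borel_solution R f f' C r \<and> (AE z in lebesgue_on half_plane. \<rho> z = r z)"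
    if "extended_entropy_solution R f \<rho>\<^sub>0 \<rho>" for \<rho>
  proof -
    have \<rho>: "\<rho> \<in> borel_measurable (lebesgue_on half_plane)" "AE z in lebesgue_on half_plane. \<rho> z \<in> {0..R}"
      "weak_solution f \<rho>" "one_sided_bound (\<lambda>r. vector_derivative f (at r within {0..R})) \<rho>"
      using that unfolding extended_entropy_solution_def Linfty_L1_Linfty_def by simp_all
    obtain r where r: "r \<in> borel_measurable borel" "\<And>z. r z \<in> {0..R}" "\<And>z. z \<notin> half_plane \<Longrightarrow> r z = 0"
      "AE z in lebesgue_on half_plane. \<rho> z = r z"
      by (rule borel_representative[OF \<rho>(1,2) less_imp_le[OF True]]) blast
    have f0: "f 0 = 0" by (simp add: f_def)
    obtain C where C: "\<forall>\<phi>\<in>Cc_infty half_plane. (\<forall>z. \<phi> z \<ge> 0) \<longrightarrow>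
        (LBINT z. indicator half_plane z * f' (r z) * partial_x \<phi> z) \<ge> - (LBINT z. C / snd z * \<phi> z)"
      using one_sided_bound_representative[OF \<rho>(4) vd cf' r] ..
    have "borel_solution R f f' C r"
    proof unfold_locales
      show "r \<in> borel_measurable borel" "\<And>z. r z \<in> {0..R}" "\<And>z. z \<notin> half_plane \<Longrightarrow> r z = 0" by (fact r)+
    next
      fix \<phi> assume \<phi>: "\<phi> \<in> Cc_infty half_plane"
      note w = weak_solution_representative[OF \<rho>(3) f0 cf r \<phi>]
      show "integrable lborel (\<lambda>z. r z * partial_t \<phi> z + f (r z) * partial_x \<phi> z)" by (rule w(1))
      show "(LBINT z. r z * partial_t \<phi> z + f (r z) * partial_x \<phi> z) = 0" by (rule w(2))
      show "(LBINT z. indicator half_plane z * f' (r z) * partial_x \<phi> z) \<ge> - (LBINT z. C / snd z * \<phi> z)"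
        if "\<And>z. \<phi> z \<ge> 0" using C \<phi> that by simp
    qed
    then show ?thesis using r(4) by (intro exI conjI)
  qed
  obtain r1 C1 where r1: "borel_solution R f f' C1 r1" and ae1: "AE z in lebesgue_on half_plane. \<rho>\<^sub>1 z = r1 z"
    using sol[OF assms(14)] by (elim exE conjE)
  obtain r2 C2 where r2: "borel_solution R f f' C2 r2" and ae2: "AE z in lebesgue_on half_plane. \<rho>\<^sub>2 z = r2 z"
    using sol[OF assms(15)] by (elim exE conjE)
  have init: "\<exists>\<tau>>0. AE s in lborel. 0 < s \<and> s < \<tau> \<longrightarrow> (\<integral>\<^sup>+y. ennreal \<bar>r1 (y, s) - r2 (y, s)\<bar> \<partial>lborel) \<le> ennreal \<epsilon>"
    if "\<epsilon> > 0" for \<epsilon>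
    by (rule attains_initial_datum_diff_small[OF assms(2) _ _ ae1 ae2 that])
       (use assms(14,15) in \<open>simp_all add: extended_entropy_solution_def\<close>)
  obtain bf where bf: "bf \<ge> 0" "\<And>x. x \<in> {0..R} \<Longrightarrow> \<bar>f x\<bar> \<le> bf" using continuous_on_Icc_bounded[OF cf] by blast
  obtain bf' where bf': "bf' \<ge> 0" "\<And>x. x \<in> {0..R} \<Longrightarrow> \<bar>f' x\<bar> \<le> bf'" using continuous_on_Icc_bounded[OF cf'] by blast
  \<comment> \<open>One constant dominates the density difference, the flux difference and f'; its
    summand R makes it positive.\<close>
  define L where "L = R + 2 * bf + bf'"
  have L: "0 < L" "R \<le> L" "2 * \<bar>f x\<bar> \<le> L" "\<bar>f' x\<bar> \<le> L" if "x \<in> {0..R}" for x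
    using True bf(1) bf(2)[OF that] bf'(1) bf'(2)[OF that] unfolding L_def by linarith+
  obtain k where k: "smooth_step k" using ex_smooth_step by blast
  interpret smooth_step k by (rule k)
  have zero: "0 \<in> {0..R}" using True by simp
  have tangent: "f' x * (x - y) \<le> f x - f y" if "x \<in> {0..R}" "y \<in> {0..R}" for x y
    by (rule concave_above_tangent[OF df mono that])
  have pair: "oleinik_pair k (\<lambda>z. r z - s z) (\<lambda>z. f (r z) - f (s z)) (\<lambda>z. indicator half_plane z * f' (r z)) L C"
    if "borel_solution R f f' C r" "borel_solution R f f' C' s"
      "\<And>\<epsilon>. \<epsilon> > 0 \<Longrightarrow> \<exists>\<tau>>0. AE t in lborel. 0 < t \<and> t < \<tau> \<longrightarrow> (\<integral>\<^sup>+y. ennreal \<bar>r (y, t) - s (y, t)\<bar> \<partial>lborel) \<le> ennreal \<epsilon>"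
    for r s C C'
    by (rule oleinik_pair_of_solutions[OF k L(1)[OF zero] cf L(3) L(2)[OF zero] cf' L(4) tangent that])
  note P1 = pair[OF r1 r2 init]
  \<comment> \<open>With the roles exchanged, the speed is taken from \<open>r2\<close>, together
    with the constant of its own one-sided bound.\<close>
  have P2: "oleinik_pair k (\<lambda>z. r2 z - r1 z) (\<lambda>z. f (r2 z) - f (r1 z)) (\<lambda>z. indicator half_plane z * f' (r2 z)) L C2"
    by (rule pair[OF r2 r1]) (subst abs_minus_commute, rule init)
  let ?e = "\<lambda>z. r1 z - r2 z" and ?F = "\<lambda>z. f (r1 z) - f (r2 z)"
  note e = oleinik_pair.e[OF P1] and F = oleinik_pair.F[OF P1]
  have "AE z in lborel. snd z > 0 \<longrightarrow> ?e z = 0"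
  proof (rule AE_eq_0_if_pot_tendsto_0[OF e F])
    fix S :: real assume S: "S > 0"
    note cD = continuous_pot[OF e F]
    \<comment> \<open>The potential is odd under a common sign change of both arguments, so the
      positive part for the exchanged pair is the negative part for the original one.\<close>
    have "pot n (\<lambda>z. r2 z - r1 z) (\<lambda>z. f (r2 z) - f (r1 z)) z = - pot n ?e ?F z" for n z
      using pot_minus[of n ?e ?F z] by simp
    with oleinik_pair.pos_part_tendsto_0[OF P2 S]
    have "(\<lambda>n. LBINT z. indicator (region S) z * max 0 (- pot n ?e ?F z)) \<longlonglongrightarrow> 0" by simp
    note neg = this
    show "(\<lambda>n. LBINT z. indicator (region S) z * \<bar>pot n ?e ?F z\<bar>) \<longlonglongrightarrow> 0"
    proof (rule tendsto_integral_abs_region)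
      show "continuous_on UNIV (pot n ?e ?F)" for n by (rule cD)
      show "(\<lambda>n. LBINT z. indicator (region S) z * max 0 (pot n ?e ?F z)) \<longlonglongrightarrow> 0"
        by (rule oleinik_pair.pos_part_tendsto_0[OF P1 S])
    qed (rule neg)
  qed
  then have "AE z in lebesgue_on half_plane. r1 z = r2 z"
    unfolding AE_half_plane_iff by eventually_elim auto
  with ae1 ae2 show ?thesis by eventually_elim simp
qed

end
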